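(* Let $\kappa>1$ be an arbitrary ordinal. Suppose $f\colon\pi\to G$ is a group homomorphism inducing an isomorphism $H_1(\pi)\to H_1(G)$. If $\kappa$ is an infinite ordinal, suppose $G$ is finitely generated. Then $f$ induces an isomorphism $\widehat\pi/\widehat\pi_\kappa\to\widehat G/\widehat G_\kappa$ if and only if $f$ induces an epimorphism $$H_2(\widehat\pi)\to H_2(\widehat G)/\mathrm{Ker}\{H_2(\widehat G)\to H_2(\widehat G/\widehat G_\lambda)\}$$ for all ordinals $\lambda<\kappa$.
   Context: $H_*$ is integral (group) homology. Ordinals indexing lower central series are $\ge 1$; a discrete ordinal is a successor ordinal. For a group $G$: $G_1=G$, $G_\kappa=[G,G_{\kappa-1}]$ if $\kappa>1$ is discrete, and $G_\kappa=\bigcap_{\lambda<\kappa}G_\lambda$ if $\kappa$ is a limit ordinal. A group homomorphism is 2-connected if it induces an isomorphism on $H_1(-;\mathbb Z)$ and an epimorphism on $H_2(-;\mathbb Z)$. A group $L$ is local if for every 2-connected homomorphism $\alpha\colon A\to B$ between finitely presented groups and every homomorphism $f\colon A\to L$ there is a unique homomorphism $g\colon B\to L$ with $g\circ\alpha=f$. The homology localization of $G$ is the (functorial, essentially unique, always existing) homomorphism $G\to\widehat G$ with $\widehat G$ local such that every homomorphism from $G$ to a local group factors uniquely through $G\to\widehat G$. Write $\widehat G_\kappa=(\widehat G)_\kappa$. *)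

theory Defs
  imports "HOL-Algebra.Free_Abelian_Groups" "HOL-Algebra.Generated_Groups"
begin

section \<open>Maps induced on quotients\<close>

text \<open>The map \<open>N x \<mapsto> M f(x)\<close> from \<open>G Mod N\<close> to \<open>H Mod M\<close> induced by a homomorphism \<open>f\<close> with
  \<open>f ` N \<subseteq> M\<close>; under these hypotheses all cosets in the union below are equal.\<close>

definition quotient_map ::
  "('b, 'n) monoid_scheme \<Rightarrow> 'b set \<Rightarrow> ('a \<Rightarrow> 'b) \<Rightarrow> 'a set \<Rightarrow> 'b set"
  where "quotient_map H M f X = (\<Union>x\<in>X. r_coset H M (f x))"


section \<open>Integral homology of groups\<close>

text \<open>The inhomogeneous bar complex: \<open>[x\<^sub>1, \<dots>, x\<^sub>n]\<close> is the bar generator \<open>[x\<^sub>1|\<dots>|x\<^sub>n]\<close>, and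
  \<open>\<partial>[x\<^sub>1|\<dots>|x\<^sub>n] = [x\<^sub>2|\<dots>|x\<^sub>n] + (\<Sum>0<i<n. (-1)\<^sup>i [x\<^sub>1|\<dots>|x\<^sub>i x\<^sub>i\<^sub>+\<^sub>1|\<dots>|x\<^sub>n]) + (-1)\<^sup>n [x\<^sub>1|\<dots>|x\<^sub>n\<^sub>-\<^sub>1]\<close>.\<close>

definition bar_chains :: "('a, 'm) monoid_scheme \<Rightarrow> nat \<Rightarrow> ('a list \<Rightarrow>\<^sub>0 int) monoid"
  where "bar_chains G n = free_Abelian_group {xs. length xs = n \<and> set xs \<subseteq> carrier G}"

definition bar_face :: "('a, 'm) monoid_scheme \<Rightarrow> nat \<Rightarrow> 'a list \<Rightarrow> 'a list"
  where "bar_face G i xs =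
    (if i = 0 then tl xs
     else if i = length xs then butlast xs
     else take (i - 1) xs @ [xs ! (i - 1) \<otimes>\<^bsub>G\<^esub> xs ! i] @ drop (i + 1) xs)"

definition bar_boundary ::
  "('a, 'm) monoid_scheme \<Rightarrow> ('a list \<Rightarrow>\<^sub>0 int) \<Rightarrow> ('a list \<Rightarrow>\<^sub>0 int)"
  where "bar_boundary G =
    frag_extend (\<lambda>xs. if xs = [] then 0
      else (\<Sum>i\<le>length xs. frag_cmul ((-1) ^ i) (frag_of (bar_face G i xs))))"

text \<open>In degree 0 the boundary is zero, so the truncation \<open>0 - 1 = 0\<close> is harmless.\<close>

definition bar_cycles :: "('a, 'm) monoid_scheme \<Rightarrow> nat \<Rightarrow> ('a list \<Rightarrow>\<^sub>0 int) set"
  where "bar_cycles G n = kernel (bar_chains G n) (bar_chains G (n - 1)) (bar_boundary G)"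

definition bar_boundaries :: "('a, 'm) monoid_scheme \<Rightarrow> nat \<Rightarrow> ('a list \<Rightarrow>\<^sub>0 int) set"
  where "bar_boundaries G n = bar_boundary G ` carrier (bar_chains G (n + 1))"

definition group_homology ::
  "nat \<Rightarrow> ('a, 'm) monoid_scheme \<Rightarrow> ('a list \<Rightarrow>\<^sub>0 int) set monoid"
  where "group_homology n G =
    (bar_chains G n)\<lparr>carrier := bar_cycles G n\<rparr> Mod bar_boundaries G n"

definition group_homology_map ::
  "nat \<Rightarrow> ('b, 'n) monoid_scheme \<Rightarrow> ('a \<Rightarrow> 'b)
    \<Rightarrow> ('a list \<Rightarrow>\<^sub>0 int) set \<Rightarrow> ('b list \<Rightarrow>\<^sub>0 int) set"
  where "group_homology_map n H f =
    quotient_map ((bar_chains H n)\<lparr>carrier := bar_cycles H n\<rparr>) (bar_boundaries H n)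
      (frag_extend (\<lambda>xs. frag_of (map f xs)))"

definition two_connected ::
  "('a, 'm) monoid_scheme \<Rightarrow> ('b, 'n) monoid_scheme \<Rightarrow> ('a \<Rightarrow> 'b) \<Rightarrow> bool"
  where "two_connected G H f \<longleftrightarrow>
    f \<in> hom G H \<and>
    group_homology_map 1 H f \<in> iso (group_homology 1 G) (group_homology 1 H) \<and>
    group_homology_map 2 H f \<in> epi (group_homology 2 G) (group_homology 2 H)"


section \<open>Finite generation and finite presentation\<close>

definition finitely_generated_group :: "('a, 'm) monoid_scheme \<Rightarrow> bool"
  where "finitely_generated_group G \<longleftrightarrow>
    group G \<and> (\<exists>S. finite S \<and> S \<subseteq> carrier G \<and> generate G S = carrier G)"

text \<open>Words in the letters \<open>s\<close>, written \<open>(s, True)\<close>, and their formal inverses, written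
  \<open>(s, False)\<close>.\<close>

type_synonym 'i gword = "('i \<times> bool) list"

definition gwords :: "'i set \<Rightarrow> 'i gword set"
  where "gwords S = {w. fst ` set w \<subseteq> S}"

inductive gword_eq :: "'i set \<Rightarrow> 'i gword set \<Rightarrow> 'i gword \<Rightarrow> 'i gword \<Rightarrow> bool"
  for S :: "'i set" and R :: "'i gword set" where
  refl: "w \<in> gwords S \<Longrightarrow> gword_eq S R w w"
| sym: "gword_eq S R u v \<Longrightarrow> gword_eq S R v u"
| trans: "gword_eq S R u v \<Longrightarrow> gword_eq S R v w \<Longrightarrow> gword_eq S R u w"
| cancel: "u \<in> gwords S \<Longrightarrow> v \<in> gwords S \<Longrightarrow> s \<in> S
    \<Longrightarrow> gword_eq S R (u @ [(s, b), (s, \<not> b)] @ v) (u @ v)"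
| relator: "u \<in> gwords S \<Longrightarrow> v \<in> gwords S \<Longrightarrow> r \<in> R \<Longrightarrow> gword_eq S R (u @ r @ v) (u @ v)"

definition gword_class :: "'i set \<Rightarrow> 'i gword set \<Rightarrow> 'i gword \<Rightarrow> 'i gword set"
  where "gword_class S R w = {v. gword_eq S R w v}"

text \<open>The group \<open>\<langle>S | R\<rangle>\<close>.\<close>

definition presented_group :: "'i set \<Rightarrow> 'i gword set \<Rightarrow> 'i gword set monoid"
  where "presented_group S R =
    \<lparr>carrier = gword_class S R ` gwords S,
     monoid.mult = (\<lambda>X Y. \<Union>u\<in>X. \<Union>v\<in>Y. gword_class S R (u @ v)),
     one = gword_class S R []\<rparr>"

text \<open>Any finite set of generators can be named by natural numbers.\<close>

definition finitely_presented_group :: "('a, 'm) monoid_scheme \<Rightarrow> bool"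
  where "finitely_presented_group G \<longleftrightarrow>
    group G \<and> (\<exists>(S :: nat set) R. finite S \<and> finite R \<and> R \<subseteq> gwords S \<and> G \<cong> presented_group S R)"


section \<open>Local groups and homology localization\<close>

text \<open>\<open>f\<close> factors uniquely through \<open>\<alpha> : A \<rightarrow> B\<close> as a homomorphism to \<open>L\<close>. Homomorphisms are
  functions on the whole type, so uniqueness is up to the values outside \<open>carrier B\<close>.\<close>

definition factors_uniquely ::
  "('a, 'm) monoid_scheme \<Rightarrow> ('b, 'n) monoid_scheme \<Rightarrow> ('a \<Rightarrow> 'b)
    \<Rightarrow> ('c, 'p) monoid_scheme \<Rightarrow> ('a \<Rightarrow> 'c) \<Rightarrow> bool"
  where "factors_uniquely A B \<alpha> L f \<longleftrightarrow>
    (\<exists>!g. g \<in> extensional (carrier B) \<and> g \<in> hom B L \<and> (\<forall>a\<in>carrier A. g (\<alpha> a) = f a))"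

text \<open>A finitely presented group is countable, so up to isomorphism its carrier is a set of
  natural numbers; hence \<open>A\<close> and \<open>B\<close> range over all finitely presented groups.\<close>

definition local_group :: "('a, 'm) monoid_scheme \<Rightarrow> bool"
  where "local_group L \<longleftrightarrow>
    group L \<and>
    (\<forall>(A :: nat monoid) (B :: nat monoid) \<alpha> f.
      finitely_presented_group A \<and> finitely_presented_group B \<and> two_connected A B \<alpha> \<and> f \<in> hom A L
      \<longrightarrow> factors_uniquely A B \<alpha> L f)"

text \<open>\<open>\<eta> : G \<rightarrow> E\<close> is a homology localization. The local test groups \<open>L\<close> live on a type depending
  on those of \<open>G\<close> and \<open>E\<close>, but the universal property then holds for local groups \<open>L\<close> on any type:
  there are only countably many 2-connected homomorphisms between finitely presented groups up to
  isomorphism, so every subset of \<open>L\<close> of cardinality at most an infinite \<open>\<mm>\<close> lies in a local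
  subgroup of \<open>L\<close> of cardinality at most \<open>\<mm>\<close>. A factorization of a homomorphism \<open>G \<rightarrow> L\<close>, and the
  comparison of two homomorphisms \<open>E \<rightarrow> L\<close>, thus take place in a local subgroup of cardinality at
  most \<open>max \<bar>G\<bar> \<aleph>\<^sub>0\<close>, respectively \<open>max \<bar>E\<bar> \<aleph>\<^sub>0\<close>, which has a copy on the type used here.\<close>

definition homology_localization :: "'a monoid \<Rightarrow> 'b monoid \<Rightarrow> ('a \<Rightarrow> 'b) \<Rightarrow> bool"
  where "homology_localization G E \<eta> \<longleftrightarrow>
    group G \<and> local_group E \<and> \<eta> \<in> hom G E \<and>
    (\<forall>(L :: ('a + 'b + nat) monoid) f.
      local_group L \<and> f \<in> hom G L \<longrightarrow> factors_uniquely G E \<eta> L f)"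


section \<open>The transfinite lower central series\<close>

text \<open>Ordinals \<open>\<ge> 1\<close> are encoded as elements of an arbitrary well-ordered type: \<open>\<kappa>\<close> stands for
  the ordinal \<open>1 + otype {..<\<kappa>}\<close>. In particular the least element of the type stands for the ordinal
  1 (on type \<^typ>\<open>nat\<close>, the element \<open>k\<close> stands for \<open>k + 1\<close>), the elements below \<open>\<kappa>\<close> stand exactly
  for the ordinals \<open>\<lambda>\<close> with \<open>1 \<le> \<lambda> < \<kappa>\<close>, and \<open>\<kappa>\<close> stands for an infinite ordinal iff \<open>{..<\<kappa>}\<close> is
  infinite.\<close>

definition ordinal_one :: "'o::wellorder"
  where "ordinal_one = (LEAST \<kappa>. True)"

definition is_predecessor :: "'o::wellorder \<Rightarrow> 'o \<Rightarrow> bool"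
  where "is_predecessor \<mu> \<kappa> \<longleftrightarrow> \<mu> < \<kappa> \<and> (\<forall>\<nu><\<kappa>. \<nu> \<le> \<mu>)"

definition commutator_subgroup :: "('a, 'm) monoid_scheme \<Rightarrow> 'a set \<Rightarrow> 'a set \<Rightarrow> 'a set"
  where "commutator_subgroup G H K =
    generate G (\<Union>h\<in>H. \<Union>k\<in>K. {h \<otimes>\<^bsub>G\<^esub> k \<otimes>\<^bsub>G\<^esub> inv\<^bsub>G\<^esub> h \<otimes>\<^bsub>G\<^esub> inv\<^bsub>G\<^esub> k})"

lemma is_predecessor_the: "is_predecessor \<mu> \<kappa> \<Longrightarrow> (THE \<mu>. is_predecessor \<mu> \<kappa>) = \<mu>"
  unfolding is_predecessor_def by (rule the_equality) (auto intro: antisym)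

function lower_central :: "('a, 'm) monoid_scheme \<Rightarrow> 'o::wellorder \<Rightarrow> 'a set"
  where "lower_central G \<kappa> =
    (if \<kappa> = ordinal_one then carrier G
     else if \<exists>\<mu>. is_predecessor \<mu> \<kappa>
     then commutator_subgroup G (carrier G) (lower_central G (THE \<mu>. is_predecessor \<mu> \<kappa>))
     else (\<Inter>\<mu>\<in>{..<\<kappa>}. lower_central G \<mu>))"
  by pat_completeness auto
termination
proof (relation "inv_image {(x, y). x < y} snd", goal_cases)
  case 1
  show ?case by (intro wf_inv_image wf)
next
  case (2 G \<kappa>)
  then obtain \<mu> where "is_predecessor \<mu> \<kappa>" by blast
  then show ?case by (simp add: is_predecessor_the) (simp add: is_predecessor_def)
next
  case (3 G \<kappa> \<mu>)
  then show ?case by simp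
qed

text \<open>The defining equation loops as a rewrite rule.\<close>

declare lower_central.simps [simp del]

abbreviation lower_central_quotient :: "('a, 'm) monoid_scheme \<Rightarrow> 'o::wellorder \<Rightarrow> 'a set monoid"
  where "lower_central_quotient G \<kappa> \<equiv> G Mod lower_central G \<kappa>"

text \<open>\<open>Ker {H\<^sub>2(G) \<rightarrow> H\<^sub>2(G/G\<^sub>\<kappa>)}\<close> for the map induced by the projection.\<close>

definition H2_kernel ::
  "('a, 'm) monoid_scheme \<Rightarrow> 'o::wellorder \<Rightarrow> ('a list \<Rightarrow>\<^sub>0 int) set set"
  where "H2_kernel G \<kappa> =
    kernel (group_homology 2 G) (group_homology 2 (lower_central_quotient G \<kappa>))
      (group_homology_map 2 (lower_central_quotient G \<kappa>) (r_coset G (lower_central G \<kappa>)))"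

end

theory Submission
  imports Defs
begin

text \<open>Abelian groups are local, so \<open>G \<rightarrow> G_hat\<close> is an isomorphism on \<open>H\<^sub>1\<close>, and hence so is
  \<open>f_hat\<close>. For a normal subgroup \<open>N\<close> of a group \<open>\<Gamma>\<close> there is an exact sequence
  \<open>H\<^sub>2(\<Gamma>) \<rightarrow> H\<^sub>2(\<Gamma>/N) \<rightarrow> N/[\<Gamma>, N] \<rightarrow> H\<^sub>1(\<Gamma>)\<close>. With \<open>N = \<Gamma>\<^sub>\<mu>\<close> it shows that, once \<open>f_hat\<close> is an
  isomorphism modulo the \<open>\<mu>\<close>-th terms of the lower central series, the condition on \<open>H\<^sub>2\<close> for \<open>\<mu>\<close> is
  equivalent to injectivity modulo the next terms; surjectivity carries over by commutator calculus.
  At limit ordinals injectivity is clear, and surjectivity holds because \<open>f_hat\<close> itself is onto when \<open>G\<close>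
  is finitely generated: the images of generators of \<open>G\<close> solve equations over the image of \<open>f_hat\<close>
  that have unique solutions in local groups.\<close>

text \<open>The halves of an isomorphism modulo \<open>\<kappa>\<close> are carried separately:
  surjectivity climbs a successor step with the help of the abelianization alone, so only
  injectivity is tied to second homology. The exact sequence is never built as a sequence of groups.
  What is used is one equivalence: for \<open>x\<close> in N, the chain [x] bounds a 2-chain of
  \<Gamma> that becomes trivial over \<Gamma>/N exactly when \<open>x\<close> lies in [\<Gamma>, N].
  Trivial has to mean a boundary plus a multiple of [1|1], since the bar complex is not normalized.
  At limits, solving equations only places the image of \<open>G\<close> inside the image of
  \<open>f_hat\<close>. The rest of \<open>G_hat\<close> follows because the image of a homomorphism
  between local groups is again local, so the universal property applies to that image as a target.
  Solvability of the equations rests on H_2 of a free group being zero, which makes every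
  endomorphism that is the identity on the abelianization 2-connected.\<close>

lemma (in group) inv_mult_cancel_left:
  assumes "x \<in> carrier G" "y \<in> carrier G"
  shows "inv x \<otimes> (x \<otimes> y) = y" and "x \<otimes> (inv x \<otimes> y) = y"
  using assms by (simp_all flip: m_assoc)

subsection \<open>Homomorphisms between quotients\<close>

lemma (in normal) r_coset_eq_iff:
  assumes "x \<in> carrier G" "y \<in> carrier G"
  shows "H #> x = H #> y \<longleftrightarrow> x \<otimes> inv y \<in> H"
proof
  assume "H #> x = H #> y"
  then have "x \<in> H #> y"
    using rcos_self[OF assms(1) is_subgroup] by simp
  then show "x \<otimes> inv y \<in> H"
    using rcos_module[OF is_group assms(2,1)] by simp
next
  assume "x \<otimes> inv y \<in> H"
  then have "x \<in> H #> y"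
    using rcos_module[OF is_group assms(2,1)] by simp
  then show "H #> x = H #> y"
    using repr_independence[OF _ assms(2) is_subgroup] by simp
qed

lemma (in normal) r_coset_eq_self_iff:
  "x \<in> carrier G \<Longrightarrow> H #> x = H \<longleftrightarrow> x \<in> H"
  using r_coset_eq_iff[of x \<one>] subset by simp

lemma (in normal) r_coset_group_hom: "group_hom G (G Mod H) ((#>) H)"
  by (intro group_hom.intro group_hom_axioms.intro is_group factorgroup_is_group r_coset_hom_Mod)

lemma (in normal) kernel_r_coset: "kernel G (G Mod H) ((#>) H) = H"
  using r_coset_eq_self_iff subset by (auto simp: kernel_def)

lemma quotient_map_r_coset:
  assumes "group G" "group H" "N \<lhd> G" "M \<lhd> H" "f \<in> hom G H" "f ` N \<subseteq> M" "x \<in> carrier G"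
  shows "quotient_map H M f (N #>\<^bsub>G\<^esub> x) = M #>\<^bsub>H\<^esub> f x"
proof -
  interpret f: group_hom G H f
    by (intro group_hom.intro group_hom_axioms.intro assms)
  interpret N: normal N G by fact
  interpret M: normal M H by fact
  have "M #>\<^bsub>H\<^esub> f y = M #>\<^bsub>H\<^esub> f x" if y: "y \<in> N #>\<^bsub>G\<^esub> x" for y
  proof -
    obtain n where n: "n \<in> N" "y = n \<otimes>\<^bsub>G\<^esub> x"
      using y by (auto simp: r_coset_def)
    then have "n \<in> carrier G" using N.subset by blast
    then have "f y \<otimes>\<^bsub>H\<^esub> inv\<^bsub>H\<^esub> f x = f n"
      using n assms(7) by (simp add: f.H.m_assoc)
    then show ?thesis
      using n assms(6,7) \<open>n \<in> carrier G\<close> by (subst M.r_coset_eq_iff) auto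
  qed
  moreover have "x \<in> N #>\<^bsub>G\<^esub> x"
    using assms(7) N.is_subgroup by (rule f.G.rcos_self)
  ultimately show ?thesis
    unfolding quotient_map_def by blast
qed

lemma quotient_map_hom:
  assumes "group G" "group H" "N \<lhd> G" "M \<lhd> H" "f \<in> hom G H" "f ` N \<subseteq> M"
  shows "quotient_map H M f \<in> hom (G Mod N) (H Mod M)"
proof (rule homI)
  interpret N: normal N G by fact
  interpret M: normal M H by fact
  note q = quotient_map_r_coset[OF assms]
  show "quotient_map H M f X \<in> carrier (H Mod M)" if "X \<in> carrier (G Mod N)" for X
    using that q hom_in_carrier[OF assms(5)] by (auto simp: carrier_FactGroup)
  fix X Y
  assume "X \<in> carrier (G Mod N)" "Y \<in> carrier (G Mod N)"
  then obtain x y where xy: "x \<in> carrier G" "y \<in> carrier G" "X = N #>\<^bsub>G\<^esub> x" "Y = N #>\<^bsub>G\<^esub> y"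
    by (auto simp: carrier_FactGroup)
  then show "quotient_map H M f (X \<otimes>\<^bsub>G Mod N\<^esub> Y)
      = quotient_map H M f X \<otimes>\<^bsub>H Mod M\<^esub> quotient_map H M f Y"
    using hom_in_carrier[OF assms(5)] by (simp add: q N.rcos_sum M.rcos_sum hom_mult[OF assms(5)])
qed

text \<open>Together with \<open>surj_modulo\<close> this splits an isomorphism of quotients into
  two conditions on representatives, which the induction along the lower central series treats by
  different arguments.\<close>

definition inj_modulo :: "('a, 'm) monoid_scheme \<Rightarrow> 'a set \<Rightarrow> 'b set \<Rightarrow> ('a \<Rightarrow> 'b) \<Rightarrow> bool"
  where "inj_modulo G N M f \<longleftrightarrow> (\<forall>x\<in>carrier G. f x \<in> M \<longrightarrow> x \<in> N)"

definition surj_modulo ::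
  "('a, 'm) monoid_scheme \<Rightarrow> ('b, 'n) monoid_scheme \<Rightarrow> 'b set \<Rightarrow> ('a \<Rightarrow> 'b) \<Rightarrow> bool"
  where "surj_modulo G H M f \<longleftrightarrow> (\<forall>y\<in>carrier H. \<exists>x\<in>carrier G. y \<otimes>\<^bsub>H\<^esub> inv\<^bsub>H\<^esub> f x \<in> M)"

lemma quotient_map_iso_iff:
  assumes "group G" "group H" "N \<lhd> G" "M \<lhd> H" "f \<in> hom G H" "f ` N \<subseteq> M"
  shows "quotient_map H M f \<in> iso (G Mod N) (H Mod M) \<longleftrightarrow>
    inj_modulo G N M f \<and> surj_modulo G H M f"
proof -
  interpret f: group_hom G H f
    by (intro group_hom.intro group_hom_axioms.intro assms)
  interpret N: normal N G by fact
  interpret M: normal M H by fact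
  interpret q: group_hom "G Mod N" "H Mod M" "quotient_map H M f"
    by (intro group_hom.intro group_hom_axioms.intro quotient_map_hom assms
        N.factorgroup_is_group M.factorgroup_is_group)
  note q = quotient_map_r_coset[OF assms]
  have "(\<forall>X\<in>carrier (G Mod N). quotient_map H M f X = \<one>\<^bsub>H Mod M\<^esub> \<longrightarrow> X = \<one>\<^bsub>G Mod N\<^esub>)
      \<longleftrightarrow> inj_modulo G N M f"
    unfolding inj_modulo_def
    by (auto simp: carrier_FactGroup q M.r_coset_eq_self_iff N.r_coset_eq_self_iff)
  moreover have "carrier (H Mod M) \<subseteq> quotient_map H M f ` carrier (G Mod N)
      \<longleftrightarrow> surj_modulo G H M f"
  proof -
    have "M #>\<^bsub>H\<^esub> y \<in> quotient_map H M f ` carrier (G Mod N)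
        \<longleftrightarrow> (\<exists>x\<in>carrier G. y \<otimes>\<^bsub>H\<^esub> inv\<^bsub>H\<^esub> f x \<in> M)" if "y \<in> carrier H" for y
      using that by (auto simp: carrier_FactGroup q image_iff M.r_coset_eq_iff)
    then show ?thesis
      unfolding surj_modulo_def carrier_FactGroup[of H M] image_subset_iff by blast
  qed
  ultimately show ?thesis
    using q.iso_iff by blast
qed

text \<open>Brings the condition of the theorem, an epimorphism onto a quotient of second homology,
  into the form \<open>surj_modulo\<close>, with the outer cosets removed.\<close>

lemma r_coset_comp_epi_iff:
  assumes "group A" "K \<lhd> B" "h \<in> hom A B"
  shows "r_coset B K \<circ> h \<in> epi A (B Mod K) \<longleftrightarrow> surj_modulo A B K h"
proof -
  interpret K: normal K B by fact
  have "r_coset B K \<circ> h \<in> hom A (B Mod K)"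
    using hom_compose[OF assms(3) K.r_coset_hom_Mod] .
  moreover have "K #>\<^bsub>B\<^esub> y \<in> (r_coset B K \<circ> h) ` carrier A
      \<longleftrightarrow> (\<exists>x\<in>carrier A. y \<otimes>\<^bsub>B\<^esub> inv\<^bsub>B\<^esub> h x \<in> K)" if "y \<in> carrier B" for y
    using that hom_in_carrier[OF assms(3)] by (auto simp: image_iff K.r_coset_eq_iff)
  ultimately show ?thesis
    unfolding surj_modulo_def epi_iff_subset carrier_FactGroup[of B K] image_subset_iff by blast
qed

subsection \<open>Commutator subgroups\<close>

abbreviation commutator :: "('a, 'm) monoid_scheme \<Rightarrow> 'a \<Rightarrow> 'a \<Rightarrow> 'a"
  where "commutator G x y \<equiv> x \<otimes>\<^bsub>G\<^esub> y \<otimes>\<^bsub>G\<^esub> inv\<^bsub>G\<^esub> x \<otimes>\<^bsub>G\<^esub> inv\<^bsub>G\<^esub> y"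

lemma commutator_subgroup_carrier: "commutator_subgroup G (carrier G) (carrier G) = derived G (carrier G)"
  by (simp add: commutator_subgroup_def derived_def)

lemma (in group) commutator_in_commutator_subgroup:
  "h \<in> H \<Longrightarrow> k \<in> K \<Longrightarrow> commutator G h k \<in> commutator_subgroup G H K"
  unfolding commutator_subgroup_def by (rule generate.incl) blast

lemma (in group) commutator_subgroup_subset_iff:
  assumes "subgroup S G"
  shows "commutator_subgroup G H K \<subseteq> S \<longleftrightarrow> (\<forall>h\<in>H. \<forall>k\<in>K. commutator G h k \<in> S)"
proof
  assume "commutator_subgroup G H K \<subseteq> S"
  then show "\<forall>h\<in>H. \<forall>k\<in>K. commutator G h k \<in> S"
    using commutator_in_commutator_subgroup by blast
next
  assume "\<forall>h\<in>H. \<forall>k\<in>K. commutator G h k \<in> S"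
  then show "commutator_subgroup G H K \<subseteq> S"
    unfolding commutator_subgroup_def by (intro generate_subgroup_incl assms) blast
qed

lemma (in normal) commutator_subgroup_normal: "commutator_subgroup G (carrier G) H \<lhd> G"
  unfolding commutator_subgroup_def
proof (rule normal_generateI)
  show "(\<Union>h\<in>carrier G. \<Union>k\<in>H. {commutator G h k}) \<subseteq> carrier G"
    using subset by auto
next
  fix c g
  assume c: "c \<in> (\<Union>h\<in>carrier G. \<Union>k\<in>H. {commutator G h k})" and g: "g \<in> carrier G"
  then obtain h k where hk: "h \<in> carrier G" "k \<in> H" "c = commutator G h k" by blast
  have k: "k \<in> carrier G" using hk subset by blast
  have "g \<otimes> c \<otimes> inv g = commutator G (g \<otimes> h \<otimes> inv g) (g \<otimes> k \<otimes> inv g)"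
    using g hk(1,3) k by (simp add: m_assoc inv_mult_group inv_mult_cancel_left)
  moreover have "g \<otimes> k \<otimes> inv g \<in> H"
    using g hk(2) by (rule inv_op_closed2)
  ultimately show "g \<otimes> c \<otimes> inv g \<in> (\<Union>h\<in>carrier G. \<Union>k\<in>H. {commutator G h k})"
    using g hk(1) by (intro UN_I[of "g \<otimes> h \<otimes> inv g"] UN_I[of "g \<otimes> k \<otimes> inv g"]) simp_all
qed

lemma (in normal) commutator_subgroup_subset: "commutator_subgroup G (carrier G) H \<subseteq> H"
proof (subst commutator_subgroup_subset_iff[OF is_subgroup], intro ballI)
  fix h k
  assume "h \<in> carrier G" "k \<in> H"
  then have "h \<otimes> k \<otimes> inv h \<in> H" "inv k \<in> H"
    using inv_op_closed2 by auto
  then show "commutator G h k \<in> H" by simp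
qed

lemma (in group) commutator_subgroup_mono:
  "H \<subseteq> H' \<Longrightarrow> K \<subseteq> K' \<Longrightarrow> commutator_subgroup G H K \<subseteq> commutator_subgroup G H' K'"
  unfolding commutator_subgroup_def by (intro mono_generate) blast

lemma (in group) commutator_subgroup_subset_derived:
  "K \<subseteq> carrier G \<Longrightarrow> commutator_subgroup G (carrier G) K \<subseteq> derived G (carrier G)"
  using commutator_subgroup_mono[of "carrier G" "carrier G" K "carrier G"]
  by (simp add: commutator_subgroup_carrier)

lemma (in group_hom) hom_commutator:
  "x \<in> carrier G \<Longrightarrow> y \<in> carrier G \<Longrightarrow> h (commutator G x y) = commutator H (h x) (h y)"
  by simp

lemma (in group_hom) commutator_subgroup_image:
  assumes "A \<subseteq> carrier G" "B \<subseteq> carrier G"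
  shows "h ` commutator_subgroup G A B = commutator_subgroup H (h ` A) (h ` B)"
proof -
  have "(\<Union>a\<in>h ` A. \<Union>b\<in>h ` B. {commutator H a b}) = h ` (\<Union>a\<in>A. \<Union>b\<in>B. {commutator G a b})"
    using assms by (auto simp: image_UN subset_iff)
  then show ?thesis
    unfolding commutator_subgroup_def using assms
    by (subst generate_img[symmetric]) (auto simp: subset_iff)
qed

text \<open>In the form (uv)(vu)^-1 the central factors appear as the same product
  \<open>c \<otimes> d\<close> in both uv and vu, and cancel.\<close>

lemma (in group) commutator_mult_central:
  assumes "x \<in> carrier G" "y \<in> carrier G" "c \<in> carrier G" "d \<in> carrier G"
    and c: "\<And>g. g \<in> carrier G \<Longrightarrow> g \<otimes> c = c \<otimes> g" and d: "\<And>g. g \<in> carrier G \<Longrightarrow> g \<otimes> d = d \<otimes> g"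
  shows "commutator G (x \<otimes> c) (y \<otimes> d) = commutator G x y"
proof -
  have *: "commutator G u v = (u \<otimes> v) \<otimes> inv (v \<otimes> u)" if "u \<in> carrier G" "v \<in> carrier G" for u v
    using that by (simp add: inv_mult_group m_assoc)
  have "(x \<otimes> c) \<otimes> (y \<otimes> d) = x \<otimes> (c \<otimes> y) \<otimes> d"
    using assms(1-4) by (simp add: m_assoc)
  also have "\<dots> = (x \<otimes> y) \<otimes> (c \<otimes> d)"
    using assms(1-4) c[of y, symmetric] by (simp add: m_assoc)
  finally have 1: "(x \<otimes> c) \<otimes> (y \<otimes> d) = (x \<otimes> y) \<otimes> (c \<otimes> d)" .
  have "(y \<otimes> d) \<otimes> (x \<otimes> c) = y \<otimes> (d \<otimes> x) \<otimes> c"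
    using assms(1-4) by (simp add: m_assoc)
  also have "\<dots> = (y \<otimes> x) \<otimes> (d \<otimes> c)"
    using assms(1-4) d[of x, symmetric] by (simp add: m_assoc)
  finally have 2: "(y \<otimes> d) \<otimes> (x \<otimes> c) = (y \<otimes> x) \<otimes> (c \<otimes> d)"
    using c[of d] assms(4) by simp
  have "commutator G (x \<otimes> c) (y \<otimes> d)
      = ((x \<otimes> c) \<otimes> (y \<otimes> d)) \<otimes> inv ((y \<otimes> d) \<otimes> (x \<otimes> c))"
    using assms(1-4) by (intro *) auto
  also have "\<dots> = (x \<otimes> y) \<otimes> inv (y \<otimes> x)"
    unfolding 1 2 using assms(1-4) by (simp add: inv_mult_group m_assoc inv_mult_cancel_left)
  also have "\<dots> = commutator G x y"
    using assms(1-4) by (intro *[symmetric])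
  finally show ?thesis .
qed

text \<open>Dividing by [G, H] makes the image of \<open>H\<close> central, since the generators
  killed are the commutators of \<open>G\<close> with \<open>H\<close>.\<close>

lemma (in normal) r_coset_commutator_subgroup_commute:
  assumes "g \<in> carrier G" "n \<in> H"
  defines "C \<equiv> commutator_subgroup G (carrier G) H"
  shows "(C #> g) \<otimes>\<^bsub>G Mod C\<^esub> (C #> n) = (C #> n) \<otimes>\<^bsub>G Mod C\<^esub> (C #> g)"
proof -
  interpret C: normal C G unfolding C_def by (rule commutator_subgroup_normal)
  have n: "n \<in> carrier G" using assms subset by blast
  have "(g \<otimes> n) \<otimes> inv (n \<otimes> g) = commutator G g n"
    using assms(1) n by (simp add: inv_mult_group m_assoc)
  then have "(g \<otimes> n) \<otimes> inv (n \<otimes> g) \<in> C"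
    unfolding C_def using commutator_in_commutator_subgroup[OF assms(1,2)] by simp
  then have "C #> (g \<otimes> n) = C #> (n \<otimes> g)"
    using assms(1) n by (simp add: C.r_coset_eq_iff)
  then show ?thesis
    using assms(1) n by (simp add: C.rcos_sum)
qed

text \<open>The image of \<open>H\<close> is central modulo [G, H], so there the commutator of two
  elements depends only on their cosets modulo \<open>H\<close>.\<close>

lemma (in normal) commutator_mult_modulo:
  assumes "x \<in> carrier G" "y \<in> carrier G" "m \<in> H" "n \<in> H"
  shows "commutator G (x \<otimes> m) (y \<otimes> n) \<otimes> inv commutator G x y \<in> commutator_subgroup G (carrier G) H"
proof -
  define C where "C = commutator_subgroup G (carrier G) H"
  interpret C: normal C G unfolding C_def by (rule commutator_subgroup_normal)
  interpret q: group_hom G "G Mod C" "(#>) C" by (rule C.r_coset_group_hom)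
  have mn: "m \<in> carrier G" "n \<in> carrier G" using assms subset by auto
  have cent: "X \<otimes>\<^bsub>G Mod C\<^esub> (C #> k) = (C #> k) \<otimes>\<^bsub>G Mod C\<^esub> X"
    if "k \<in> H" "X \<in> carrier (G Mod C)" for k X
    using that r_coset_commutator_subgroup_commute[of _ k] unfolding C_def carrier_FactGroup by blast
  have "C #> commutator G (x \<otimes> m) (y \<otimes> n) = C #> commutator G x y"
  proof -
    have "C #> commutator G (x \<otimes> m) (y \<otimes> n)
        = commutator (G Mod C) ((C #> x) \<otimes>\<^bsub>G Mod C\<^esub> (C #> m)) ((C #> y) \<otimes>\<^bsub>G Mod C\<^esub> (C #> n))"
      using assms(1,2) mn by (subst q.hom_commutator) (simp_all only: q.hom_mult m_closed)
    also have "\<dots> = commutator (G Mod C) (C #> x) (C #> y)"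
      using assms(1,2) mn cent[OF assms(3)] cent[OF assms(4)]
      by (intro q.H.commutator_mult_central) (simp_all only: q.hom_closed)
    also have "\<dots> = C #> commutator G x y"
      using assms(1,2) by (rule q.hom_commutator[symmetric])
    finally show ?thesis .
  qed
  then show ?thesis
    using assms(1,2) mn by (subst (asm) C.r_coset_eq_iff) (simp_all flip: C_def)
qed

text \<open>Modulo \<open>M\<close> every element comes from \<open>G\<close>, and a commutator
  changes only by [H, M] when its entries change by \<open>M\<close>. Hence all commutators come
  from \<open>G\<close> modulo [H, M], and surjectivity on the abelianization supplies the remaining
  elements. This is the surjectivity half of a successor step.\<close>

lemma surj_modulo_commutator_subgroup:
  assumes "group G" "group H" "f \<in> hom G H" "M \<lhd> H"
    and "surj_modulo G H M f" "surj_modulo G H (derived H (carrier H)) f"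
  shows "surj_modulo G H (commutator_subgroup H (carrier H) M) f"
proof -
  interpret f: group_hom G H f
    by (intro group_hom.intro group_hom_axioms.intro assms)
  interpret M: normal M H by fact
  define C where "C = commutator_subgroup H (carrier H) M"
  interpret C: normal C H unfolding C_def by (rule M.commutator_subgroup_normal)
  interpret q: group_hom H "H Mod C" "r_coset H C" by (rule C.r_coset_group_hom)
  interpret qf: group_hom G "H Mod C" "r_coset H C \<circ> f"
    by (intro group_hom.intro group_hom_axioms.intro hom_compose[OF assms(3) C.r_coset_hom_Mod]
        assms q.H.is_group)
  \<comment> \<open>The preimage in \<open>H\<close> of the image of \<open>G\<close> in
    \<open>H Mod C\<close>. As it is a subgroup, it contains the derived subgroup once it contains
    all commutators.\<close>
  define K where "K = {y \<in> carrier H. C #>\<^bsub>H\<^esub> y \<in> (r_coset H C \<circ> f) ` carrier G}"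
  have K: "subgroup K H"
  proof (rule subgroup.intro)
    show "x \<otimes>\<^bsub>H\<^esub> y \<in> K" if "x \<in> K" "y \<in> K" for x y
      using that subgroup.m_closed[OF qf.img_is_subgroup] q.hom_mult unfolding K_def by simp
    show "\<one>\<^bsub>H\<^esub> \<in> K"
      using subgroup.one_closed[OF qf.img_is_subgroup] q.hom_one unfolding K_def by simp
    show "inv\<^bsub>H\<^esub> x \<in> K" if "x \<in> K" for x
      using that subgroup.m_inv_closed[OF qf.img_is_subgroup] q.hom_inv unfolding K_def by simp
  qed (auto simp: K_def)
  have fK: "f x \<in> K" if "x \<in> carrier G" for x
    using that unfolding K_def by simp
  have CK: "C \<subseteq> K"
  proof
    fix c assume c: "c \<in> C"
    then have cc: "c \<in> carrier H" using C.subset by blast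
    have "C #>\<^bsub>H\<^esub> c = C" using c cc by (simp add: C.r_coset_eq_self_iff)
    then have "C #>\<^bsub>H\<^esub> c = (r_coset H C \<circ> f) \<one>\<^bsub>G\<^esub>" using qf.hom_one by simp
    then show "c \<in> K" unfolding K_def using cc by blast
  qed
  have dec: "\<exists>x\<in>carrier G. \<exists>m\<in>M. y = f x \<otimes>\<^bsub>H\<^esub> m" if y: "y \<in> carrier H" for y
  proof -
    obtain x where x: "x \<in> carrier G" "y \<otimes>\<^bsub>H\<^esub> inv\<^bsub>H\<^esub> f x \<in> M"
      using assms(5) y unfolding surj_modulo_def by blast
    have "inv\<^bsub>H\<^esub> f x \<otimes>\<^bsub>H\<^esub> (y \<otimes>\<^bsub>H\<^esub> inv\<^bsub>H\<^esub> f x) \<otimes>\<^bsub>H\<^esub> f x \<in> M"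
      using M.inv_op_closed1 x by simp
    moreover have "inv\<^bsub>H\<^esub> f x \<otimes>\<^bsub>H\<^esub> (y \<otimes>\<^bsub>H\<^esub> inv\<^bsub>H\<^esub> f x) \<otimes>\<^bsub>H\<^esub> f x = inv\<^bsub>H\<^esub> f x \<otimes>\<^bsub>H\<^esub> y"
      using x y by (simp add: f.H.m_assoc)
    moreover have "y = f x \<otimes>\<^bsub>H\<^esub> (inv\<^bsub>H\<^esub> f x \<otimes>\<^bsub>H\<^esub> y)"
      using x y by (simp add: f.H.inv_mult_cancel_left)
    ultimately show ?thesis using x by metis
  qed
  have "commutator H y z \<in> K" if yz: "y \<in> carrier H" "z \<in> carrier H" for y z
  proof -
    obtain x m x' m' where xm: "x \<in> carrier G" "m \<in> M" "y = f x \<otimes>\<^bsub>H\<^esub> m"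
        "x' \<in> carrier G" "m' \<in> M" "z = f x' \<otimes>\<^bsub>H\<^esub> m'"
      using dec yz by meson
    have "commutator H y z \<otimes>\<^bsub>H\<^esub> inv\<^bsub>H\<^esub> commutator H (f x) (f x') \<in> K"
      using M.commutator_mult_modulo[of "f x" "f x'" m m'] xm CK unfolding C_def by auto
    moreover have "commutator H (f x) (f x') \<in> K"
      using fK[of "commutator G x x'"] xm by simp
    ultimately have "commutator H y z \<otimes>\<^bsub>H\<^esub> inv\<^bsub>H\<^esub> commutator H (f x) (f x')
        \<otimes>\<^bsub>H\<^esub> commutator H (f x) (f x') \<in> K"
      by (rule subgroup.m_closed[OF K])
    then show ?thesis
      using yz xm by (simp add: f.H.m_assoc f.H.inv_mult_group f.H.inv_mult_cancel_left)
  qed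
  then have "derived H (carrier H) \<subseteq> K"
    using f.H.commutator_subgroup_subset_iff[OF K, of "carrier H" "carrier H"]
    by (simp add: commutator_subgroup_carrier)
  have "y \<in> K" if y: "y \<in> carrier H" for y
  proof -
    obtain x where x: "x \<in> carrier G" "y \<otimes>\<^bsub>H\<^esub> inv\<^bsub>H\<^esub> f x \<in> derived H (carrier H)"
      using assms(6) y unfolding surj_modulo_def by blast
    then have "y \<otimes>\<^bsub>H\<^esub> inv\<^bsub>H\<^esub> f x \<otimes>\<^bsub>H\<^esub> f x \<in> K"
      using \<open>derived H (carrier H) \<subseteq> K\<close> fK subgroup.m_closed[OF K] by blast
    then show ?thesis using x y by (simp add: f.H.m_assoc)
  qed
  then show ?thesis
    unfolding surj_modulo_def K_def C_def[symmetric]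
    by (auto simp: image_iff C.r_coset_eq_iff)
qed

subsection \<open>The lower central series\<close>

lemma ordinal_one_le: "ordinal_one \<le> \<kappa>"
  unfolding ordinal_one_def by (rule Least_le) simp

lemma ordinal_cases:
  obtains (one) "\<kappa> = ordinal_one"
  | (succ) \<mu> where "is_predecessor \<mu> \<kappa>"
  | (limit) "ordinal_one < \<kappa>" "\<nexists>\<mu>. is_predecessor \<mu> \<kappa>"
  using ordinal_one_le[of \<kappa>] by (metis order.not_eq_order_implies_strict)

lemma is_predecessor_less: "is_predecessor \<mu> \<kappa> \<Longrightarrow> \<mu> < \<kappa>"
  by (simp add: is_predecessor_def)

text \<open>A well-ordered type may have a greatest element, so the successor of
  \<open>\<mu>\<close> is formed below a witness \<open>\<kappa>\<close>; the bound keeps it within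
  the range of the induction.\<close>

lemma is_predecessor_Least:
  fixes \<mu> :: "'o::wellorder"
  assumes "\<mu> < \<kappa>"
  shows "is_predecessor \<mu> (LEAST \<nu>. \<mu> < \<nu>)" and "(LEAST \<nu>. \<mu> < \<nu>) \<le> \<kappa>"
  using assms LeastI[of "\<lambda>\<nu>. \<mu> < \<nu>" \<kappa>] Least_le[of "\<lambda>\<nu>. \<mu> < \<nu>"]
  unfolding is_predecessor_def by (auto simp: not_less) (meson leD not_le_imp_less)

text \<open>A maximum of a finite \<open>{..<\<kappa>}\<close> would be a predecessor of
  \<open>\<kappa>\<close>. This makes the hypothesis reserved for infinite ordinals available at
  limit stages.\<close>

lemma infinite_lessThan_limit:
  fixes \<kappa> :: "'o::wellorder"
  assumes "ordinal_one < \<kappa>" "\<nexists>\<mu>. is_predecessor \<mu> \<kappa>"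
  shows "infinite {..<\<kappa>}"
proof
  assume fin: "finite {..<\<kappa>}"
  have "is_predecessor (Max {..<\<kappa>}) \<kappa>"
    using Max_in[OF fin] Max_ge[OF fin] assms(1) unfolding is_predecessor_def by auto
  then show False using assms(2) by blast
qed

lemma lower_central_one: "lower_central G ordinal_one = carrier G"
  by (subst lower_central.simps) simp

lemma lower_central_succ:
  assumes "is_predecessor \<mu> \<kappa>"
  shows "lower_central G \<kappa> = commutator_subgroup G (carrier G) (lower_central G \<mu>)"
proof -
  have "\<kappa> \<noteq> ordinal_one"
    using is_predecessor_less[OF assms] ordinal_one_le[of \<mu>] by auto
  then show ?thesis
    using assms by (subst lower_central.simps) (auto simp: is_predecessor_the)
qed

lemma lower_central_limit:
  assumes "ordinal_one < \<kappa>" "\<nexists>\<mu>. is_predecessor \<mu> \<kappa>"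
  shows "lower_central G \<kappa> = (\<Inter>\<mu>\<in>{..<\<kappa>}. lower_central G \<mu>)"
  using assms by (subst lower_central.simps) auto

context group
begin

lemma lower_central_normal: "lower_central G \<kappa> \<lhd> G"
proof (induction \<kappa> rule: less_induct)
  case (less \<kappa>)
  show ?case
  proof (cases \<kappa> rule: ordinal_cases)
    case one
    then show ?thesis by (simp add: lower_central_one normal_self)
  next
    case (succ \<mu>)
    interpret N: normal "lower_central G \<mu>" G
      by (intro less.IH is_predecessor_less succ)
    show ?thesis
      unfolding lower_central_succ[OF succ] by (rule N.commutator_subgroup_normal)
  next
    case limit
    have N: "normal (lower_central G \<mu>) G" if "\<mu> \<in> {..<\<kappa>}" for \<mu>
      using that less.IH by simp
    show ?thesis
      unfolding lower_central_limit[OF limit]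
    proof (rule normal_invI)
      show "subgroup (\<Inter>\<mu>\<in>{..<\<kappa>}. lower_central G \<mu>) G"
        using N limit(1) by (intro subgroups_Inter) (auto intro: normal_imp_subgroup)
    qed (use N in \<open>auto intro: normal.inv_op_closed2\<close>)
  qed
qed

lemma lower_central_antimono:
  "\<mu> \<le> \<kappa> \<Longrightarrow> lower_central G \<kappa> \<subseteq> lower_central G \<mu>"
proof (induction \<kappa> rule: less_induct)
  case (less \<kappa>)
  show ?case
  proof (cases "\<mu> = \<kappa>")
    case False
    then have lt: "\<mu> < \<kappa>" using less.prems by simp
    show ?thesis
    proof (cases \<kappa> rule: ordinal_cases)
      case one
      then show ?thesis using lt ordinal_one_le[of \<mu>] by auto
    next
      case (succ \<nu>)
      then have "\<nu> < \<kappa>" "\<mu> \<le> \<nu>" using lt by (auto simp: is_predecessor_def)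
      then show ?thesis
        using less.IH[of \<nu>] normal.commutator_subgroup_subset[OF lower_central_normal]
        unfolding lower_central_succ[OF succ] by blast
    next
      case limit
      then show ?thesis using lt by (auto simp: lower_central_limit)
    qed
  qed simp
qed

end

lemma (in group_hom) hom_lower_central:
  "h ` lower_central G \<kappa> \<subseteq> lower_central H \<kappa>"
proof (induction \<kappa> rule: less_induct)
  case (less \<kappa>)
  show ?case
  proof (cases \<kappa> rule: ordinal_cases)
    case one
    then show ?thesis by (auto simp: lower_central_one)
  next
    case (succ \<mu>)
    have "lower_central G \<mu> \<subseteq> carrier G"
      using normal_imp_subgroup[OF G.lower_central_normal] subgroup.subset by blast
    then show ?thesis
      unfolding lower_central_succ[OF succ]
      using less.IH[OF is_predecessor_less[OF succ]]
      by (subst commutator_subgroup_image) (simp_all add: H.commutator_subgroup_mono image_subset_iff)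
  next
    case limit
    then show ?thesis using less.IH by (fastforce simp: lower_central_limit)
  qed
qed

text \<open>Modulo \<open>lower_central H \<kappa>\<close>, every element of \<open>H\<close> comes from \<open>G\<close>; hence so do the
  commutators that generate the next term of the series.\<close>

lemma (in group_hom) inj_modulo_lower_central_antimono:
  assumes inj: "inj_modulo G (lower_central G \<kappa>) (lower_central H \<kappa>) h"
    and surj: "surj_modulo G H (lower_central H \<kappa>) h"
  shows "\<mu> \<le> \<kappa> \<Longrightarrow> inj_modulo G (lower_central G \<mu>) (lower_central H \<mu>) h"
proof (induction \<mu> rule: less_induct)
  case (less \<mu>)
  show ?case
  proof (cases \<mu> rule: ordinal_cases)
    case one
    then show ?thesis by (simp add: inj_modulo_def lower_central_one)
  next
    case limit
    then show ?thesis
      using less unfolding inj_modulo_def by (auto simp: lower_central_limit)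
  next
    case (succ \<nu>)
    have \<nu>: "\<nu> < \<mu>" by (rule is_predecessor_less[OF succ])
    define M where "M = lower_central H \<kappa>"
    interpret M: normal M H unfolding M_def by (rule H.lower_central_normal)
    interpret q: group_hom H "H Mod M" "r_coset H M" by (rule M.r_coset_group_hom)
    interpret N: normal "lower_central G \<mu>" G by (rule G.lower_central_normal)
    \<comment> \<open>Agreement modulo \<open>M\<close> with an element of the
      \<open>\<mu>\<close>-th term is enough: the quotient of the two elements is sent into
      \<open>M\<close>, so by injectivity at \<open>\<kappa>\<close> it lies in the
      \<open>\<kappa>\<close>-th term of \<open>G\<close>, which is contained in the
      \<open>\<mu>\<close>-th.\<close>
    have lift: "x \<in> lower_central G \<mu>"
      if "x \<in> carrier G" "y \<in> lower_central G \<mu>" "M #>\<^bsub>H\<^esub> h x = M #>\<^bsub>H\<^esub> h y" for x y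
    proof -
      have y: "y \<in> carrier G" using that N.subset by blast
      have "h (x \<otimes> inv y) \<in> M"
        using that y M.r_coset_eq_iff[of "h x" "h y"] by simp
      then have "x \<otimes> inv y \<in> lower_central G \<mu>"
        using inj that(1) y G.lower_central_antimono[OF less.prems]
        unfolding inj_modulo_def M_def by auto
      then have "x \<otimes> inv y \<otimes> y \<in> lower_central G \<mu>"
        using that(2) by (rule N.m_closed)
      then show ?thesis using that(1) y by (simp add: G.m_assoc)
    qed
    have ex: "\<exists>x\<in>carrier G. M #>\<^bsub>H\<^esub> y = M #>\<^bsub>H\<^esub> h x" if "y \<in> carrier H" for y
      using surj that M.r_coset_eq_iff unfolding surj_modulo_def M_def[symmetric] by fastforce
    \<comment> \<open>The goal reduces to \<open>lower_central H \<mu> \<subseteq> S\<close>, after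
      which \<open>lift\<close> applies to any \<open>x\<close> with \<open>h x\<close> in that
      term. Since \<open>S\<close> is a subgroup, only the generating commutators have to be
      checked.\<close>
    define S where
      "S = {y \<in> carrier H. \<exists>x\<in>lower_central G \<mu>. M #>\<^bsub>H\<^esub> y = M #>\<^bsub>H\<^esub> h x}"
    have S: "subgroup S H"
    proof (rule H.subgroupI)
      show "S \<subseteq> carrier H" unfolding S_def by blast
      have "\<one>\<^bsub>H\<^esub> \<in> S"
        unfolding S_def using N.one_closed by (auto intro!: bexI[of _ \<one>])
      then show "S \<noteq> {}" by blast
    next
      fix y assume "y \<in> S"
      then obtain x where x: "y \<in> carrier H" "x \<in> lower_central G \<mu>" "M #>\<^bsub>H\<^esub> y = M #>\<^bsub>H\<^esub> h x"
        unfolding S_def by blast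
      then have "M #>\<^bsub>H\<^esub> inv\<^bsub>H\<^esub> y = M #>\<^bsub>H\<^esub> h (inv x)"
        using N.subset by (simp add: subset_iff)
      then show "inv\<^bsub>H\<^esub> y \<in> S" unfolding S_def using x N.m_inv_closed by blast
    next
      fix y z assume "y \<in> S" "z \<in> S"
      then obtain x w where x: "y \<in> carrier H" "x \<in> lower_central G \<mu>" "M #>\<^bsub>H\<^esub> y = M #>\<^bsub>H\<^esub> h x"
        "z \<in> carrier H" "w \<in> lower_central G \<mu>" "M #>\<^bsub>H\<^esub> z = M #>\<^bsub>H\<^esub> h w"
        unfolding S_def by blast
      then have "M #>\<^bsub>H\<^esub> (y \<otimes>\<^bsub>H\<^esub> z) = M #>\<^bsub>H\<^esub> h (x \<otimes> w)"
        using N.subset by (simp add: subset_iff)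
      then show "y \<otimes>\<^bsub>H\<^esub> z \<in> S" unfolding S_def using x N.m_closed[of x w] by blast
    qed
    have "commutator H y z \<in> S" if yz: "y \<in> carrier H" "z \<in> lower_central H \<nu>" for y z
    proof -
      have z: "z \<in> carrier H"
        using yz subgroup.subset[OF normal_imp_subgroup[OF H.lower_central_normal]] by blast
      obtain x w where xw: "x \<in> carrier G" "M #>\<^bsub>H\<^esub> y = M #>\<^bsub>H\<^esub> h x"
          "w \<in> carrier G" "M #>\<^bsub>H\<^esub> z = M #>\<^bsub>H\<^esub> h w"
        using ex yz(1) z by meson
      interpret L: normal "lower_central H \<nu>" H by (rule H.lower_central_normal)
      \<comment> \<open>\<open>M\<close> is contained in the \<open>\<nu>\<close>-th term, so
        \<open>h w\<close> lies there together with \<open>z\<close>, and the induction hypothesis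
        moves the preimage \<open>w\<close> into the \<open>\<nu>\<close>-th term of
        \<open>G\<close>.\<close>
      have "h w \<otimes>\<^bsub>H\<^esub> inv\<^bsub>H\<^esub> z \<in> M"
        using xw z M.r_coset_eq_iff[of "h w" z] by simp
      then have "h w \<otimes>\<^bsub>H\<^esub> inv\<^bsub>H\<^esub> z \<in> lower_central H \<nu>"
        using H.lower_central_antimono[OF order.trans[OF less_imp_le[OF \<nu>] less.prems]]
        unfolding M_def by auto
      then have "h w \<otimes>\<^bsub>H\<^esub> inv\<^bsub>H\<^esub> z \<otimes>\<^bsub>H\<^esub> z \<in> lower_central H \<nu>"
        using yz(2) by (rule L.m_closed)
      then have "h w \<in> lower_central H \<nu>"
        using xw z by (simp add: H.m_assoc)
      then have "w \<in> lower_central G \<nu>"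
        using less.IH[OF \<nu>] \<nu> less.prems xw(3) unfolding inj_modulo_def by auto
      then have "commutator G x w \<in> lower_central G \<mu>"
        unfolding lower_central_succ[OF succ]
        using xw(1) by (intro G.commutator_in_commutator_subgroup)
      moreover have "M #>\<^bsub>H\<^esub> commutator H y z = M #>\<^bsub>H\<^esub> h (commutator G x w)"
        using yz z xw by simp
      ultimately show ?thesis unfolding S_def using yz(1) z by blast
    qed
    then have "lower_central H \<mu> \<subseteq> S"
      unfolding lower_central_succ[OF succ] H.commutator_subgroup_subset_iff[OF S] by blast
    then show ?thesis
      using lift unfolding inj_modulo_def S_def by blast
  qed
qed

subsection \<open>The bar complex in low degrees\<close>

text \<open>Subgroups of chains as plain sets in an additive type, so that computations with
  boundaries use + and - of the type class instead of the operations of a group record.\<close>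

definition additive_set :: "'a::ab_group_add set \<Rightarrow> bool"
  where "additive_set X \<longleftrightarrow> 0 \<in> X \<and> (\<forall>a\<in>X. \<forall>b\<in>X. a - b \<in> X)"

lemma additive_setD:
  assumes "additive_set X"
  shows "0 \<in> X" and "a \<in> X \<Longrightarrow> b \<in> X \<Longrightarrow> a - b \<in> X" and "a \<in> X \<Longrightarrow> - a \<in> X"
    and "a \<in> X \<Longrightarrow> b \<in> X \<Longrightarrow> a + b \<in> X"
proof -
  show 0: "0 \<in> X" using assms by (auto simp: additive_set_def)
  show d: "a - b \<in> X" if "a \<in> X" "b \<in> X" for a b
    using assms that by (auto simp: additive_set_def)
  show m: "- a \<in> X" if "a \<in> X" for a using d[OF 0 that] by simp
  show "a + b \<in> X" if "a \<in> X" "b \<in> X" for a b using d[OF that(1) m[OF that(2)]] by simp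
qed

lemma additive_set_frag_cmul: "additive_set X \<Longrightarrow> a \<in> X \<Longrightarrow> frag_cmul k a \<in> X"
  by (rule frag_closure_minus_cmul) (auto simp: additive_set_def)

abbreviation chains :: "('a, 'm) monoid_scheme \<Rightarrow> nat \<Rightarrow> ('a list \<Rightarrow>\<^sub>0 int) set"
  where "chains G n \<equiv> carrier (bar_chains G n)"

definition bar_map :: "('a \<Rightarrow> 'b) \<Rightarrow> ('a list \<Rightarrow>\<^sub>0 int) \<Rightarrow> ('b list \<Rightarrow>\<^sub>0 int)"
  where "bar_map f = frag_extend (\<lambda>xs. frag_of (map f xs))"

lemma bar_chains_simps [simp]:
  "x \<otimes>\<^bsub>bar_chains G n\<^esub> y = x + y" "\<one>\<^bsub>bar_chains G n\<^esub> = 0"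
  by (simp_all add: bar_chains_def)

lemma comm_group_bar_chains: "comm_group (bar_chains G n)"
  unfolding bar_chains_def by (rule abelian_free_Abelian_group)

lemma group_bar_chains: "group (bar_chains G n)"
  by (rule comm_group.axioms(2)[OF comm_group_bar_chains])

lemma chains_iff: "c \<in> chains G n \<longleftrightarrow> Poly_Mapping.keys c \<subseteq> {xs. length xs = n \<and> set xs \<subseteq> carrier G}"
  by (simp add: bar_chains_def)

lemma frag_of_in_chains [simp]: "frag_of xs \<in> chains G n \<longleftrightarrow> length xs = n \<and> set xs \<subseteq> carrier G"
  by (simp add: chains_iff)

lemma additive_chains: "additive_set (chains G n)"
proof -
  have "Poly_Mapping.keys (a - b) \<subseteq> S"
    if "Poly_Mapping.keys a \<subseteq> S" "Poly_Mapping.keys b \<subseteq> S" for a b :: "'a list \<Rightarrow>\<^sub>0 int" and S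
    using keys_diff[of a b] that by blast
  then show ?thesis
    unfolding additive_set_def by (simp add: chains_iff)
qed

lemmas chains_closed [simp] = additive_setD[OF additive_chains] additive_set_frag_cmul[OF additive_chains]

lemma inv_bar_chains: "c \<in> chains G n \<Longrightarrow> inv\<^bsub>bar_chains G n\<^esub> c = - c"
  by (simp add: bar_chains_def)

lemma chains_induct [consumes 1, case_names zero diff gen]:
  assumes "c \<in> chains G n" and "P 0"
    and "\<And>a b. a \<in> chains G n \<Longrightarrow> b \<in> chains G n \<Longrightarrow> P a \<Longrightarrow> P b \<Longrightarrow> P (a - b)"
    and "\<And>xs. length xs = n \<Longrightarrow> set xs \<subseteq> carrier G \<Longrightarrow> P (frag_of xs)"
  shows "P c"
  using assms(1)[unfolded chains_iff] assms(2)
  by (rule free_Abelian_group_induct[where P = P]) (auto simp: chains_iff intro: assms(3,4))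

lemma length_1_2_3:
  "length xs = Suc 0 \<Longrightarrow> \<exists>x. xs = [x]" "length xs = 2 \<Longrightarrow> \<exists>x y. xs = [x, y]"
  "length xs = 3 \<Longrightarrow> \<exists>x y z. xs = [x, y, z]"
  by (auto simp: length_Suc_conv numeral_2_eq_2 numeral_3_eq_3)

lemma bar_map_simps [simp]:
  "bar_map f 0 = 0" "bar_map f (frag_of xs) = frag_of (map f xs)"
  "bar_map f (a - b) = bar_map f a - bar_map f b" "bar_map f (a + b) = bar_map f a + bar_map f b"
  "bar_map f (- a) = - bar_map f a" "bar_map f (frag_cmul k a) = frag_cmul k (bar_map f a)"
  by (simp_all add: bar_map_def frag_extend_diff frag_extend_add frag_extend_minus frag_extend_cmul)

lemma bar_map_closed:
  assumes "c \<in> chains G n" and "\<And>x. x \<in> carrier G \<Longrightarrow> f x \<in> carrier H"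
  shows "bar_map f c \<in> chains H n"
  using assms(1) by (induction rule: chains_induct) (use assms(2) in auto)

lemma bar_map_comp: "bar_map g (bar_map f c) = bar_map (g \<circ> f) c"
  unfolding bar_map_def using frag_extend_compose[of "\<lambda>xs. frag_of (map g xs)" "map f" c]
  by (simp add: comp_def)

lemma bar_map_cong:
  assumes "c \<in> chains G n" and "\<And>x. x \<in> carrier G \<Longrightarrow> f x = g x"
  shows "bar_map f c = bar_map g c"
  using assms(1)
proof (induction rule: chains_induct)
  case (gen xs)
  then have "map f xs = map g xs" using assms(2) by auto
  then show ?case by (simp only: bar_map_simps)
qed simp_all

lemma bar_map_id: "bar_map (\<lambda>x. x) c = c"
  unfolding bar_map_def using frag_expansion[of c] by simp

lemma bar_boundary_simps [simp]:
  "bar_boundary G 0 = 0" "bar_boundary G (a - b) = bar_boundary G a - bar_boundary G b"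
  "bar_boundary G (a + b) = bar_boundary G a + bar_boundary G b"
  "bar_boundary G (- a) = - bar_boundary G a"
  "bar_boundary G (frag_cmul k a) = frag_cmul k (bar_boundary G a)"
  by (simp_all add: bar_boundary_def frag_extend_diff frag_extend_add frag_extend_minus frag_extend_cmul)

lemma bar_boundary_frag_of:
  "bar_boundary G (frag_of [x]) = 0"
  "bar_boundary G (frag_of [x, y]) = frag_of [y] - frag_of [x \<otimes>\<^bsub>G\<^esub> y] + frag_of [x]"
  "bar_boundary G (frag_of [x, y, z])
    = frag_of [y, z] - frag_of [x \<otimes>\<^bsub>G\<^esub> y, z] + frag_of [x, y \<otimes>\<^bsub>G\<^esub> z] - frag_of [x, y]"
  by (simp_all add: bar_boundary_def bar_face_def atMost_Suc eval_nat_numeral)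

lemma bar_boundary_bar_map:
  assumes "f \<in> hom G H" "c \<in> chains G n"
  shows "bar_boundary H (bar_map f c) = bar_map f (bar_boundary G c)"
  using assms(2)
proof (induction rule: chains_induct)
  case (gen xs)
  have face: "bar_face H i (map f xs) = map f (bar_face G i xs)" if "i \<le> length xs" for i
  proof -
    have "xs ! (i - 1) \<in> carrier G" "xs ! i \<in> carrier G" if "i \<noteq> 0" "i \<noteq> length xs"
      using gen that \<open>i \<le> length xs\<close> by (auto simp: subset_iff)
    then show ?thesis
      using that by (auto simp: bar_face_def map_tl map_butlast take_map drop_map hom_mult[OF assms(1)])
  qed
  have sum: "bar_map f (sum g I) = (\<Sum>i\<in>I. bar_map f (g i))" if "finite I" for g and I :: "nat set"
    using that by (induction I) simp_all
  show ?case
    by (cases "xs = []") (auto simp: bar_boundary_def sum face bar_map_simps(2) intro!: sum.cong)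
qed simp_all

text \<open>Second homology needs nothing beyond 3-chains, so here and in
  \<open>bar_boundary_boundary\<close> the explicit formulas for one, two and three entries replace
  the general simplicial identities.\<close>

lemma bar_boundary_closed:
  assumes "group G" "c \<in> chains G n" "n \<in> {1, 2, 3}"
  shows "bar_boundary G c \<in> chains G (n - 1)"
  using assms(2)
proof (induction rule: chains_induct)
  case (gen xs)
  interpret group G by fact
  show ?case
    using gen assms(3)
    by (auto simp: bar_boundary_frag_of dest!: length_1_2_3 intro!: chains_closed(2,4))
qed auto

lemma bar_boundary_boundary:
  assumes "group G" "c \<in> chains G n" "n \<in> {1, 2, 3}"
  shows "bar_boundary G (bar_boundary G c) = 0"
  using assms(2)
proof (induction rule: chains_induct)
  case (gen xs)
  interpret group G by fact
  show ?case
    using gen assms(3) by (auto simp: bar_boundary_frag_of m_assoc dest!: length_1_2_3)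
qed auto

lemma bar_cycles_iff:
  "c \<in> bar_cycles G n \<longleftrightarrow> c \<in> chains G n \<and> bar_boundary G c = 0"
  by (simp add: bar_cycles_def kernel_def)

lemma bar_cycles_1: "bar_cycles G 1 = chains G 1"
proof -
  have "bar_boundary G c = 0" if "c \<in> chains G 1" for c
    using that by (induction rule: chains_induct) (auto simp: bar_boundary_frag_of dest!: length_1_2_3)
  then show ?thesis by (auto simp: bar_cycles_iff)
qed

lemma additive_bar_cycles: "additive_set (bar_cycles G n)"
  unfolding additive_set_def by (simp add: bar_cycles_iff)

lemma additive_bar_boundaries: "additive_set (bar_boundaries G n)"
  unfolding additive_set_def bar_boundaries_def
  by (auto simp: image_iff) (metis bar_boundary_simps(1) chains_closed(1), metis bar_boundary_simps(2) chains_closed(2))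

lemmas bar_boundaries_closed = additive_setD[OF additive_bar_boundaries]
  additive_set_frag_cmul[OF additive_bar_boundaries]

lemma bar_boundariesI: "c \<in> chains G (n + 1) \<Longrightarrow> bar_boundary G c \<in> bar_boundaries G n"
  unfolding bar_boundaries_def by blast

lemma bar_boundaries_subset_cycles:
  assumes "group G" "n \<in> {1, 2}"
  shows "bar_boundaries G n \<subseteq> bar_cycles G n"
  using assms bar_boundary_closed[OF assms(1), of _ "n + 1"] bar_boundary_boundary[OF assms(1), of _ "n + 1"]
  by (auto simp: bar_boundaries_def bar_cycles_iff)

lemma bar_map_boundaries:
  assumes "f \<in> hom G H" "c \<in> bar_boundaries G n"
  shows "bar_map f c \<in> bar_boundaries H n"
proof -
  obtain d where d: "d \<in> chains G (n + 1)" "c = bar_boundary G d"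
    using assms(2) unfolding bar_boundaries_def by blast
  have "bar_map f d \<in> chains H (n + 1)"
    using d(1) hom_in_carrier[OF assms(1)] by (rule bar_map_closed)
  then show ?thesis
    using bar_boundariesI[of "bar_map f d" H n] bar_boundary_bar_map[OF assms(1) d(1)] d(2) by simp
qed

lemma bar_map_cycles:
  assumes "f \<in> hom G H" "c \<in> bar_cycles G n"
  shows "bar_map f c \<in> bar_cycles H n"
  using assms bar_map_closed[of c G n f H] hom_in_carrier[OF assms(1)]
  by (auto simp: bar_cycles_iff bar_boundary_bar_map)

text \<open>These are the boundary of [1|1|q] and the negative of the boundary of [q|1|1].
  Degenerate 2-chains are thus homologous to [1|1] rather than to zero, and [1|1] is not a cycle,
  its boundary being [1].\<close>

lemma (in group) degenerate_boundaries:
  assumes "q \<in> carrier G"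
  shows "frag_of [\<one>, q] - frag_of [\<one>, \<one>] \<in> bar_boundaries G 2"
    and "frag_of [q, \<one>] - frag_of [\<one>, \<one>] \<in> bar_boundaries G 2"
proof -
  have "bar_boundary G (frag_of [\<one>, \<one>, q]) \<in> bar_boundaries G 2"
    using assms by (intro bar_boundariesI) simp
  then show "frag_of [\<one>, q] - frag_of [\<one>, \<one>] \<in> bar_boundaries G 2"
    using assms by (simp add: bar_boundary_frag_of)
  have "- bar_boundary G (frag_of [q, \<one>, \<one>]) \<in> bar_boundaries G 2"
    using assms by (intro bar_boundariesI bar_boundaries_closed) simp
  then show "frag_of [q, \<one>] - frag_of [\<one>, \<one>] \<in> bar_boundaries G 2"
    using assms by (simp add: bar_boundary_frag_of)
qed

subsection \<open>Chains over a quotient\<close>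

text \<open>For \<open>p : G \<rightarrow> Q\<close> onto with kernel \<open>N\<close>, the connecting map \<open>H\<^sub>2(Q) \<rightarrow> N/[G, N]\<close> is handled
  without choosing a section: it sends the class of \<open>p\<^sub>#c - [1|1]\<close> to \<open>x\<close> whenever \<open>\<partial>c = [x]\<close>.\<close>

locale group_epi = group_hom G Q p
  for G :: "('a, 'm) monoid_scheme" (structure) and Q :: "('b, 'n) monoid_scheme" (structure) and p +
  assumes surj: "p ` carrier G = carrier Q"
begin

abbreviation N where "N \<equiv> kernel G Q p"

lemma kernelI: "x \<in> carrier G \<Longrightarrow> p x = \<one>\<^bsub>Q\<^esub> \<Longrightarrow> x \<in> N"
  and kernelD: "x \<in> N \<Longrightarrow> x \<in> carrier G" "x \<in> N \<Longrightarrow> p x = \<one>\<^bsub>Q\<^esub>"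
  by (auto simp: kernel_def)

definition degenerate :: "('b list \<Rightarrow>\<^sub>0 int) set"
  where "degenerate = {d. \<exists>k. d - frag_cmul k (frag_of [\<one>\<^bsub>Q\<^esub>, \<one>\<^bsub>Q\<^esub>]) \<in> bar_boundaries Q 2}"

text \<open>The 1-chains to be treated as zero. Modulo them, a 1-chain dying in \<open>Q\<close>
  reduces to a single [x] with \<open>x\<close> in \<open>N\<close>
  (\<open>chain_in_kernel_collapsible\<close>), and such an [x] vanishes exactly for
  \<open>x\<close> in [G, N] (\<open>collapsible_iff\<close>). In this way N/[G, N] is seen inside
  the bar complex.\<close>

definition collapsible :: "('a list \<Rightarrow>\<^sub>0 int) set"
  where "collapsible = bar_boundary G ` {c \<in> chains G 2. bar_map p c \<in> degenerate}"

lemma additive_degenerate: "additive_set degenerate"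
  unfolding additive_set_def degenerate_def
proof (intro conjI ballI, goal_cases)
  case 1
  show ?case using bar_boundaries_closed(1) by (auto intro!: exI[of _ 0])
next
  case (2 a b)
  then obtain k l where "a - frag_cmul k (frag_of [\<one>\<^bsub>Q\<^esub>, \<one>\<^bsub>Q\<^esub>]) \<in> bar_boundaries Q 2"
      "b - frag_cmul l (frag_of [\<one>\<^bsub>Q\<^esub>, \<one>\<^bsub>Q\<^esub>]) \<in> bar_boundaries Q 2" by blast
  from bar_boundaries_closed(2)[OF this]
  have "a - b - frag_cmul (k - l) (frag_of [\<one>\<^bsub>Q\<^esub>, \<one>\<^bsub>Q\<^esub>]) \<in> bar_boundaries Q 2"
    by (simp add: frag_cmul_diff_distrib algebra_simps)
  then show ?case by blast
qed

lemma additive_collapsible: "additive_set collapsible"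
proof -
  have "0 \<in> collapsible"
    unfolding collapsible_def using additive_setD(1)[OF additive_degenerate]
    by (auto intro!: rev_image_eqI[of 0])
  moreover have "bar_boundary G a - bar_boundary G b \<in> collapsible"
    if "a \<in> chains G 2" "bar_map p a \<in> degenerate" "b \<in> chains G 2" "bar_map p b \<in> degenerate" for a b
    unfolding collapsible_def using that additive_setD(2)[OF additive_degenerate]
    by (auto intro!: rev_image_eqI[of "a - b"])
  ultimately show ?thesis
    unfolding additive_set_def by (auto simp: collapsible_def)
qed

lemmas collapsible_closed = additive_setD[OF additive_collapsible]

lemma boundary_subset_degenerate: "bar_boundaries Q 2 \<subseteq> degenerate"
  unfolding degenerate_def by (auto intro!: exI[of _ 0])

text \<open>Up to sign these are the boundaries of [n|g] and [g|n], whose images [1|p g] and [p g|1]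
  are degenerate. So forming [x] from x is additive modulo \<open>collapsible\<close> as soon as one
  factor lies in \<open>N\<close>, in either order.\<close>

lemma collapsible_mult:
  assumes "n \<in> N" "g \<in> carrier G"
  shows "frag_of [n \<otimes> g] - frag_of [n] - frag_of [g] \<in> collapsible"
    and "frag_of [g \<otimes> n] - frag_of [g] - frag_of [n] \<in> collapsible"
proof -
  have n: "n \<in> carrier G" "p n = \<one>\<^bsub>Q\<^esub>" using assms by (auto simp: kernel_def)
  have "frag_of [\<one>\<^bsub>Q\<^esub>, p g] \<in> degenerate" "frag_of [p g, \<one>\<^bsub>Q\<^esub>] \<in> degenerate"
    unfolding degenerate_def using H.degenerate_boundaries[of "p g"] assms(2)
    by (auto intro!: exI[of _ 1])
  then have "bar_boundary G (frag_of [n, g]) \<in> collapsible" "bar_boundary G (frag_of [g, n]) \<in> collapsible"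
    unfolding collapsible_def using n assms(2) by (auto intro!: imageI)
  then have "- bar_boundary G (frag_of [n, g]) \<in> collapsible" "- bar_boundary G (frag_of [g, n]) \<in> collapsible"
    by (auto intro: collapsible_closed)
  then show "frag_of [n \<otimes> g] - frag_of [n] - frag_of [g] \<in> collapsible"
    "frag_of [g \<otimes> n] - frag_of [g] - frag_of [n] \<in> collapsible"
    by (simp_all add: bar_boundary_frag_of algebra_simps)
qed

lemma one_in_kernel: "\<one> \<in> N"
  by (simp add: kernel_def)

lemma collapsible_one: "frag_of [\<one>] \<in> collapsible"
  using collapsible_closed(3)[OF collapsible_mult(1)[OF one_in_kernel, of \<one>]] by simp

text \<open>Modulo \<open>collapsible\<close> both \<open>g \<otimes> n\<close> and
  \<open>n \<otimes> g\<close> give [g] + [n]. The commutator \<open>y\<close> of \<open>g\<close>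
  and \<open>n\<close> satisfies \<open>y \<otimes> (n \<otimes> g) = g \<otimes> n\<close>, so [y]
  is zero; products and inverses follow by additivity on \<open>N\<close>.\<close>

lemma commutator_subgroup_collapsible:
  assumes "x \<in> commutator_subgroup G (carrier G) N"
  shows "frag_of [x] \<in> collapsible"
proof -
  interpret N: normal N G by (rule normal_kernel)
  define X where "X = {x \<in> N. frag_of [x] \<in> collapsible}"
  have X: "subgroup X G"
  proof (rule G.subgroupI)
    show "X \<subseteq> carrier G" using N.subset unfolding X_def by blast
    show "X \<noteq> {}" using collapsible_one one_in_kernel unfolding X_def by blast
    show "inv x \<in> X" if "x \<in> X" for x
    proof -
      have x: "x \<in> N" "x \<in> carrier G" "frag_of [x] \<in> collapsible"
        using that N.subset unfolding X_def by auto
      have "frag_of [\<one>] - frag_of [x] - frag_of [inv x] \<in> collapsible"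
        using collapsible_mult(1)[of x "inv x"] x by simp
      from collapsible_closed(2)[OF collapsible_closed(2)[OF collapsible_one x(3)] this]
      show ?thesis using x unfolding X_def by simp
    qed
    show "x \<otimes> y \<in> X" if "x \<in> X" "y \<in> X" for x y
    proof -
      have xy: "x \<in> N" "x \<in> carrier G" "frag_of [x] \<in> collapsible"
        "y \<in> N" "y \<in> carrier G" "frag_of [y] \<in> collapsible"
        using that N.subset unfolding X_def by auto
      from collapsible_closed(4)[OF collapsible_closed(4)[OF collapsible_mult(1)[OF xy(1,5)] xy(3)] xy(6)]
      show ?thesis using xy unfolding X_def by simp
    qed
  qed
  have "commutator G g n \<in> X" if gn: "g \<in> carrier G" "n \<in> N" for g n
  proof -
    have n: "n \<in> carrier G" using gn N.subset by blast
    define y where "y = commutator G g n"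
    have y: "y \<in> carrier G" "y \<in> N"
      using gn n N.commutator_subgroup_subset G.commutator_in_commutator_subgroup[OF gn]
      unfolding y_def by auto
    have "y \<otimes> (n \<otimes> g) = g \<otimes> n"
      unfolding y_def using gn(1) n by (simp add: G.m_assoc G.inv_mult_cancel_left)
    then have 1: "frag_of [g \<otimes> n] - frag_of [y] - frag_of [n \<otimes> g] \<in> collapsible"
      using collapsible_mult(1)[OF y(2), of "n \<otimes> g"] gn n by simp
    note 2 = collapsible_mult[OF gn(2,1)]
    have "(frag_of [g \<otimes> n] - frag_of [g] - frag_of [n]) - (frag_of [g \<otimes> n] - frag_of [y] - frag_of [n \<otimes> g])
        - (frag_of [n \<otimes> g] - frag_of [n] - frag_of [g]) \<in> collapsible"
      by (intro collapsible_closed 1 2)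
    then have "frag_of [y] \<in> collapsible" by simp
    then show ?thesis using y unfolding X_def y_def by simp
  qed
  then have "commutator_subgroup G (carrier G) N \<subseteq> X"
    by (simp add: G.commutator_subgroup_subset_iff[OF X])
  then show ?thesis using assms unfolding X_def by blast
qed

lemma chain_over_kernel_collapsible:
  assumes "u \<in> chains (G\<lparr>carrier := N\<rparr>) 1"
  shows "\<exists>x\<in>N. u - frag_of [x] \<in> collapsible"
  using assms
proof (induction rule: chains_induct)
  case zero
  show ?case using collapsible_closed(3)[OF collapsible_one] one_in_kernel by auto
next
  case (diff a b)
  then obtain x y where xy: "x \<in> N" "a - frag_of [x] \<in> collapsible" "y \<in> N" "b - frag_of [y] \<in> collapsible"
    by blast
  interpret N: normal N G by (rule normal_kernel)
  have c: "x \<in> carrier G" "y \<in> carrier G" using xy N.subset by auto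
  have z: "x \<otimes> inv y \<in> N" using xy by blast
  have "frag_of [x] - frag_of [x \<otimes> inv y] - frag_of [y] \<in> collapsible"
    using collapsible_mult(1)[OF z c(2)] c by (simp add: G.m_assoc)
  from collapsible_closed(4)[OF collapsible_closed(2)[OF xy(2,4)] this] z
  show ?case by (intro bexI[of _ "x \<otimes> inv y"]) (simp_all add: algebra_simps)
next
  case (gen xs)
  then obtain x where "xs = [x]" "x \<in> N" by (auto dest!: length_1_2_3)
  then show ?case using collapsible_closed(1) by (intro bexI[of _ x]) simp_all
qed

text \<open>The normalization at the neutral element makes \<open>g \<otimes> inv s (p g)\<close>
  equal to \<open>g\<close> on \<open>N\<close> and the factor set of the extension trivial at the
  pair of neutral elements.\<close>

lemma obtain_section:
  obtains s where "\<And>q. q \<in> carrier Q \<Longrightarrow> s q \<in> carrier G" "\<And>q. q \<in> carrier Q \<Longrightarrow> p (s q) = q"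
    "s \<one>\<^bsub>Q\<^esub> = \<one>"
proof
  let ?s = "\<lambda>q. if q = \<one>\<^bsub>Q\<^esub> then \<one> else inv_into (carrier G) p q"
  show "?s q \<in> carrier G" "p (?s q) = q" if "q \<in> carrier Q" for q
    using that inv_into_into[of q p "carrier G"] f_inv_into_f[of q p "carrier G"] surj by auto
qed simp

text \<open>Each \<open>g\<close> factors as \<open>t g \<otimes> s (p g)\<close> with
  \<open>t g\<close> in \<open>N\<close>, so \<open>u\<close> is congruent to the sum of its images
  under \<open>t\<close> and under \<open>s \<circ> p\<close>; the latter vanishes with
  \<open>bar_map p u\<close>.\<close>

lemma chain_in_kernel_collapsible:
  assumes "u \<in> chains G 1" "bar_map p u = 0"
  shows "\<exists>x\<in>N. u - frag_of [x] \<in> collapsible"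
proof -
  obtain s where s: "\<And>q. q \<in> carrier Q \<Longrightarrow> s q \<in> carrier G" "\<And>q. q \<in> carrier Q \<Longrightarrow> p (s q) = q"
    using obtain_section by metis
  define t where "t g = g \<otimes> inv s (p g)" for g
  have t: "t g \<in> N" if "g \<in> carrier G" for g
    using that s[of "p g"] by (simp add: t_def kernel_def)
  have "u - bar_map s (bar_map p u) - bar_map t u \<in> collapsible"
    using assms(1)
  proof (induction rule: chains_induct)
    case zero
    then show ?case using collapsible_closed(1) by simp
  next
    case (diff a b)
    from collapsible_closed(2)[OF diff(3,4)] show ?case by (simp add: algebra_simps)
  next
    case (gen xs)
    then obtain g where g: "xs = [g]" "g \<in> carrier G" by (auto dest!: length_1_2_3)
    have "t g \<otimes> s (p g) = g" unfolding t_def using g s[of "p g"] by (simp add: G.m_assoc)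
    then show ?case
      using collapsible_mult(1)[OF t[OF g(2)] s(1)[of "p g"]] g by (simp add: algebra_simps)
  qed
  then have 1: "u - bar_map t u \<in> collapsible" using assms(2) by simp
  have "bar_map t u \<in> chains (G\<lparr>carrier := N\<rparr>) 1"
    using assms(1) t by (intro bar_map_closed) auto
  then obtain x where x: "x \<in> N" "bar_map t u - frag_of [x] \<in> collapsible"
    using chain_over_kernel_collapsible by blast
  show ?thesis using collapsible_closed(4)[OF 1 x(2)] x(1) by auto
qed

end

section \<open>Homomorphisms from bar chains to groups\<close>

lemma (in group) hom_bar_chains_diff:
  assumes "h \<in> hom (bar_chains K n) G" "a \<in> chains K n" "b \<in> chains K n"
  shows "h (a - b) = h a \<otimes> inv h b"
proof -
  interpret C: comm_group "bar_chains K n" by (rule comm_group_bar_chains)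
  interpret h: group_hom "bar_chains K n" G h
    by (intro group_hom.intro group_hom_axioms.intro C.is_group is_group assms)
  have "a - b = a \<otimes>\<^bsub>bar_chains K n\<^esub> inv\<^bsub>bar_chains K n\<^esub> b"
    using assms by (simp add: inv_bar_chains)
  then show ?thesis
    using assms(2,3) by (simp only: h.hom_mult h.hom_inv C.inv_closed)
qed

lemma (in comm_group) bar_chains_universal:
  assumes "\<And>xs. length xs = n \<Longrightarrow> set xs \<subseteq> carrier K \<Longrightarrow> f xs \<in> carrier G"
  obtains h where "h \<in> hom (bar_chains K n) G"
    "\<And>xs. length xs = n \<Longrightarrow> set xs \<subseteq> carrier K \<Longrightarrow> h (frag_of xs) = f xs"
proof -
  have "f ` {xs. length xs = n \<and> set xs \<subseteq> carrier K} \<subseteq> carrier G"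
    using assms by blast
  then show thesis
    by (rule free_Abelian_group_universal) (auto simp: bar_chains_def intro: that)
qed

context group_epi
begin

text \<open>With a section \<open>s\<close> and \<open>t g = g s(p g)\<inverse>\<close>, the map \<open>[g] \<mapsto> t g\<close> extends to \<open>h : C\<^sub>1(G) \<rightarrow> N/[G, N]\<close>,
  and \<open>h \<circ> \<partial>\<close> factors through \<open>p\<^sub>#\<close>.\<close>

lemma collapsible_imp_commutator_subgroup:
  assumes x: "x \<in> N" and "frag_of [x] \<in> collapsible"
  shows "x \<in> commutator_subgroup G (carrier G) N"
proof -
  interpret N: normal N G by (rule normal_kernel)
  define C where "C = commutator_subgroup G (carrier G) N"
  interpret C: normal C G unfolding C_def by (rule N.commutator_subgroup_normal)
  have CN: "C \<subseteq> N" unfolding C_def by (rule N.commutator_subgroup_subset)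
  have CN_normal: "C \<lhd> G\<lparr>carrier := N\<rparr>"
    by (rule G.normal_restrict_supergroup[OF N.is_subgroup C.normal_axioms CN])
  define A where "A = G\<lparr>carrier := N\<rparr> Mod C"
  have carrier_A: "carrier A = r_coset G C ` N" by (simp add: A_def carrier_FactGroup)
  have mult_A: "(C #> m) \<otimes>\<^bsub>A\<^esub> (C #> n) = C #> (m \<otimes> n)" if "m \<in> N" "n \<in> N" for m n
    using that N.subset by (simp add: A_def C.rcos_sum subset_iff)
  have one_A: "\<one>\<^bsub>A\<^esub> = C" by (simp add: A_def)
  have "group A" unfolding A_def by (rule normal.factorgroup_is_group[OF CN_normal])
  then interpret A: comm_group A
  proof (rule group.group_comm_groupI)
    fix X Y assume "X \<in> carrier A" "Y \<in> carrier A"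
    then obtain m n where mn: "m \<in> N" "n \<in> N" "X = C #> m" "Y = C #> n"
      by (auto simp: carrier_A)
    then show "X \<otimes>\<^bsub>A\<^esub> Y = Y \<otimes>\<^bsub>A\<^esub> X"
      using N.r_coset_commutator_subgroup_commute[of m n] N.subset
      by (auto simp: A_def C_def)
  qed
  obtain s where s: "\<And>q. q \<in> carrier Q \<Longrightarrow> s q \<in> carrier G" "\<And>q. q \<in> carrier Q \<Longrightarrow> p (s q) = q"
    "s \<one>\<^bsub>Q\<^esub> = \<one>"
    by (rule obtain_section) blast
  define t where "t g = g \<otimes> inv s (p g)" for g
  \<comment> \<open>The factor set of the extension; \<open>\<psi>\<close> below is its inverse,
    extended to 2-chains of \<open>Q\<close> with values in N/[G, N].\<close>
  define \<sigma> where "\<sigma> q r = s q \<otimes> s r \<otimes> inv s (q \<otimes>\<^bsub>Q\<^esub> r)" for q r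
  have t: "t g \<in> N" "C #> t g \<in> carrier A" if "g \<in> carrier G" for g
  proof -
    show "t g \<in> N" using that s(1,2)[of "p g"] by (intro kernelI) (simp_all add: t_def)
    then show "C #> t g \<in> carrier A" unfolding carrier_A by (rule imageI)
  qed
  have \<sigma>: "\<sigma> q r \<in> N" "C #> \<sigma> q r \<in> carrier A" if "q \<in> carrier Q" "r \<in> carrier Q" for q r
  proof -
    show "\<sigma> q r \<in> N" using that s(1,2) by (intro kernelI) (simp_all add: \<sigma>_def)
    then show "C #> \<sigma> q r \<in> carrier A" unfolding carrier_A by (rule imageI)
  qed
  obtain h where h: "h \<in> hom (bar_chains G 1) A" "\<And>g. g \<in> carrier G \<Longrightarrow> h (frag_of [g]) = C #> t g"
  proof -
    have *: "C #> t (hd xs) \<in> carrier A" if "length xs = 1" "set xs \<subseteq> carrier G" for xs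
      using that t by (auto dest!: length_1_2_3)
    show thesis
      by (rule A.bar_chains_universal[of 1 G "\<lambda>xs. C #> t (hd xs)", OF *]) (auto intro: that)
  qed
  obtain \<psi> where \<psi>: "\<psi> \<in> hom (bar_chains Q 2) A"
    "\<And>q r. q \<in> carrier Q \<Longrightarrow> r \<in> carrier Q \<Longrightarrow> \<psi> (frag_of [q, r]) = inv\<^bsub>A\<^esub> (C #> \<sigma> q r)"
  proof -
    have *: "inv\<^bsub>A\<^esub> (C #> \<sigma> (xs ! 0) (xs ! 1)) \<in> carrier A" if "length xs = 2" "set xs \<subseteq> carrier Q" for xs
      using that \<sigma> by (auto dest!: length_1_2_3)
    show thesis
      by (rule A.bar_chains_universal[of 2 Q "\<lambda>xs. inv\<^bsub>A\<^esub> (C #> \<sigma> (xs ! 0) (xs ! 1))", OF *])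
        (auto intro: that)
  qed
  \<comment> \<open>\<open>t\<close> is multiplicative up to the factor set and a conjugation by
    \<open>s (p g)\<close>; the conjugation disappears modulo \<open>C\<close>, where
    \<open>N\<close> becomes central.\<close>
  have t_mult: "C #> t (g \<otimes> k) = (C #> t g) \<otimes>\<^bsub>A\<^esub> (C #> t k) \<otimes>\<^bsub>A\<^esub> (C #> \<sigma> (p g) (p k))"
    if gk: "g \<in> carrier G" "k \<in> carrier G" for g k
  proof -
    have sc: "s (p g) \<in> carrier G" "s (p k) \<in> carrier G" "s (p g \<otimes>\<^bsub>Q\<^esub> p k) \<in> carrier G"
      using gk s by auto
    have tk: "t k \<in> carrier G" using t(1)[OF gk(2)] N.subset by blast
    define m where "m = s (p g) \<otimes> t k \<otimes> inv s (p g)"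
    have m: "m \<in> N" unfolding m_def by (rule N.inv_op_closed2[OF sc(1) t(1)[OF gk(2)]])
    have "m \<otimes> inv t k = commutator G (s (p g)) (t k)" unfolding m_def ..
    then have "m \<otimes> inv t k \<in> C"
      unfolding C_def using G.commutator_in_commutator_subgroup[OF sc(1) t(1)[OF gk(2)]] by simp
    then have "C #> m = C #> t k"
      using m tk N.subset by (subst C.r_coset_eq_iff) auto
    moreover have "t (g \<otimes> k) = t g \<otimes> m \<otimes> \<sigma> (p g) (p k)"
      unfolding t_def m_def \<sigma>_def using gk sc
      by (simp add: G.m_assoc G.inv_mult_cancel_left)
    moreover have "t g \<otimes> m \<in> N" using t(1)[OF gk(1)] m by (rule N.m_closed)
    ultimately show ?thesis
      using mult_A[OF t(1)[OF gk(1)] m] mult_A[of "t g \<otimes> m" "\<sigma> (p g) (p k)"] \<sigma>(1)[of "p g" "p k"] gk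
      by simp
  qed
  \<comment> \<open>On [g|k] the left side is t(k) t(g) / t(gk), which by \<open>t_mult\<close> is
    the inverse of the factor set; hence the inverse in \<open>\<psi>\<close>.\<close>
  have h_boundary: "h (bar_boundary G c) = \<psi> (bar_map p c)" if "c \<in> chains G 2" for c
    using that
  proof (induction rule: chains_induct)
    case zero
    show ?case
      using Group.hom_one[OF h(1) group_bar_chains] Group.hom_one[OF \<psi>(1) group_bar_chains] A.is_group
      by simp
  next
    case (diff a b)
    have "bar_boundary G a \<in> chains G 1" "bar_boundary G b \<in> chains G 1"
      using diff bar_boundary_closed[OF G.is_group, of _ 2] by auto
    moreover have "bar_map p a \<in> chains Q 2" "bar_map p b \<in> chains Q 2"
      using diff by (auto intro: bar_map_closed)
    ultimately show ?case
      using diff A.hom_bar_chains_diff[OF h(1)] A.hom_bar_chains_diff[OF \<psi>(1)] by simp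
  next
    case (gen xs)
    then obtain g k where xs: "xs = [g, k]" and gk: "g \<in> carrier G" "k \<in> carrier G"
      by (auto dest!: length_1_2_3)
    have "bar_boundary G (frag_of xs) = frag_of [k] - (frag_of [g \<otimes> k] - frag_of [g])"
      unfolding xs by (simp add: bar_boundary_frag_of)
    then have "h (bar_boundary G (frag_of xs))
        = (C #> t k) \<otimes>\<^bsub>A\<^esub> inv\<^bsub>A\<^esub> ((C #> t (g \<otimes> k)) \<otimes>\<^bsub>A\<^esub> inv\<^bsub>A\<^esub> (C #> t g))"
      using gk by (simp add: A.hom_bar_chains_diff[OF h(1)] h(2))
    also have "\<dots> = inv\<^bsub>A\<^esub> (C #> \<sigma> (p g) (p k))"
      unfolding t_mult[OF gk] using gk t(2) \<sigma>(2)
      by (simp add: A.inv_mult_group A.m_ac A.inv_mult_cancel_left)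
    finally show ?case using gk by (simp add: xs \<psi>(2))
  qed
  \<comment> \<open>The cocycle identity needs no computation: a 3-chain of \<open>Q\<close> lifts
    along \<open>s\<close>, and \<open>h_boundary\<close> turns \<open>\<psi>\<close> of its
    boundary into \<open>h\<close> of a double boundary.\<close>
  have \<psi>_boundary: "\<psi> b = C" if b: "b \<in> bar_boundaries Q 2" for b
  proof -
    obtain c where c: "c \<in> chains Q 3" "b = bar_boundary Q c"
      using b unfolding bar_boundaries_def by auto
    have sc: "bar_map s c \<in> chains G 3" using c(1) s(1) by (rule bar_map_closed)
    have "bar_map p (bar_map s c) = bar_map (\<lambda>x. x) c"
      unfolding bar_map_comp using c(1) by (rule bar_map_cong) (simp add: s)
    then have "b = bar_map p (bar_boundary G (bar_map s c))"
      using c bar_boundary_bar_map[OF homh sc] by (simp add: bar_map_id)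
    then have "\<psi> b = h (bar_boundary G (bar_boundary G (bar_map s c)))"
      using sc bar_boundary_closed[OF G.is_group, of _ 3] by (simp add: h_boundary)
    also have "\<dots> = h 0"
      using sc bar_boundary_boundary[OF G.is_group, of _ 3] by simp
    also have "\<dots> = C"
      using Group.hom_one[OF h(1) group_bar_chains] A.is_group one_A
      by simp
    finally show ?thesis .
  qed
  obtain c k where c: "c \<in> chains G 2" "frag_of [x] = bar_boundary G c"
    and k: "bar_map p c - frag_cmul k (frag_of [\<one>\<^bsub>Q\<^esub>, \<one>\<^bsub>Q\<^esub>]) \<in> bar_boundaries Q 2"
    using assms(2) unfolding collapsible_def degenerate_def by blast
  \<comment> \<open>The multiple of [1|1] allowed in \<open>degenerate\<close> is invisible to
    \<open>\<psi>\<close>, because \<open>s\<close> preserves the neutral element.\<close>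
  have \<psi>_one: "\<psi> (frag_of [\<one>\<^bsub>Q\<^esub>, \<one>\<^bsub>Q\<^esub>]) = \<one>\<^bsub>A\<^esub>"
    using \<psi>(2)[of "\<one>\<^bsub>Q\<^esub>" "\<one>\<^bsub>Q\<^esub>"] C.subset s(3) one_A A.inv_one by (simp add: \<sigma>_def)
  have "additive_set {d \<in> chains Q 2. \<psi> d = \<one>\<^bsub>A\<^esub>}"
    unfolding additive_set_def
    using Group.hom_one[OF \<psi>(1) group_bar_chains] A.is_group
    by (auto simp: A.hom_bar_chains_diff[OF \<psi>(1)])
  note D = additive_setD[OF this] additive_set_frag_cmul[OF this]
  have kc: "bar_map p c - frag_cmul k (frag_of [\<one>\<^bsub>Q\<^esub>, \<one>\<^bsub>Q\<^esub>]) \<in> {d \<in> chains Q 2. \<psi> d = \<one>\<^bsub>A\<^esub>}"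
    using \<psi>_boundary[OF k] bar_boundaries_subset_cycles[OF H.is_group, of 2] k one_A
    by (auto simp: bar_cycles_iff)
  have "frag_of [\<one>\<^bsub>Q\<^esub>, \<one>\<^bsub>Q\<^esub>] \<in> {d \<in> chains Q 2. \<psi> d = \<one>\<^bsub>A\<^esub>}"
    using \<psi>_one by simp
  from D(4)[OF kc D(5)[OF this, of k]] have "\<psi> (bar_map p c) = \<one>\<^bsub>A\<^esub>" by simp
  then have "h (frag_of [x]) = C"
    using h_boundary[OF c(1)] c(2) one_A by simp
  moreover have "x \<in> carrier G" using x N.subset by blast
  moreover have "t x = x" unfolding t_def using x s(3) kernelD[OF x] by simp
  ultimately have "C #> x = C" using h(2)[of x] by simp
  then show ?thesis
    using C.r_coset_eq_self_iff[OF \<open>x \<in> carrier G\<close>] unfolding C_def by simp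
qed

lemma collapsible_iff:
  "x \<in> N \<Longrightarrow> frag_of [x] \<in> collapsible \<longleftrightarrow> x \<in> commutator_subgroup G (carrier G) N"
  using collapsible_imp_commutator_subgroup commutator_subgroup_collapsible by blast

end

subsection \<open>The first homology group\<close>

context group
begin

lemma group_epi_trivial: "group_epi G (G\<lparr>carrier := {\<one>}\<rparr>) (\<lambda>_. \<one>)"
proof -
  have "group (G\<lparr>carrier := {\<one>}\<rparr>)" by (rule subgroup_imp_group[OF triv_subgroup])
  then show ?thesis
    by (intro group_epi.intro group_epi_axioms.intro group_hom.intro group_hom_axioms.intro is_group)
      (auto simp: hom_def)
qed

lemma collapsible_trivial: "group_epi.collapsible G (G\<lparr>carrier := {\<one>}\<rparr>) (\<lambda>_. \<one>) = bar_boundaries G 1"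
proof -
  let ?T = "G\<lparr>carrier := {\<one>}\<rparr>"
  note E = group_epi_trivial
  have "bar_map (\<lambda>_. \<one>) c \<in> group_epi.degenerate ?T" if c: "c \<in> chains G 2" for c
  proof -
    define d where "d = bar_map (\<lambda>_. \<one>) c"
    have "d \<in> chains (G\<lparr>carrier := {\<one>}\<rparr>) 2"
      unfolding d_def using c by (rule bar_map_closed) simp
    then have keys: "Poly_Mapping.keys d \<subseteq> {xs. length xs = 2 \<and> set xs \<subseteq> {\<one>}}"
      by (simp add: chains_iff)
    have "xs = [\<one>, \<one>]" if "xs \<in> Poly_Mapping.keys d" for xs
      using subsetD[OF keys that] by (auto dest!: length_1_2_3)
    then have "Poly_Mapping.keys d \<subseteq> {[\<one>, \<one>]}" by blast
    then have "d = frag_cmul (Poly_Mapping.lookup d [\<one>, \<one>]) (frag_of [\<one>, \<one>])"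
      by (intro poly_mapping_eqI) (auto simp: lookup_single when_def not_in_keys_iff_lookup_eq_zero[symmetric])
    then have "d - frag_cmul (Poly_Mapping.lookup d [\<one>, \<one>]) (frag_of [\<one>, \<one>]) = 0"
      by simp
    then show ?thesis
      unfolding group_epi.degenerate_def[OF E] d_def[symmetric] using bar_boundaries_closed(1)
      by (intro CollectI exI[of _ "Poly_Mapping.lookup d [\<one>, \<one>]"]) simp
  qed
  then show ?thesis
    unfolding group_epi.collapsible_def[OF E] bar_boundaries_def by (auto simp: numeral_2_eq_2)
qed

lemma bar_boundaries_1_iff:
  assumes "x \<in> carrier G"
  shows "frag_of [x] \<in> bar_boundaries G 1 \<longleftrightarrow> x \<in> derived G (carrier G)"
proof -
  have "kernel G (G\<lparr>carrier := {\<one>}\<rparr>) (\<lambda>_. \<one>) = carrier G" by (auto simp: kernel_def)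
  then show ?thesis
    using group_epi.collapsible_iff[OF group_epi_trivial, of x] assms by (simp add: collapsible_trivial commutator_subgroup_carrier)
qed

lemma chain_1_homologous:
  assumes "u \<in> chains G 1"
  shows "\<exists>x\<in>carrier G. u - frag_of [x] \<in> bar_boundaries G 1"
proof -
  have "kernel G (G\<lparr>carrier := {\<one>}\<rparr>) (\<lambda>_. \<one>) = carrier G" by (auto simp: kernel_def)
  then show ?thesis
    using group_epi.chain_over_kernel_collapsible[OF group_epi_trivial, of u] assms by (simp add: collapsible_trivial)
qed

lemma bar_boundaries_1_mult:
  assumes "x \<in> carrier G" "y \<in> carrier G"
  shows "frag_of [x \<otimes> y] - frag_of [x] - frag_of [y] \<in> bar_boundaries G 1"
proof -
  have "- bar_boundary G (frag_of [x, y]) \<in> bar_boundaries G 1"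
    using assms by (intro bar_boundariesI bar_boundaries_closed) simp
  then show ?thesis by (simp add: bar_boundary_frag_of algebra_simps)
qed

lemma bar_boundaries_1_diff_iff:
  assumes "x \<in> carrier G" "y \<in> carrier G"
  shows "frag_of [x] - frag_of [y] \<in> bar_boundaries G 1 \<longleftrightarrow> x \<otimes> inv y \<in> derived G (carrier G)"
proof -
  have *: "frag_of [x] - frag_of [x \<otimes> inv y] - frag_of [y] \<in> bar_boundaries G 1"
    using bar_boundaries_1_mult[of "x \<otimes> inv y" y] assms by (simp add: m_assoc)
  have "frag_of [x] - frag_of [y] \<in> bar_boundaries G 1 \<longleftrightarrow> frag_of [x \<otimes> inv y] \<in> bar_boundaries G 1"
  proof
    assume "frag_of [x] - frag_of [y] \<in> bar_boundaries G 1"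
    from bar_boundaries_closed(2)[OF this *] show "frag_of [x \<otimes> inv y] \<in> bar_boundaries G 1"
      by simp
  next
    assume "frag_of [x \<otimes> inv y] \<in> bar_boundaries G 1"
    from bar_boundaries_closed(4)[OF * this] show "frag_of [x] - frag_of [y] \<in> bar_boundaries G 1"
      by simp
  qed
  then show ?thesis
    using bar_boundaries_1_iff[of "x \<otimes> inv y"] assms by simp
qed

end

subsection \<open>Homology groups in terms of cycles\<close>

abbreviation cycle_group :: "('a, 'm) monoid_scheme \<Rightarrow> nat \<Rightarrow> ('a list \<Rightarrow>\<^sub>0 int) monoid"
  where "cycle_group G n \<equiv> (bar_chains G n)\<lparr>carrier := bar_cycles G n\<rparr>"

lemma subgroup_additive:
  assumes "additive_set X" "X \<subseteq> chains G n"
  shows "subgroup X (bar_chains G n)"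
proof
  fix x y assume "x \<in> X" "y \<in> X"
  then show "x \<otimes>\<^bsub>bar_chains G n\<^esub> y \<in> X" "inv\<^bsub>bar_chains G n\<^esub> x \<in> X"
    using additive_setD[OF assms(1)] assms(2) by (auto simp: inv_bar_chains subset_iff)
qed (use assms additive_setD[OF assms(1)] in auto)

lemma bar_cycles_subset: "bar_cycles G n \<subseteq> chains G n"
  by (auto simp: bar_cycles_iff)

lemma subgroup_bar_cycles: "subgroup (bar_cycles G n) (bar_chains G n)"
  by (rule subgroup_additive[OF additive_bar_cycles bar_cycles_subset])

lemma group_cycle_group: "group (cycle_group G n)"
  by (rule group.subgroup_imp_group[OF group_bar_chains subgroup_bar_cycles])

lemma comm_group_cycle_group: "comm_group (cycle_group G n)"
  by (rule group.group_comm_groupI[OF group_cycle_group]) (simp add: add.commute)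

lemma inv_cycle_group: "c \<in> bar_cycles G n \<Longrightarrow> inv\<^bsub>cycle_group G n\<^esub> c = - c"
  using group.m_inv_consistent[OF group_bar_chains subgroup_bar_cycles, of c G n]
    inv_bar_chains[OF subsetD[OF bar_cycles_subset]] by simp

lemma bar_boundaries_normal:
  assumes "group G" "n \<in> {1, 2}"
  shows "bar_boundaries G n \<lhd> cycle_group G n"
proof (rule comm_group.subgroup_imp_normal[OF comm_group_cycle_group])
  have "subgroup (bar_boundaries G n) (bar_chains G n)"
    using bar_boundaries_subset_cycles[OF assms] bar_cycles_subset
    by (intro subgroup_additive additive_bar_boundaries) blast
  then show "subgroup (bar_boundaries G n) (cycle_group G n)"
    by (rule group.subgroup_incl[OF group_bar_chains _ subgroup_bar_cycles])
      (rule bar_boundaries_subset_cycles[OF assms])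
qed

lemma bar_map_cycle_hom: "f \<in> hom G H \<Longrightarrow> bar_map f \<in> hom (cycle_group G n) (cycle_group H n)"
  by (intro homI) (simp_all add: bar_map_cycles)

lemma group_homology_map_eq:
  "group_homology_map n H f = quotient_map (cycle_group H n) (bar_boundaries H n) (bar_map f)"
  by (simp add: group_homology_map_def bar_map_def)

lemma bar_map_image_boundaries:
  "f \<in> hom G H \<Longrightarrow> bar_map f ` bar_boundaries G n \<subseteq> bar_boundaries H n"
  using bar_map_boundaries by blast

lemma group_homology_map_hom:
  assumes "group G" "group H" "f \<in> hom G H" "n \<in> {1, 2}"
  shows "group_homology_map n H f \<in> hom (group_homology n G) (group_homology n H)"
  unfolding group_homology_map_eq group_homology_def
  by (intro quotient_map_hom group_cycle_group bar_boundaries_normal bar_map_cycle_hom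
      bar_map_image_boundaries assms)

lemma group_homology_map_coset:
  assumes "group G" "group H" "f \<in> hom G H" "n \<in> {1, 2}" "z \<in> bar_cycles G n"
  shows "group_homology_map n H f (bar_boundaries G n #>\<^bsub>cycle_group G n\<^esub> z)
    = bar_boundaries H n #>\<^bsub>cycle_group H n\<^esub> bar_map f z"
  unfolding group_homology_map_eq
  by (rule quotient_map_r_coset)
    (use assms in \<open>simp_all add: group_cycle_group bar_boundaries_normal bar_map_cycle_hom
      bar_map_image_boundaries del: r_coset_consistent\<close>)

lemma surj_modulo_cycles_iff:
  "f \<in> hom G H \<Longrightarrow> surj_modulo (cycle_group G n) (cycle_group H n) X (bar_map f) \<longleftrightarrow>
    (\<forall>z\<in>bar_cycles H n. \<exists>w\<in>bar_cycles G n. z - bar_map f w \<in> X)"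
  unfolding surj_modulo_def using bar_map_cycles[of f G H _ n] by (simp add: inv_cycle_group)

lemma group_homology_map_iso_iff:
  assumes "group G" "group H" "f \<in> hom G H" "n \<in> {1, 2}"
  shows "group_homology_map n H f \<in> iso (group_homology n G) (group_homology n H) \<longleftrightarrow>
    (\<forall>c\<in>bar_cycles G n. bar_map f c \<in> bar_boundaries H n \<longrightarrow> c \<in> bar_boundaries G n) \<and>
    (\<forall>z\<in>bar_cycles H n. \<exists>w\<in>bar_cycles G n. z - bar_map f w \<in> bar_boundaries H n)"
proof -
  have "group_homology_map n H f \<in> iso (group_homology n G) (group_homology n H) \<longleftrightarrow>
      inj_modulo (cycle_group G n) (bar_boundaries G n) (bar_boundaries H n) (bar_map f) \<and>
      surj_modulo (cycle_group G n) (cycle_group H n) (bar_boundaries H n) (bar_map f)"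
    unfolding group_homology_map_eq group_homology_def
    by (intro quotient_map_iso_iff group_cycle_group bar_boundaries_normal bar_map_cycle_hom
        bar_map_image_boundaries assms)
  then show ?thesis
    by (simp add: surj_modulo_cycles_iff[OF assms(3)] inj_modulo_def)
qed

text \<open>Every 1-chain is homologous to a single [x], and [x] is a boundary exactly for
  \<open>x\<close> in the derived subgroup. This lets later arguments on first homology work with
  the abelianization.\<close>

lemma H1_iso_iff:
  assumes "group G" "group H" "f \<in> hom G H"
  shows "group_homology_map 1 H f \<in> iso (group_homology 1 G) (group_homology 1 H) \<longleftrightarrow>
    inj_modulo G (derived G (carrier G)) (derived H (carrier H)) f \<and>
    surj_modulo G H (derived H (carrier H)) f" (is "_ \<longleftrightarrow> ?R")
proof -
  interpret f: group_hom G H f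
    by (intro group_hom.intro group_hom_axioms.intro assms)
  note bc = bar_boundaries_closed
  have iff: "group_homology_map 1 H f \<in> iso (group_homology 1 G) (group_homology 1 H) \<longleftrightarrow>
    (\<forall>c\<in>chains G 1. bar_map f c \<in> bar_boundaries H 1 \<longrightarrow> c \<in> bar_boundaries G 1) \<and>
    (\<forall>z\<in>chains H 1. \<exists>w\<in>chains G 1. z - bar_map f w \<in> bar_boundaries H 1)" (is "_ \<longleftrightarrow> ?L")
    using group_homology_map_iso_iff[OF assms, of 1] by (simp add: bar_cycles_1[unfolded One_nat_def])
  have map_diff: "bar_map f c - frag_of [f x] \<in> bar_boundaries H 1"
    if "c - frag_of [x] \<in> bar_boundaries G 1" for c x
    using bar_map_boundaries[OF assms(3) that] by simp
  have "?L \<longleftrightarrow> ?R"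
  proof
    assume L: ?L
    show ?R
    proof
      show "inj_modulo G (derived G (carrier G)) (derived H (carrier H)) f"
        unfolding inj_modulo_def
      proof (intro ballI impI)
        fix x assume x: "x \<in> carrier G" "f x \<in> derived H (carrier H)"
        then have "bar_map f (frag_of [x]) \<in> bar_boundaries H 1"
          using f.H.bar_boundaries_1_iff[of "f x"] by simp
        then have "frag_of [x] \<in> bar_boundaries G 1"
          using conjunct1[OF L] x by simp
        then show "x \<in> derived G (carrier G)"
          using f.G.bar_boundaries_1_iff x by blast
      qed
      show "surj_modulo G H (derived H (carrier H)) f"
        unfolding surj_modulo_def
      proof
        fix y assume y: "y \<in> carrier H"
        then obtain w where w: "w \<in> chains G 1" "frag_of [y] - bar_map f w \<in> bar_boundaries H 1"
          using bspec[OF conjunct2[OF L], of "frag_of [y]"] by auto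
        obtain x where x: "x \<in> carrier G" "w - frag_of [x] \<in> bar_boundaries G 1"
          using f.G.chain_1_homologous[OF w(1)] by blast
        have "frag_of [y] - frag_of [f x] \<in> bar_boundaries H 1"
          using bc(4)[OF w(2) map_diff[OF x(2)]] by simp
        then show "\<exists>x\<in>carrier G. y \<otimes>\<^bsub>H\<^esub> inv\<^bsub>H\<^esub> f x \<in> derived H (carrier H)"
          using f.H.bar_boundaries_1_diff_iff[of y "f x"] x y by auto
      qed
    qed
  next
    assume R: ?R
    show ?L
    proof (intro conjI ballI impI)
      fix c assume c: "c \<in> chains G 1" "bar_map f c \<in> bar_boundaries H 1"
      obtain x where x: "x \<in> carrier G" "c - frag_of [x] \<in> bar_boundaries G 1"
        using f.G.chain_1_homologous[OF c(1)] by blast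
      have "frag_of [f x] \<in> bar_boundaries H 1"
        using bc(2)[OF c(2) map_diff[OF x(2)]] by simp
      then have "f x \<in> derived H (carrier H)"
        using f.H.bar_boundaries_1_iff x by simp
      then have "x \<in> derived G (carrier G)"
        using conjunct1[OF R] x unfolding inj_modulo_def by blast
      then have "frag_of [x] \<in> bar_boundaries G 1"
        using f.G.bar_boundaries_1_iff x by blast
      from bc(4)[OF x(2) this] show "c \<in> bar_boundaries G 1" by simp
    next
      fix z assume z: "z \<in> chains H 1"
      obtain y where y: "y \<in> carrier H" "z - frag_of [y] \<in> bar_boundaries H 1"
        using f.H.chain_1_homologous[OF z] by blast
      obtain x where x: "x \<in> carrier G" "y \<otimes>\<^bsub>H\<^esub> inv\<^bsub>H\<^esub> f x \<in> derived H (carrier H)"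
        using conjunct2[OF R] y unfolding surj_modulo_def by blast
      have "frag_of [y] - frag_of [f x] \<in> bar_boundaries H 1"
        using f.H.bar_boundaries_1_diff_iff[of y "f x"] x y by simp
      from bc(4)[OF y(2) this] x show "\<exists>w\<in>chains G 1. z - bar_map f w \<in> bar_boundaries H 1"
        by (intro bexI[of _ "frag_of [x]"]) simp_all
    qed
  qed
  then show ?thesis using iff by simp
qed

text \<open>The second homology condition on cycles: the images of \<open>z\<close> and
  \<open>bar_map f w\<close> have the same class in H_2(Q). Stated for an arbitrary
  \<open>p\<close>, it lets the comparison below avoid the lower central series.\<close>

definition H2_epi_modulo ::
  "('a, 'm) monoid_scheme \<Rightarrow> ('b, 'n) monoid_scheme \<Rightarrow> ('c, 'l) monoid_scheme \<Rightarrow> ('b \<Rightarrow> 'c) \<Rightarrow> ('a \<Rightarrow> 'b) \<Rightarrow> bool"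
  where "H2_epi_modulo P G Q p f \<longleftrightarrow>
    (\<forall>z\<in>bar_cycles G 2. \<exists>w\<in>bar_cycles P 2. bar_map p (z - bar_map f w) \<in> bar_boundaries Q 2)"

lemma H2_epi_iff:
  assumes "group P" "group G" "f \<in> hom P G"
  shows "r_coset (group_homology 2 G) (H2_kernel G \<mu>) \<circ> group_homology_map 2 G f
      \<in> epi (group_homology 2 P) (group_homology 2 G Mod H2_kernel G \<mu>)
    \<longleftrightarrow> H2_epi_modulo P G (lower_central_quotient G \<mu>) (r_coset G (lower_central G \<mu>)) f"
proof -
  define Q where "Q = lower_central_quotient G \<mu>"
  define p where "p = r_coset G (lower_central G \<mu>)"
  interpret G: group G by fact
  interpret L: normal "lower_central G \<mu>" G by (rule G.lower_central_normal)
  have p: "p \<in> hom G Q" and Q: "group Q"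
    unfolding p_def Q_def by (rule L.r_coset_hom_Mod) (rule L.factorgroup_is_group)
  interpret BP: normal "bar_boundaries P 2" "cycle_group P 2"
    by (rule bar_boundaries_normal[OF assms(1)]) simp
  interpret BG: normal "bar_boundaries G 2" "cycle_group G 2"
    by (rule bar_boundaries_normal[OF assms(2)]) simp
  interpret BQ: normal "bar_boundaries Q 2" "cycle_group Q 2"
    by (rule bar_boundaries_normal[OF Q]) simp
  have hP: "group (group_homology 2 P)" and hG: "group (group_homology 2 G)" and hQ: "group (group_homology 2 Q)"
    unfolding group_homology_def
    by (rule BP.factorgroup_is_group BG.factorgroup_is_group BQ.factorgroup_is_group)+
  have pm: "group_hom (group_homology 2 G) (group_homology 2 Q) (group_homology_map 2 Q p)"
    using group_homology_map_hom[OF assms(2) Q p] hG hQ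
    by (simp add: group_hom_def group_hom_axioms_def)
  have K: "H2_kernel G \<mu> = kernel (group_homology 2 G) (group_homology 2 Q) (group_homology_map 2 Q p)"
    by (simp add: H2_kernel_def Q_def p_def)
  have fm: "group_homology_map 2 G f \<in> hom (group_homology 2 P) (group_homology 2 G)"
    using group_homology_map_hom[OF assms] by simp
  have "r_coset (group_homology 2 G) (H2_kernel G \<mu>) \<circ> group_homology_map 2 G f
      \<in> epi (group_homology 2 P) (group_homology 2 G Mod H2_kernel G \<mu>)
    \<longleftrightarrow> surj_modulo (group_homology 2 P) (group_homology 2 G) (H2_kernel G \<mu>) (group_homology_map 2 G f)"
    unfolding K by (rule r_coset_comp_epi_iff[OF hP group_hom.normal_kernel[OF pm] fm])
  also have "\<dots> \<longleftrightarrow> (\<forall>z\<in>bar_cycles G 2. \<exists>w\<in>bar_cycles P 2.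
      (bar_boundaries G 2 #>\<^bsub>cycle_group G 2\<^esub> z) \<otimes>\<^bsub>group_homology 2 G\<^esub>
        inv\<^bsub>group_homology 2 G\<^esub> group_homology_map 2 G f (bar_boundaries P 2 #>\<^bsub>cycle_group P 2\<^esub> w)
      \<in> H2_kernel G \<mu>)"
    unfolding surj_modulo_def by (simp add: group_homology_def carrier_FactGroup del: r_coset_consistent)
  also have "\<dots> \<longleftrightarrow> H2_epi_modulo P G Q p f"
    unfolding H2_epi_modulo_def
  proof (rule ball_cong[OF HOL.refl], rule bex_cong[OF HOL.refl])
    fix z w assume z: "z \<in> bar_cycles G 2" and w: "w \<in> bar_cycles P 2"
    have fw: "bar_map f w \<in> bar_cycles G 2"
      using bar_map_cycles[OF assms(3) w] .
    have d: "z - bar_map f w \<in> bar_cycles G 2"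
      using additive_setD(2)[OF additive_bar_cycles z fw] .
    interpret c: group_hom "cycle_group G 2" "group_homology 2 G" "r_coset (cycle_group G 2) (bar_boundaries G 2)"
      unfolding group_homology_def by (rule BG.r_coset_group_hom)
    have eq: "(bar_boundaries G 2 #>\<^bsub>cycle_group G 2\<^esub> z) \<otimes>\<^bsub>group_homology 2 G\<^esub>
        inv\<^bsub>group_homology 2 G\<^esub> (bar_boundaries G 2 #>\<^bsub>cycle_group G 2\<^esub> bar_map f w)
        = bar_boundaries G 2 #>\<^bsub>cycle_group G 2\<^esub> (z - bar_map f w)"
    proof -
      have "z - bar_map f w = z \<otimes>\<^bsub>cycle_group G 2\<^esub> inv\<^bsub>cycle_group G 2\<^esub> bar_map f w"
        using fw by (simp add: inv_cycle_group)
      moreover have "z \<in> carrier (cycle_group G 2)" "bar_map f w \<in> carrier (cycle_group G 2)"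
        using z fw by simp_all
      ultimately show ?thesis
        by (simp only: c.hom_mult c.hom_inv BG.inv_closed)
    qed
    have fw_coset: "group_homology_map 2 G f (bar_boundaries P 2 #>\<^bsub>cycle_group P 2\<^esub> w)
        = bar_boundaries G 2 #>\<^bsub>cycle_group G 2\<^esub> bar_map f w"
      by (rule group_homology_map_coset[OF assms _ w]) simp
    have pd_coset: "group_homology_map 2 Q p (bar_boundaries G 2 #>\<^bsub>cycle_group G 2\<^esub> (z - bar_map f w))
        = bar_boundaries Q 2 #>\<^bsub>cycle_group Q 2\<^esub> bar_map p (z - bar_map f w)"
      by (rule group_homology_map_coset[OF assms(2) Q p _ d]) simp
    have mem: "bar_boundaries G 2 #>\<^bsub>cycle_group G 2\<^esub> (z - bar_map f w) \<in> carrier (group_homology 2 G)"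
      by (rule c.hom_closed) (use d in simp)
    have pd: "bar_map p (z - bar_map f w) \<in> carrier (cycle_group Q 2)"
      using bar_map_cycles[OF p d] by simp
    show "(bar_boundaries G 2 #>\<^bsub>cycle_group G 2\<^esub> z) \<otimes>\<^bsub>group_homology 2 G\<^esub>
        inv\<^bsub>group_homology 2 G\<^esub> group_homology_map 2 G f (bar_boundaries P 2 #>\<^bsub>cycle_group P 2\<^esub> w)
      \<in> H2_kernel G \<mu> \<longleftrightarrow> bar_map p (z - bar_map f w) \<in> bar_boundaries Q 2"
      unfolding fw_coset eq K kernel_def
      using mem pd_coset BQ.r_coset_eq_self_iff[OF pd]
      by (simp add: group_homology_def del: r_coset_consistent bar_map_simps)
  qed
  finally show ?thesis unfolding Q_def p_def .
qed

subsection \<open>One step up the lower central series\<close>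

text \<open>The condition \<open>onto\<close> makes \<open>Q\<close> a quotient of \<open>P\<close>
  as well, so the descriptions of N/[G, N] for \<open>p\<close> and for \<open>p \<circ> f\<close>
  share the group \<open>Q\<close> and can be compared along \<open>f\<close>.\<close>

locale quotient_step = p: group_epi G Q p
  for G :: "('b, 'n) monoid_scheme" (structure) and Q :: "('c, 'l) monoid_scheme" (structure) and p +
  fixes P :: "('a, 'm) monoid_scheme" and f
  assumes group_P: "group P" and f_hom: "f \<in> hom P G" and onto: "(p \<circ> f) ` carrier P = carrier Q"
begin

sublocale f: group_hom P G f
  by (intro group_hom.intro group_hom_axioms.intro group_P p.G.is_group f_hom)

sublocale pf: group_epi P Q "p \<circ> f"
  by (intro group_epi.intro group_epi_axioms.intro group_hom.intro group_hom_axioms.intro group_P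
      p.H.is_group hom_compose[OF f_hom p.homh] onto)

lemma f_kernel: "x \<in> pf.N \<Longrightarrow> f x \<in> p.N"
  by (auto simp: kernel_def)

lemma boundary_f: "c \<in> chains P n \<Longrightarrow> bar_boundary G (bar_map f c) = bar_map f (bar_boundary P c)"
  by (rule bar_boundary_bar_map[OF f_hom])

lemma bar_map_f_closed: "c \<in> chains P n \<Longrightarrow> bar_map f c \<in> chains G n"
  by (rule bar_map_closed[OF _ f.hom_closed])

text \<open>If \<open>f x\<close> lies in the commutator subgroup for \<open>p\<close>, then [f x]
  bounds a chain \<open>c'\<close> degenerate over \<open>Q\<close>, while injectivity on
  abelianizations lets [x] bound some \<open>c\<close> in \<open>P\<close>. The chains
  \<open>bar_map f c\<close> and \<open>c'\<close> differ by a cycle, which the hypothesis on H_2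
  corrects by a cycle \<open>w\<close> of \<open>P\<close>; then \<open>c - w\<close> still bounds
  [x] and is degenerate over \<open>Q\<close>.\<close>

lemma step_inj:
  assumes epi: "H2_epi_modulo P G Q p f"
    and ab: "inj_modulo P (derived P (carrier P)) (derived G (carrier G)) f"
  shows "inj_modulo P (commutator_subgroup P (carrier P) pf.N) (commutator_subgroup G (carrier G) p.N) f"
  unfolding inj_modulo_def
proof (intro ballI impI)
  fix x assume x: "x \<in> carrier P" "f x \<in> commutator_subgroup G (carrier G) p.N"
  have fxN: "f x \<in> p.N"
    using x(2) normal.commutator_subgroup_subset[OF p.normal_kernel] by blast
  then have xN: "x \<in> pf.N" using x(1) by (auto simp: kernel_def)
  have "f x \<in> derived G (carrier G)"
    using x(2) p.G.commutator_subgroup_subset_derived[of p.N] p.kernelD by blast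
  then have "x \<in> derived P (carrier P)" using ab x(1) unfolding inj_modulo_def by blast
  then have "frag_of [x] \<in> bar_boundaries P 1" using f.G.bar_boundaries_1_iff[OF x(1)] by blast
  then obtain c where c: "c \<in> chains P 2" "frag_of [x] = bar_boundary P c"
    unfolding bar_boundaries_def by (auto simp: numeral_2_eq_2)
  have "frag_of [f x] \<in> p.collapsible" using p.collapsible_iff[OF fxN] x(2) by blast
  then obtain c' where c': "c' \<in> chains G 2" "frag_of [f x] = bar_boundary G c'" "bar_map p c' \<in> p.degenerate"
    unfolding p.collapsible_def by blast
  have "bar_map f c - c' \<in> bar_cycles G 2"
    using c c' bar_map_f_closed[OF c(1)] boundary_f[OF c(1)]
    by (simp add: bar_cycles_iff flip: c(2) c'(2))
  then obtain w where w: "w \<in> bar_cycles P 2" "bar_map p (bar_map f c - c' - bar_map f w) \<in> bar_boundaries Q 2"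
    using epi unfolding H2_epi_modulo_def by blast
  have "bar_map p (bar_map f c - c' - bar_map f w) + bar_map p c' \<in> p.degenerate"
    using additive_setD(4)[OF p.additive_degenerate] w(2) c'(3) p.boundary_subset_degenerate by blast
  then have "bar_map (p \<circ> f) (c - w) \<in> pf.degenerate"
    by (simp add: bar_map_comp[symmetric])
  moreover have "c - w \<in> chains P 2" "bar_boundary P (c - w) = frag_of [x]"
    using c w(1) by (auto simp: bar_cycles_iff)
  ultimately have "frag_of [x] \<in> pf.collapsible"
    unfolding pf.collapsible_def by (metis (mono_tags, lifting) image_eqI mem_Collect_eq)
  then show "x \<in> commutator_subgroup P (carrier P) pf.N"
    using pf.collapsible_iff[OF xN] by blast
qed

text \<open>The connecting map evaluated in \<open>P\<close>: lift \<open>z\<close> along a section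
  of \<open>p \<circ> f\<close>, observe that the boundary of the lift dies in \<open>Q\<close>, and
  absorb the collapsible part of that boundary into the chain, at the price of a degenerate error
  over \<open>Q\<close>.\<close>

lemma cycle_lift:
  assumes "z \<in> bar_cycles Q 2"
  obtains x c where "x \<in> pf.N" "c \<in> chains P 2" "bar_boundary P c = frag_of [x]"
    "bar_map (p \<circ> f) c - z \<in> p.degenerate"
proof -
  obtain s where s: "\<And>q. q \<in> carrier Q \<Longrightarrow> s q \<in> carrier P" "\<And>q. q \<in> carrier Q \<Longrightarrow> (p \<circ> f) (s q) = q"
    using pf.obtain_section by metis
  have z: "z \<in> chains Q 2" "bar_boundary Q z = 0" using assms by (auto simp: bar_cycles_iff)
  define c where "c = bar_map s z"
  have c: "c \<in> chains P 2" unfolding c_def using z(1) s(1) by (rule bar_map_closed)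
  have "bar_map (p \<circ> f) c = bar_map (\<lambda>x. x) z"
    unfolding c_def bar_map_comp using z(1) by (rule bar_map_cong) (use s in simp)
  then have cz: "bar_map (p \<circ> f) c = z" by (simp add: bar_map_id)
  have "bar_boundary P c \<in> chains P 1"
    using bar_boundary_closed[OF group_P c] by simp
  moreover have "bar_map (p \<circ> f) (bar_boundary P c) = 0"
    using bar_boundary_bar_map[OF pf.homh c] cz z(2) by simp
  ultimately obtain x where x: "x \<in> pf.N" "bar_boundary P c - frag_of [x] \<in> pf.collapsible"
    using pf.chain_in_kernel_collapsible by blast
  then obtain d where d: "d \<in> chains P 2" "bar_map (p \<circ> f) d \<in> pf.degenerate"
    "bar_boundary P c - frag_of [x] = bar_boundary P d"
    unfolding pf.collapsible_def by blast
  have "bar_boundary P (c - d) = frag_of [x]"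
    using d(3) by (simp add: algebra_simps)
  moreover have "bar_map (p \<circ> f) (c - d) - z \<in> p.degenerate"
    using additive_setD(3)[OF p.additive_degenerate] d(2) cz by simp
  ultimately show thesis using that[OF x(1), of "c - d"] c d(1) by simp
qed

text \<open>The boundary of [1|1] is the nonzero chain [1], so for a cycle the multiple of [1|1] has
  coefficient zero.\<close>

lemma degenerate_cycle:
  assumes "d \<in> p.degenerate" "d \<in> bar_cycles Q 2"
  shows "d \<in> bar_boundaries Q 2"
proof -
  obtain k where k: "d - frag_cmul k (frag_of [\<one>\<^bsub>Q\<^esub>, \<one>\<^bsub>Q\<^esub>]) \<in> bar_boundaries Q 2"
    using assms(1) unfolding p.degenerate_def by blast
  then have "bar_boundary Q (d - frag_cmul k (frag_of [\<one>\<^bsub>Q\<^esub>, \<one>\<^bsub>Q\<^esub>])) = 0"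
    using bar_boundaries_subset_cycles[OF p.H.is_group, of 2] bar_cycles_iff by blast
  then have "k = 0"
    using assms(2) by (simp add: bar_cycles_iff bar_boundary_frag_of)
  then show ?thesis using k by simp
qed

text \<open>Lift the image of \<open>z\<close> in \<open>Q\<close> to a chain \<open>c\<close> of
  \<open>P\<close> with boundary [x]. Comparison with \<open>z\<close> puts \<open>f x\<close> into
  the commutator subgroup of \<open>G\<close>, injectivity puts \<open>x\<close> into that of
  \<open>P\<close>, and this provides \<open>c'\<close> with the same boundary and degenerate over
  \<open>Q\<close>; the difference \<open>c - c'\<close> is the required cycle.\<close>

lemma step_H2_epi:
  assumes inj: "inj_modulo P (commutator_subgroup P (carrier P) pf.N) (commutator_subgroup G (carrier G) p.N) f"
  shows "H2_epi_modulo P G Q p f"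
  unfolding H2_epi_modulo_def
proof
  fix z assume z: "z \<in> bar_cycles G 2"
  have zc: "z \<in> chains G 2" "bar_boundary G z = 0" using z by (auto simp: bar_cycles_iff)
  obtain x c where x: "x \<in> pf.N" and c: "c \<in> chains P 2" "bar_boundary P c = frag_of [x]"
    "bar_map (p \<circ> f) c - bar_map p z \<in> p.degenerate"
    using cycle_lift[OF bar_map_cycles[OF p.homh z]] by blast
  have xc: "x \<in> carrier P" using x by (rule pf.kernelD)
  have "bar_map p (bar_map f c - z) \<in> p.degenerate"
    using c(3) by (simp add: bar_map_comp[symmetric])
  moreover have "bar_map f c - z \<in> chains G 2" "bar_boundary G (bar_map f c - z) = frag_of [f x]"
    using c(1,2) zc bar_map_f_closed boundary_f by auto
  ultimately have "frag_of [f x] \<in> p.collapsible"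
    unfolding p.collapsible_def by (metis (mono_tags, lifting) image_eqI mem_Collect_eq)
  then have "f x \<in> commutator_subgroup G (carrier G) p.N"
    using p.collapsible_iff[OF f_kernel[OF x]] by blast
  then have "x \<in> commutator_subgroup P (carrier P) pf.N"
    using inj xc unfolding inj_modulo_def by blast
  then have "frag_of [x] \<in> pf.collapsible"
    using pf.collapsible_iff[OF x] by blast
  then obtain c' where c': "c' \<in> chains P 2" "bar_map (p \<circ> f) c' \<in> pf.degenerate" "frag_of [x] = bar_boundary P c'"
    unfolding pf.collapsible_def by blast
  define w where "w = c - c'"
  have w: "w \<in> bar_cycles P 2"
    unfolding w_def using c c' by (simp add: bar_cycles_iff)
  have "bar_map (p \<circ> f) c' - (bar_map (p \<circ> f) c - bar_map p z) \<in> p.degenerate"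
    using additive_setD(2)[OF p.additive_degenerate] c(3) c'(2) by simp
  then have deg: "bar_map p (z - bar_map f w) \<in> p.degenerate"
    unfolding w_def by (simp add: bar_map_comp[symmetric] algebra_simps)
  have "z - bar_map f w \<in> bar_cycles G 2"
    using additive_setD(2)[OF additive_bar_cycles z bar_map_cycles[OF f_hom w]] .
  then have "bar_map p (z - bar_map f w) \<in> bar_boundaries Q 2"
    using degenerate_cycle[OF deg] bar_map_cycles[OF p.homh] by blast
  then show "\<exists>w\<in>bar_cycles P 2. bar_map p (z - bar_map f w) \<in> bar_boundaries Q 2"
    using w by blast
qed

end

subsection \<open>Presented groups\<close>

lemma gwords_simps [simp]:
  "[] \<in> gwords S" "a # w \<in> gwords S \<longleftrightarrow> fst a \<in> S \<and> w \<in> gwords S"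
  "u @ v \<in> gwords S \<longleftrightarrow> u \<in> gwords S \<and> v \<in> gwords S"
  by (auto simp: gwords_def)

definition inverse_word :: "'i gword \<Rightarrow> 'i gword"
  where "inverse_word w = rev (map (\<lambda>(s, b). (s, \<not> b)) w)"

lemma inverse_word_simps [simp]:
  "inverse_word [] = []" "inverse_word ((s, b) # w) = inverse_word w @ [(s, \<not> b)]"
  by (simp_all add: inverse_word_def)

lemma inverse_word_closed [simp]: "w \<in> gwords S \<Longrightarrow> inverse_word w \<in> gwords S"
  by (induction w) auto

locale presentation =
  fixes S :: "'i set" and R :: "'i gword set"
  assumes relators: "R \<subseteq> gwords S"
begin

lemma gword_eq_in: "gword_eq S R u v \<Longrightarrow> u \<in> gwords S \<and> v \<in> gwords S"
  by (induction rule: gword_eq.induct) (use relators in auto)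

lemma gword_eq_context:
  "gword_eq S R u v \<Longrightarrow> a \<in> gwords S \<Longrightarrow> b \<in> gwords S \<Longrightarrow> gword_eq S R (a @ u @ b) (a @ v @ b)"
proof (induction rule: gword_eq.induct)
  case (refl w)
  then show ?case by (simp add: gword_eq.refl)
next
  case (sym u v)
  then show ?case by (blast intro: gword_eq.sym)
next
  case (trans u v w)
  then show ?case by (blast intro: gword_eq.trans)
next
  case (cancel u v s c)
  then show ?case using gword_eq.cancel[of "a @ u" S "v @ b" s R c] by simp
next
  case (relator u v r)
  then show ?case using gword_eq.relator[of "a @ u" S "v @ b" r R] by simp
qed

lemma gword_eq_append:
  assumes "gword_eq S R u u'" "gword_eq S R v v'"
  shows "gword_eq S R (u @ v) (u' @ v')"
  using gword_eq_context[OF assms(1), of "[]" v] gword_eq_context[OF assms(2), of u' "[]"]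
    gword_eq_in[OF assms(1)] gword_eq_in[OF assms(2)] by (auto intro: gword_eq.trans)

lemma gword_class_eq_iff:
  assumes "u \<in> gwords S"
  shows "gword_class S R u = gword_class S R v \<longleftrightarrow> gword_eq S R u v"
proof
  assume "gword_class S R u = gword_class S R v"
  then have "u \<in> gword_class S R v"
    using gword_eq.refl[OF assms] by (auto simp: gword_class_def)
  then show "gword_eq S R u v" by (auto simp: gword_class_def intro: gword_eq.sym)
next
  assume "gword_eq S R u v"
  then show "gword_class S R u = gword_class S R v"
    unfolding gword_class_def by (blast intro: gword_eq.sym gword_eq.trans)
qed

lemma carrier_presented: "carrier (presented_group S R) = gword_class S R ` gwords S"
  and one_presented: "\<one>\<^bsub>presented_group S R\<^esub> = gword_class S R []"
  by (simp_all add: presented_group_def)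

lemma mult_presented:
  assumes "u \<in> gwords S" "v \<in> gwords S"
  shows "gword_class S R u \<otimes>\<^bsub>presented_group S R\<^esub> gword_class S R v = gword_class S R (u @ v)"
proof -
  have "gword_class S R (u' @ v') = gword_class S R (u @ v)"
    if "u' \<in> gword_class S R u" "v' \<in> gword_class S R v" for u' v'
    using that gword_eq_append[of u u' v v'] assms gword_class_eq_iff[of "u @ v" "u' @ v'"]
    by (simp add: gword_class_def)
  moreover have "u \<in> gword_class S R u" "v \<in> gword_class S R v"
    using assms by (auto simp: gword_class_def intro: gword_eq.refl)
  ultimately have "(\<Union>u'\<in>gword_class S R u. \<Union>v'\<in>gword_class S R v. gword_class S R (u' @ v'))
      = gword_class S R (u @ v)"
    by blast
  then show ?thesis by (simp add: presented_group_def)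
qed

lemma inverse_word_eq: "w \<in> gwords S \<Longrightarrow> gword_eq S R (inverse_word w @ w) []"
proof (induction w)
  case Nil
  show ?case by (simp add: gword_eq.refl)
next
  case (Cons a w)
  obtain s b where a: "a = (s, b)" by (cases a)
  have "gword_eq S R (inverse_word w @ [(s, \<not> b), (s, \<not> \<not> b)] @ w) (inverse_word w @ w)"
    using Cons.prems a by (intro gword_eq.cancel) auto
  then show ?case using Cons a by (auto intro: gword_eq.trans)
qed

lemma group_presented: "group (presented_group S R)"
proof (rule groupI)
  fix X assume "X \<in> carrier (presented_group S R)"
  then obtain w where w: "w \<in> gwords S" "X = gword_class S R w" by (auto simp: carrier_presented)
  then have "gword_class S R (inverse_word w) \<otimes>\<^bsub>presented_group S R\<^esub> X = \<one>\<^bsub>presented_group S R\<^esub>"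
    using gword_class_eq_iff[of "inverse_word w @ w" "[]"] inverse_word_eq
    by (simp add: mult_presented one_presented)
  then show "\<exists>Y\<in>carrier (presented_group S R). Y \<otimes>\<^bsub>presented_group S R\<^esub> X = \<one>\<^bsub>presented_group S R\<^esub>"
    using w by (auto simp: carrier_presented)
qed (auto simp: carrier_presented one_presented mult_presented)

lemma generate_presented:
  "generate (presented_group S R) ((\<lambda>s. gword_class S R [(s, True)]) ` S) = carrier (presented_group S R)"
    (is "generate ?P ?T = _")
proof
  interpret group ?P by (rule group_presented)
  have T: "?T \<subseteq> carrier ?P" by (auto simp: carrier_presented)
  show "generate ?P ?T \<subseteq> carrier ?P" by (rule generate_incl[OF T])
  have letter: "gword_class S R [(s, b)] \<in> generate ?P ?T" if s: "s \<in> S" for s b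
  proof -
    have t: "gword_class S R [(s, True)] \<in> generate ?P ?T" using s by (intro generate.incl) blast
    have "gword_class S R [(s, False)] \<otimes>\<^bsub>?P\<^esub> gword_class S R [(s, True)] = \<one>\<^bsub>?P\<^esub>"
      using s inverse_word_eq[of "[(s, True)]"] gword_class_eq_iff[of "[(s, False), (s, True)]" "[]"]
      by (simp add: mult_presented one_presented)
    then have "inv\<^bsub>?P\<^esub> gword_class S R [(s, True)] = gword_class S R [(s, False)]"
      using s by (intro inv_equality) (auto simp: carrier_presented)
    then show ?thesis
      using t generate_m_inv_closed[OF T t] by (cases b) auto
  qed
  have "gword_class S R w \<in> generate ?P ?T" if "w \<in> gwords S" for w
    using that
  proof (induction w)
    case Nil
    show ?case using generate.one[of ?P] by (simp add: one_presented)
  next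
    case (Cons a w)
    then show ?case
      using generate.eng[OF letter[of "fst a" "snd a"], of "gword_class S R w"]
        mult_presented[of "[a]" w] by simp
  qed
  then show "carrier ?P \<subseteq> generate ?P ?T" by (auto simp: carrier_presented)
qed

end

lemma finitely_presented_imp_generated:
  assumes "finitely_presented_group B"
  shows "finitely_generated_group B"
proof -
  obtain S :: "nat set" and R where SR: "finite S" "R \<subseteq> gwords S" "B \<cong> presented_group S R" and B: "group B"
    using assms unfolding finitely_presented_group_def by blast
  interpret presentation S R by unfold_locales (rule SR(2))
  interpret B: group B by (rule B)
  have "presented_group S R \<cong> B" using SR(3) by (rule B.iso_sym)
  then obtain i where i: "i \<in> iso (presented_group S R) B" unfolding is_iso_def by blast
  interpret i: group_hom "presented_group S R" B i
    by (intro group_hom.intro group_hom_axioms.intro group_presented B iso_imp_homomorphism[OF i])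
  let ?T = "(\<lambda>s. gword_class S R [(s, True)]) ` S"
  have T: "?T \<subseteq> carrier (presented_group S R)" by (auto simp: carrier_presented)
  have "generate B (i ` ?T) = carrier B"
    using i.generate_img[OF T] generate_presented i unfolding iso_iff by simp
  moreover have "i ` ?T \<subseteq> carrier B" using T i.hom_closed by blast
  ultimately show ?thesis
    unfolding finitely_generated_group_def using SR(1) B by blast
qed

subsection \<open>Copies of a group\<close>

text \<open>Locality and localizations are tested on groups over fixed types, so groups of words or
  cosets have to be moved there along a map injective on the carrier.\<close>

definition copy_group :: "('a \<Rightarrow> 'b) \<Rightarrow> ('a, 'm) monoid_scheme \<Rightarrow> 'b monoid"
  where "copy_group j G = \<lparr>carrier = j ` carrier G,
    monoid.mult = (\<lambda>x y. j (inv_into (carrier G) j x \<otimes>\<^bsub>G\<^esub> inv_into (carrier G) j y)), one = j \<one>\<^bsub>G\<^esub>\<rparr>"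

lemma (in group) copy_group_iso:
  assumes "inj_on j (carrier G)"
  shows "group (copy_group j G)" and "j \<in> iso G (copy_group j G)"
proof -
  show iso: "j \<in> iso G (copy_group j G)"
    using assms by (auto simp: iso_def hom_def copy_group_def bij_betw_def)
  have "monoid (copy_group j G)"
    using assms by (intro monoidI) (auto simp: copy_group_def m_assoc)
  then show "group (copy_group j G)"
    using iso_imp_group[OF is_isoI[OF iso]] by blast
qed

subsection \<open>Free groups\<close>

text \<open>Freeness is recorded by words, with \<open>cl\<close> sending a word to its element,
  because the vanishing of H_2 is shown by reading words letter by letter. The carrier type stays
  open so that a model on the natural numbers qualifies.\<close>

locale free_group = group F for F (structure) +
  fixes S :: "'i set" and cl :: "'i gword \<Rightarrow> 'a"
  assumes cl_image: "cl ` gwords S = carrier F"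
    and cl_append: "u \<in> gwords S \<Longrightarrow> v \<in> gwords S \<Longrightarrow> cl (u @ v) = cl u \<otimes> cl v"
    and cl_eq_iff: "u \<in> gwords S \<Longrightarrow> v \<in> gwords S \<Longrightarrow> cl u = cl v \<longleftrightarrow> gword_eq S {} u v"
begin

lemma cl_closed [simp]: "w \<in> gwords S \<Longrightarrow> cl w \<in> carrier F"
  using cl_image by blast

lemma cl_Nil [simp]: "cl [] = \<one>"
proof -
  have "cl [] \<otimes> cl [] = cl []" using cl_append[of "[]" "[]"] by simp
  then show ?thesis using r_cancel_one'[of "cl []" "cl []"] by simp
qed

lemma cl_letter_inverse:
  assumes "s \<in> S"
  shows "cl [(s, b)] \<otimes> cl [(s, \<not> b)] = \<one>"
proof -
  have "gword_eq S {} ([] @ [(s, b), (s, \<not> b)] @ []) ([] @ [])"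
    using assms by (intro gword_eq.cancel) auto
  then show ?thesis
    using assms cl_append[of "[(s, b)]" "[(s, \<not> b)]"] cl_eq_iff[of "[(s, b), (s, \<not> b)]" "[]"] by simp
qed

lemma cl_letter: "s \<in> S \<Longrightarrow> cl [(s, False)] = inv cl [(s, True)]"
  using cl_letter_inverse[of s False] by (intro inv_equality[symmetric]) auto

lemma cl_Cons: "a # w \<in> gwords S \<Longrightarrow> cl (a # w) = cl [a] \<otimes> cl w"
  using cl_append[of "[a]" w] by simp

lemma hom_eqI:
  assumes "group K" "g \<in> hom F K" "h \<in> hom F K"
    and gen: "\<And>s. s \<in> S \<Longrightarrow> g (cl [(s, True)]) = h (cl [(s, True)])"
    and "x \<in> carrier F"
  shows "g x = h x"
proof -
  interpret g: group_hom F K g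
    by (intro group_hom.intro group_hom_axioms.intro assms is_group)
  interpret h: group_hom F K h
    by (intro group_hom.intro group_hom_axioms.intro assms is_group)
  have letter: "g (cl [(s, b)]) = h (cl [(s, b)])" if "s \<in> S" for s b
    using that gen[OF that] by (cases b) (simp_all add: cl_letter)
  have "g (cl w) = h (cl w)" if "w \<in> gwords S" for w
    using that
  proof (induction w)
    case (Cons a w)
    then show ?case using letter[of "fst a" "snd a"] by (simp add: cl_Cons[of a w])
  qed simp
  moreover obtain w where "w \<in> gwords S" "x = cl w"
    using assms(5) by (auto simp flip: cl_image)
  ultimately show ?thesis by simp
qed

lemma hom_exists:
  assumes "group K" and \<phi>: "\<And>s. s \<in> S \<Longrightarrow> \<phi> s \<in> carrier K"
  obtains h where "h \<in> hom F K" "\<And>s. s \<in> S \<Longrightarrow> h (cl [(s, True)]) = \<phi> s"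
proof -
  interpret K: group K by fact
  define e where "e a = (if snd a then \<phi> (fst a) else inv\<^bsub>K\<^esub> \<phi> (fst a))" for a
  define ev where "ev w = foldr (\<lambda>a k. e a \<otimes>\<^bsub>K\<^esub> k) w \<one>\<^bsub>K\<^esub>" for w
  have e: "e a \<in> carrier K" if "fst a \<in> S" for a using that \<phi> by (simp add: e_def)
  have ev: "ev w \<in> carrier K" if "w \<in> gwords S" for w
    using that by (induction w) (auto simp: ev_def e)
  have ev_append: "ev (u @ v) = ev u \<otimes>\<^bsub>K\<^esub> ev v" if "u \<in> gwords S" "v \<in> gwords S" for u v
    using that(1)
  proof (induction u)
    case Nil
    then show ?case using ev[OF that(2)] by (simp add: ev_def)
  next
    case (Cons a u)
    then show ?case using ev[of u] ev[OF that(2)] e[of a] by (simp add: ev_def K.m_assoc)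
  qed
  have ev_eq: "ev u = ev v" if "gword_eq S {} u v" for u v
    using that
  proof (induction rule: gword_eq.induct)
    case (cancel u v s b)
    have "ev [(s, b), (s, \<not> b)] = \<one>\<^bsub>K\<^esub>"
      using cancel(3) \<phi> by (cases b) (simp_all add: ev_def e_def)
    then show ?case
      using cancel ev_append[of u "[(s, b), (s, \<not> b)] @ v"] ev_append[of "[(s, b), (s, \<not> b)]" v]
        ev_append[of u v] ev by simp
  qed auto
  define h where "h x = ev (SOME w. w \<in> gwords S \<and> cl w = x)" for x
  have h: "h (cl w) = ev w" if "w \<in> gwords S" for w
  proof -
    have "(SOME v. v \<in> gwords S \<and> cl v = cl w) \<in> gwords S \<and> cl (SOME v. v \<in> gwords S \<and> cl v = cl w) = cl w"
      by (rule someI[of _ w]) (simp add: that)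
    then show ?thesis
      unfolding h_def using that cl_eq_iff ev_eq by blast
  qed
  have "h \<in> hom F K"
  proof (rule homI)
    show "h x \<in> carrier K" if "x \<in> carrier F" for x
      using that h ev unfolding cl_image[symmetric] by auto
    show "h (x \<otimes> y) = h x \<otimes>\<^bsub>K\<^esub> h y" if "x \<in> carrier F" "y \<in> carrier F" for x y
      using that h ev_append unfolding cl_image[symmetric] by (auto simp: cl_append[symmetric])
  qed
  moreover have "h (cl [(s, True)]) = \<phi> s" if "s \<in> S" for s
    using that h[of "[(s, True)]"] \<phi> by (simp add: ev_def e_def)
  ultimately show thesis by (rule that)
qed

lemma generate_letters: "generate F ((\<lambda>s. cl [(s, True)]) ` S) = carrier F"
proof
  have T: "(\<lambda>s. cl [(s, True)]) ` S \<subseteq> carrier F" by auto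
  show "generate F ((\<lambda>s. cl [(s, True)]) ` S) \<subseteq> carrier F" by (rule generate_incl[OF T])
  have letter: "cl [(s, b)] \<in> generate F ((\<lambda>s. cl [(s, True)]) ` S)" if "s \<in> S" for s b
  proof -
    have "cl [(s, True)] \<in> (\<lambda>s. cl [(s, True)]) ` S" using that by blast
    then show ?thesis
      using that by (cases b) (simp_all add: cl_letter generate.incl generate.inv)
  qed
  have "cl w \<in> generate F ((\<lambda>s. cl [(s, True)]) ` S)" if "w \<in> gwords S" for w
    using that
  proof (induction w)
    case Nil
    show ?case using generate.one by simp
  next
    case (Cons a w)
    then show ?case
      using generate.eng[OF letter[of "fst a" "snd a"]] by (simp add: cl_Cons[of a w])
  qed
  then show "carrier F \<subseteq> generate F ((\<lambda>s. cl [(s, True)]) ` S)"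
    by (auto simp flip: cl_image)
qed

text \<open>The function \<open>T\<close> below satisfies \<open>T(uv) = T(u) + T(v) + [u|v]\<close> modulo boundaries, that is,
  it trivializes the universal 2-cocycle; it exists because words can be read letter by letter.\<close>

lemma bar_cycles_2_subset_boundaries: "bar_cycles F 2 \<subseteq> bar_boundaries F 2"
proof
  fix z assume z: "z \<in> bar_cycles F 2"
  note bc = bar_boundaries_closed
  \<comment> \<open>The values are dictated by the law for \<open>T\<close>. Empty words require
    \<open>T [] = - frag_of [\<one>, \<one>]\<close>; a generator may receive 0, and reading a
    generator followed by its inverse as the empty word then fixes the value on inverse
    letters.\<close>
  define T1 where "T1 a = (if snd a then 0 else - frag_of [\<one>, \<one>] - frag_of [cl [(fst a, True)], cl [a]])" for a
  define T where "T = rec_list (- frag_of [\<one>, \<one>]) (\<lambda>a w t. T1 a + t + frag_of [cl [a], cl w])"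
  have T_simps: "T [] = - frag_of [\<one>, \<one>]" "T (a # w) = T1 a + T w + frag_of [cl [a], cl w]" for a w
    by (simp_all add: T_def)
  have cocycle: "frag_of [y, k] - frag_of [x \<otimes> y, k] + frag_of [x, y \<otimes> k] - frag_of [x, y] \<in> bar_boundaries F 2"
    if "x \<in> carrier F" "y \<in> carrier F" "k \<in> carrier F" for x y k
    using bar_boundariesI[of "frag_of [x, y, k]" F 2] that by (simp add: bar_boundary_frag_of)
  have T_append: "T (u @ v) - T u - T v - frag_of [cl u, cl v] \<in> bar_boundaries F 2"
    if "u \<in> gwords S" "v \<in> gwords S" for u v
    using that(1)
  proof (induction u)
    case Nil
    show ?case
      using bc(3)[OF degenerate_boundaries(1)[of "cl v"]] that(2) by (simp add: T_simps)
  next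
    case (Cons a u)
    have c: "cl [a] \<in> carrier F" "cl u \<in> carrier F" "cl v \<in> carrier F"
      using Cons.prems that(2) by simp_all
    have cl: "cl (u @ v) = cl u \<otimes> cl v" "cl (a # u) = cl [a] \<otimes> cl u"
      using Cons.prems that(2) by (simp_all add: cl_append cl_Cons[of a u])
    have "T ((a # u) @ v) - T (a # u) - T v - frag_of [cl (a # u), cl v]
      = (T (u @ v) - T u - T v - frag_of [cl u, cl v])
        + (frag_of [cl u, cl v] - frag_of [cl [a] \<otimes> cl u, cl v] + frag_of [cl [a], cl u \<otimes> cl v] - frag_of [cl [a], cl u])"
      by (simp add: T_simps cl)
    also have "\<dots> \<in> bar_boundaries F 2"
      using bc(4)[OF Cons.IH cocycle[OF c]] Cons.prems by simp
    finally show ?case .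
  qed
  have T1_pair: "T1 (s, b) + T1 (s, \<not> b) + frag_of [\<one>, \<one>] + frag_of [cl [(s, b)], cl [(s, \<not> b)]] \<in> bar_boundaries F 2"
    if s: "s \<in> S" for s b
  proof (cases b)
    case True
    then show ?thesis using bc(1) by (simp add: T1_def)
  next
    case False
    let ?x = "cl [(s, True)]" and ?y = "cl [(s, False)]"
    have xy: "?x \<in> carrier F" "?y \<in> carrier F" "?x \<otimes> ?y = \<one>" "?y \<otimes> ?x = \<one>"
      using s cl_letter_inverse[of s True] cl_letter_inverse[of s False] by simp_all
    \<comment> \<open>With the inverse letter in front, what remains is [y|x] - [x|y], the boundary
      of [x|y|x] up to degenerate chains.\<close>
    have "(frag_of [?y, ?x] - frag_of [\<one>, ?x] + frag_of [?x, \<one>] - frag_of [?x, ?y])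
        + (frag_of [\<one>, ?x] - frag_of [\<one>, \<one>]) - (frag_of [?x, \<one>] - frag_of [\<one>, \<one>]) \<in> bar_boundaries F 2"
      using bc(2)[OF bc(4)[OF cocycle[of ?x ?y ?x] degenerate_boundaries(1)] degenerate_boundaries(2), of ?x ?x] xy
      by simp
    then show ?thesis using False by (simp add: T1_def algebra_simps)
  qed
  have T_pair: "T ((s, b) # (s, \<not> b) # v) - T v \<in> bar_boundaries F 2" if "s \<in> S" "v \<in> gwords S" for s b v
  proof -
    let ?x = "cl [(s, b)]" and ?y = "cl [(s, \<not> b)]" and ?k = "cl v"
    have xy: "?x \<in> carrier F" "?y \<in> carrier F" "?k \<in> carrier F" "?x \<otimes> ?y = \<one>"
      using that cl_letter_inverse[of s b] by simp_all
    have "T ((s, b) # (s, \<not> b) # v) - T v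
      = (T1 (s, b) + T1 (s, \<not> b) + frag_of [\<one>, \<one>] + frag_of [?x, ?y])
        + (frag_of [?y, ?k] - frag_of [?x \<otimes> ?y, ?k] + frag_of [?x, ?y \<otimes> ?k] - frag_of [?x, ?y])
        + (frag_of [\<one>, ?k] - frag_of [\<one>, \<one>])"
      using that by (simp add: T_simps xy(4) cl_Cons[of "(s, \<not> b)" v])
    then show ?thesis
      using bc(4)[OF bc(4)[OF T1_pair[OF that(1)] cocycle[OF xy(1-3)]] degenerate_boundaries(1)[OF xy(3)]]
      by (simp only:)
  qed
  have T_eq: "T u - T v \<in> bar_boundaries F 2" if "gword_eq S {} u v" for u v
    using that
  proof (induction rule: gword_eq.induct)
    case (refl w)
    then show ?case using bc(1) by simp
  next
    case (sym u v)
    then show ?case using bc(3) by fastforce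
  next
    case (trans u v w)
    then show ?case using bc(4) by fastforce
  next
    case (cancel u v s b)
    let ?p = "[(s, b), (s, \<not> b)]"
    have w: "?p @ v \<in> gwords S" using cancel by simp
    have "gword_eq S {} ([] @ ?p @ v) ([] @ v)" using cancel by (intro gword_eq.cancel) auto
    then have "cl (?p @ v) = cl v" using cl_eq_iff[OF w] cancel by simp
    then have "T (u @ ?p @ v) - T (u @ v)
      = (T (u @ ?p @ v) - T u - T (?p @ v) - frag_of [cl u, cl (?p @ v)])
        - (T (u @ v) - T u - T v - frag_of [cl u, cl v]) + (T (?p @ v) - T v)"
      by simp
    then show ?case
      using bc(4)[OF bc(2)[OF T_append[OF cancel(1) w] T_append[OF cancel(1,2)]] T_pair[OF cancel(3,2)], of b]
      by (simp only: append_Cons append_Nil)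
  qed simp
  define r where "r x = (SOME w. w \<in> gwords S \<and> cl w = x)" for x
  have r: "r x \<in> gwords S" "cl (r x) = x" if "x \<in> carrier F" for x
  proof -
    have "\<exists>w. w \<in> gwords S \<and> cl w = x" using that by (auto simp flip: cl_image)
    then show "r x \<in> gwords S" "cl (r x) = x" unfolding r_def by (metis (mono_tags, lifting) someI_ex)+
  qed
  define t where "t = frag_extend (\<lambda>xs. T (r (hd xs)))"
  \<comment> \<open>On [x|y] the second term is T(x) + T(y) - T(xy) for chosen words, hence -[x|y]
    modulo boundaries. For a cycle that term is zero, so the cycle itself is a boundary.\<close>
  have "c + t (bar_boundary F c) \<in> bar_boundaries F 2" if "c \<in> chains F 2" for c
    using that
  proof (induction rule: chains_induct)
    case zero
    show ?case using bc(1) by (simp add: t_def)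
  next
    case (diff a b)
    from bc(2)[OF diff(3,4)] show ?case by (simp add: t_def frag_extend_diff algebra_simps)
  next
    case (gen xs)
    then obtain x y where xs: "xs = [x, y]" and xy: "x \<in> carrier F" "y \<in> carrier F"
      by (auto dest!: length_1_2_3)
    have "gword_eq S {} (r x @ r y) (r (x \<otimes> y))"
      using r xy cl_eq_iff[of "r x @ r y" "r (x \<otimes> y)"] by (simp add: cl_append)
    from bc(3)[OF bc(4)[OF bc(3)[OF T_eq[OF this]] T_append[OF r(1)[OF xy(1)] r(1)[OF xy(2)]]]]
    show ?case
      using r xy by (simp add: xs bar_boundary_frag_of t_def frag_extend_diff frag_extend_add algebra_simps)
  qed
  from this[of z] z show "z \<in> bar_boundaries F 2"
    by (simp add: bar_cycles_iff t_def)
qed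

end

text \<open>The groups \<open>A\<close> and \<open>B\<close> in \<open>local_group\<close> have
  carriers in the natural numbers; here each class of words is named by the code of a chosen
  representative.\<close>

lemma ex_free_group_nat:
  fixes S :: "nat set"
  assumes "finite S"
  shows "\<exists>(F :: nat monoid) cl. free_group F S cl \<and> finitely_presented_group F"
proof -
  interpret presentation S "{}" by unfold_locales simp
  let ?P = "presented_group S {}"
  interpret P: group ?P by (rule group_presented)
  define j :: "nat gword set \<Rightarrow> nat" where "j X = to_nat (SOME w. w \<in> X)" for X
  have rep: "gword_eq S {} u (SOME w. w \<in> gword_class S {} u)" if "u \<in> gwords S" for u
  proof -
    have "(SOME w. w \<in> gword_class S {} u) \<in> gword_class S {} u"
      by (rule someI[of _ u]) (simp add: gword_class_def gword_eq.refl that)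
    then show ?thesis by (simp add: gword_class_def)
  qed
  have inj: "inj_on j (carrier ?P)"
  proof (rule inj_onI)
    fix X Y assume "X \<in> carrier ?P" "Y \<in> carrier ?P" "j X = j Y"
    then obtain u v where uv: "u \<in> gwords S" "X = gword_class S {} u" "v \<in> gwords S" "Y = gword_class S {} v"
      "(SOME w. w \<in> gword_class S {} u) = (SOME w. w \<in> gword_class S {} v)"
      by (auto simp: carrier_presented j_def)
    then have "gword_eq S {} u v"
      using rep[of u] rep[of v] by (metis gword_eq.sym gword_eq.trans)
    then show "X = Y" using uv gword_class_eq_iff by simp
  qed
  define F where "F = copy_group j ?P"
  define cl where "cl w = j (gword_class S {} w)" for w
  have F: "group F" and iso: "j \<in> iso ?P F"
    unfolding F_def by (rule P.copy_group_iso[OF inj])+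
  have "free_group F S cl"
  proof (intro free_group.intro free_group_axioms.intro F)
    show "cl ` gwords S = carrier F"
      using iso by (auto simp: iso_iff cl_def carrier_presented)
    show "cl (u @ v) = cl u \<otimes>\<^bsub>F\<^esub> cl v" if "u \<in> gwords S" "v \<in> gwords S" for u v
      using that hom_mult[OF iso_imp_homomorphism[OF iso]] unfolding cl_def
      by (simp add: mult_presented[symmetric] carrier_presented)
    show "cl u = cl v \<longleftrightarrow> gword_eq S {} u v" if "u \<in> gwords S" "v \<in> gwords S" for u v
      using that inj_on_eq_iff[OF inj, of "gword_class S {} u" "gword_class S {} v"]
        gword_class_eq_iff[of u v] by (simp add: cl_def carrier_presented)
  qed
  moreover have "finitely_presented_group F"
    unfolding finitely_presented_group_def
    using F assms P.iso_sym[OF is_isoI[OF iso]] by (intro conjI exI[of _ S] exI[of _ "{}"]) auto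
  ultimately show ?thesis by blast
qed

lemma (in group_hom) derived_subset:
  "h ` derived G (carrier G) \<subseteq> derived H (carrier H)"
  unfolding derived_img[symmetric, OF order.refl] by (intro H.mono_derived) auto

section \<open>Two-connected endomorphisms of free groups\<close>

context free_group
begin

text \<open>Modulo the derived subgroup \<open>\<alpha>\<close> fixes the generators and hence
  everything, so it is bijective on the abelianization. The group H_2 of \<open>F\<close> is zero,
  so the map on it is onto.\<close>

lemma endomorphism_two_connected:
  assumes \<alpha>: "\<alpha> \<in> hom F F"
    and gen: "\<And>s. s \<in> S \<Longrightarrow> \<alpha> (cl [(s, True)]) \<otimes> inv cl [(s, True)] \<in> derived F (carrier F)"
  shows "two_connected F F \<alpha>"
proof -
  define D where "D = derived F (carrier F)"
  interpret D: normal D F unfolding D_def by (rule derived_self_is_normal)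
  interpret \<alpha>: group_hom F F \<alpha>
    by (intro group_hom.intro group_hom_axioms.intro is_group \<alpha>)
  have eq: "D #> \<alpha> x = D #> x" if "x \<in> carrier F" for x
  proof -
    have "((#>) D \<circ> \<alpha>) x = D #> x"
    proof (rule hom_eqI[OF D.factorgroup_is_group Group.hom_compose[OF \<alpha> D.r_coset_hom_Mod] D.r_coset_hom_Mod _ that])
      show "((#>) D \<circ> \<alpha>) (cl [(s, True)]) = D #> cl [(s, True)]" if "s \<in> S" for s
        using gen[OF that] that by (simp add: D.r_coset_eq_iff flip: D_def)
    qed
    then show ?thesis by simp
  qed
  have "inj_modulo F D D \<alpha>"
    unfolding inj_modulo_def using eq D.r_coset_eq_self_iff by (metis \<alpha>.hom_closed)
  moreover have "surj_modulo F F D \<alpha>"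
    unfolding surj_modulo_def using eq D.r_coset_eq_iff by (metis \<alpha>.hom_closed)
  ultimately have H1: "group_homology_map 1 F \<alpha> \<in> iso (group_homology 1 F) (group_homology 1 F)"
    using H1_iso_iff[OF is_group is_group \<alpha>] by (simp add: D_def)
  interpret B: normal "bar_boundaries F 2" "cycle_group F 2"
    by (rule bar_boundaries_normal[OF is_group]) simp
  have hom2: "group_homology_map 2 F \<alpha> \<in> hom (group_homology 2 F) (group_homology 2 F)"
    by (rule group_homology_map_hom[OF is_group is_group \<alpha>]) simp
  have grp: "group (group_homology 2 F)"
    unfolding group_homology_def by (rule B.factorgroup_is_group)
  have "carrier (group_homology 2 F) \<subseteq> {\<one>\<^bsub>group_homology 2 F\<^esub>}"
    using bar_cycles_2_subset_boundaries B.r_coset_eq_self_iff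
    by (auto simp: group_homology_def carrier_FactGroup)
  moreover have "\<one>\<^bsub>group_homology 2 F\<^esub> = group_homology_map 2 F \<alpha> \<one>\<^bsub>group_homology 2 F\<^esub>"
    by (rule Group.hom_one[OF hom2 grp grp, symmetric])
  ultimately have "carrier (group_homology 2 F) \<subseteq> group_homology_map 2 F \<alpha> ` carrier (group_homology 2 F)"
    using monoid.one_closed[OF group.is_monoid[OF grp]] by blast
  then show ?thesis
    unfolding two_connected_def epi_iff_subset using \<alpha> H1 hom2 by blast
qed

end

subsection \<open>Local groups\<close>

text \<open>Dropping \<open>extensional\<close> turns uniqueness into agreement on the carrier, the
  form in which composites of homomorphisms can be compared.\<close>

lemma factors_uniquely_iff:
  assumes "group B" "\<alpha> \<in> hom A B"
  shows "factors_uniquely A B \<alpha> L f \<longleftrightarrow>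
    (\<exists>g\<in>hom B L. (\<forall>a\<in>carrier A. g (\<alpha> a) = f a) \<and>
      (\<forall>h\<in>hom B L. (\<forall>a\<in>carrier A. h (\<alpha> a) = f a) \<longrightarrow> (\<forall>b\<in>carrier B. h b = g b)))"
proof
  interpret B: group B by fact
  have \<alpha>: "\<alpha> a \<in> carrier B" if "a \<in> carrier A" for a
    using that assms(2) by (simp add: hom_in_carrier)
  have restrict_hom: "restrict h (carrier B) \<in> hom B L" if "h \<in> hom B L" for h
    using that by (rule B.hom_restrict) simp
  {
    assume "factors_uniquely A B \<alpha> L f"
    then obtain g where g: "g \<in> hom B L" "\<forall>a\<in>carrier A. g (\<alpha> a) = f a"
      and uniq: "\<And>h. h \<in> extensional (carrier B) \<Longrightarrow> h \<in> hom B L \<Longrightarrow> \<forall>a\<in>carrier A. h (\<alpha> a) = f a \<Longrightarrow> h = g"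
      unfolding factors_uniquely_def by blast
    have "h b = g b" if "h \<in> hom B L" "\<forall>a\<in>carrier A. h (\<alpha> a) = f a" "b \<in> carrier B" for h b
    proof -
      have "restrict h (carrier B) = g"
        using that restrict_hom \<alpha> by (intro uniq) auto
      then show ?thesis using that(3) by auto
    qed
    then show "\<exists>g\<in>hom B L. (\<forall>a\<in>carrier A. g (\<alpha> a) = f a) \<and>
      (\<forall>h\<in>hom B L. (\<forall>a\<in>carrier A. h (\<alpha> a) = f a) \<longrightarrow> (\<forall>b\<in>carrier B. h b = g b))"
      using g by blast
  next
    assume "\<exists>g\<in>hom B L. (\<forall>a\<in>carrier A. g (\<alpha> a) = f a) \<and>
      (\<forall>h\<in>hom B L. (\<forall>a\<in>carrier A. h (\<alpha> a) = f a) \<longrightarrow> (\<forall>b\<in>carrier B. h b = g b))"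
    then obtain g where g: "g \<in> hom B L" "\<forall>a\<in>carrier A. g (\<alpha> a) = f a"
      and uniq: "\<And>h b. h \<in> hom B L \<Longrightarrow> \<forall>a\<in>carrier A. h (\<alpha> a) = f a \<Longrightarrow> b \<in> carrier B \<Longrightarrow> h b = g b"
      by blast
    show "factors_uniquely A B \<alpha> L f"
      unfolding factors_uniquely_def
    proof (rule ex1I[of _ "restrict g (carrier B)"])
      show "restrict g (carrier B) \<in> extensional (carrier B) \<and> restrict g (carrier B) \<in> hom B L \<and>
          (\<forall>a\<in>carrier A. restrict g (carrier B) (\<alpha> a) = f a)"
        using g restrict_hom \<alpha> by auto
      show "h = restrict g (carrier B)"
        if "h \<in> extensional (carrier B) \<and> h \<in> hom B L \<and> (\<forall>a\<in>carrier A. h (\<alpha> a) = f a)" for h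
        using that uniq by (intro extensionalityI[of _ "carrier B"]) auto
    qed
  }
qed

lemma factors_uniquelyE:
  assumes "factors_uniquely A B \<alpha> L f" "group B" "\<alpha> \<in> hom A B"
  obtains g where "g \<in> hom B L" "\<And>a. a \<in> carrier A \<Longrightarrow> g (\<alpha> a) = f a"
  using factors_uniquely_iff[OF assms(2,3), THEN iffD1, OF assms(1)] that by blast

lemma factors_uniquely_unique:
  assumes "factors_uniquely A B \<alpha> L f" "group B" "\<alpha> \<in> hom A B"
    and "g \<in> hom B L" "h \<in> hom B L"
    and "\<And>a. a \<in> carrier A \<Longrightarrow> g (\<alpha> a) = f a" "\<And>a. a \<in> carrier A \<Longrightarrow> h (\<alpha> a) = f a" "b \<in> carrier B"
  shows "g b = h b"
proof -
  obtain k where "\<forall>h\<in>hom B L. (\<forall>a\<in>carrier A. h (\<alpha> a) = f a) \<longrightarrow> (\<forall>b\<in>carrier B. h b = k b)"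
    using factors_uniquely_iff[OF assms(2,3), THEN iffD1, OF assms(1)] by blast
  then have "g b = k b" "h b = k b" using assms(4-8) by blast+
  then show ?thesis by simp
qed

lemma factors_uniquelyI:
  assumes "group B" "\<alpha> \<in> hom A B" "g \<in> hom B L" "\<And>a. a \<in> carrier A \<Longrightarrow> g (\<alpha> a) = f a"
    and "\<And>h b. h \<in> hom B L \<Longrightarrow> (\<And>a. a \<in> carrier A \<Longrightarrow> h (\<alpha> a) = f a) \<Longrightarrow> b \<in> carrier B \<Longrightarrow> h b = g b"
  shows "factors_uniquely A B \<alpha> L f"
  by (rule factors_uniquely_iff[OF assms(1,2), THEN iffD2], rule bexI[OF _ assms(3)])
    (simp add: assms(4,5))

section \<open>Transport of factorizations and locality along isomorphisms\<close>

lemma factors_uniquely_iso: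
  assumes "factors_uniquely A B \<alpha> L (inv_into (carrier L) j \<circ> f)" "group B" "group L" "\<alpha> \<in> hom A B"
    and j: "j \<in> iso L L'" and f: "f \<in> hom A L'"
  shows "factors_uniquely A B \<alpha> L' f"
proof -
  let ?i = "inv_into (carrier L) j"
  have i: "?i \<in> hom L' L" using group.iso_set_sym[OF assms(3) j] by (rule iso_imp_homomorphism)
  have bij: "bij_betw j (carrier L) (carrier L')" using j by (simp add: iso_def)
  have ji: "j (?i y) = y" if "y \<in> carrier L'" for y
    using bij_betw_inv_into_right[OF bij that] .
  obtain g where g: "g \<in> hom B L" "\<And>a. a \<in> carrier A \<Longrightarrow> g (\<alpha> a) = (?i \<circ> f) a"
    using factors_uniquelyE[OF assms(1,2,4)] by blast
  show ?thesis
  proof (rule factors_uniquelyI[OF assms(2,4), of "j \<circ> g"])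
    show "j \<circ> g \<in> hom B L'" using hom_compose[OF g(1) iso_imp_homomorphism[OF j]] .
    show "(j \<circ> g) (\<alpha> a) = f a" if "a \<in> carrier A" for a
      using g(2)[OF that] ji[OF hom_in_carrier[OF f that]] by simp
    show "h b = (j \<circ> g) b"
      if h: "h \<in> hom B L'" "\<And>a. a \<in> carrier A \<Longrightarrow> h (\<alpha> a) = f a" and b: "b \<in> carrier B" for h b
    proof -
      have "(?i \<circ> h) b = g b"
        by (rule factors_uniquely_unique[OF assms(1,2,4) hom_compose[OF h(1) i] g(1) _ g(2) b])
          (simp add: h(2))
      then show ?thesis using ji[OF hom_in_carrier[OF h(1) b]] by (metis comp_apply)
    qed
  qed
qed

lemma local_group_iso:
  assumes "local_group L" "group L'" "j \<in> iso L L'"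
  shows "local_group L'"
  unfolding local_group_def
proof (intro conjI allI impI)
  show "group L'" by fact
  fix A B :: "nat monoid" and \<alpha> f
  assume *: "finitely_presented_group A \<and> finitely_presented_group B \<and> two_connected A B \<alpha> \<and> f \<in> hom A L'"
  have L: "group L" using assms(1) by (simp add: local_group_def)
  have "inv_into (carrier L) j \<circ> f \<in> hom A L"
    using hom_compose[OF _ iso_imp_homomorphism[OF group.iso_set_sym[OF L assms(3)]]] * by blast
  then have "factors_uniquely A B \<alpha> L (inv_into (carrier L) j \<circ> f)"
    using assms(1) * unfolding local_group_def by blast
  then show "factors_uniquely A B \<alpha> L' f"
    using * by (intro factors_uniquely_iso[OF _ _ L _ assms(3)])
      (auto simp: two_connected_def finitely_presented_group_def)
qed

text \<open>The definition tests groups on one type only; a local group whose carrier injects into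
  that type is covered by passing to its copy and back.\<close>

lemma homology_localization_universal:
  fixes G :: "'a monoid" and E :: "'b monoid" and L :: "('c, 'm) monoid_scheme"
    and j :: "'c \<Rightarrow> 'a + 'b + nat"
  assumes "homology_localization G E \<eta>" "local_group L" "f \<in> hom G L" "inj_on j (carrier L)"
  shows "factors_uniquely G E \<eta> L f"
proof -
  have L: "group L" and E: "group E" and \<eta>: "\<eta> \<in> hom G E"
    using assms(1,2) by (simp_all add: local_group_def homology_localization_def)
  let ?L = "copy_group j L"
  have L': "group ?L" and j: "j \<in> iso L ?L"
    using group.copy_group_iso[OF L assms(4)] by blast+
  let ?i = "inv_into (carrier L) j"
  have i: "?i \<in> iso ?L L" by (rule group.iso_set_sym[OF L j])
  have bij: "bij_betw j (carrier L) (carrier ?L)" using j by (simp add: iso_def)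
  have "factors_uniquely G E \<eta> ?L (j \<circ> f)"
    using assms(1) local_group_iso[OF assms(2) L' j] hom_compose[OF assms(3) iso_imp_homomorphism[OF j]]
    unfolding homology_localization_def by blast
  moreover have "inv_into (carrier ?L) ?i (f x) = j (f x)" if "x \<in> carrier G" for x
    using inv_into_inv_into_eq[OF bij] hom_in_carrier[OF assms(3) that] by simp
  ultimately have "factors_uniquely G E \<eta> ?L (inv_into (carrier ?L) ?i \<circ> f)"
    by (simp add: factors_uniquely_def)
  then show ?thesis
    by (rule factors_uniquely_iso[OF _ E L' \<eta> i assms(3)])
qed

text \<open>A homomorphism to an abelian group kills commutators, and \<open>\<alpha>\<close> is
  bijective modulo commutators. The factorization sends \<open>b\<close> to \<open>f a\<close> for
  any \<open>a\<close> with \<open>\<alpha> a\<close> congruent to \<open>b\<close>.\<close>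

lemma local_group_comm:
  assumes "comm_group L"
  shows "local_group L"
  unfolding local_group_def
proof (intro conjI allI impI)
  interpret L: comm_group L by fact
  show "group L" by (rule L.is_group)
  fix A B :: "nat monoid" and \<alpha> f
  assume *: "finitely_presented_group A \<and> finitely_presented_group B \<and> two_connected A B \<alpha> \<and> f \<in> hom A L"
  then have AB: "group A" "group B" and \<alpha>: "\<alpha> \<in> hom A B" and f: "f \<in> hom A L"
    by (auto simp: finitely_presented_group_def two_connected_def)
  have H1: "inj_modulo A (derived A (carrier A)) (derived B (carrier B)) \<alpha>"
      "surj_modulo A B (derived B (carrier B)) \<alpha>"
    using * H1_iso_iff[OF AB \<alpha>] by (auto simp: two_connected_def)
  interpret f: group_hom A L f
    by (intro group_hom.intro group_hom_axioms.intro AB L.is_group f)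
  interpret \<alpha>: group_hom A B \<alpha>
    by (intro group_hom.intro group_hom_axioms.intro AB \<alpha>)
  define D where "D = derived B (carrier B)"
  interpret D: normal D B unfolding D_def by (rule \<alpha>.H.derived_self_is_normal)
  have kill: "h d = \<one>\<^bsub>L\<^esub>" if "group_hom K L h" "d \<in> derived K (carrier K)" for K :: "nat monoid" and h d
    using group_hom.derived_subset[OF that(1)] that(2) L.derived_eq_singleton[of "carrier L"] by blast
  have eq: "f a = f a'" if "a \<in> carrier A" "a' \<in> carrier A" "D #>\<^bsub>B\<^esub> \<alpha> a = D #>\<^bsub>B\<^esub> \<alpha> a'" for a a'
  proof -
    have "\<alpha> (a \<otimes>\<^bsub>A\<^esub> inv\<^bsub>A\<^esub> a') \<in> D"
      using that D.r_coset_eq_iff[of "\<alpha> a" "\<alpha> a'"] by simp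
    then have "a \<otimes>\<^bsub>A\<^esub> inv\<^bsub>A\<^esub> a' \<in> derived A (carrier A)"
      using H1(1) that unfolding inj_modulo_def D_def by simp
    then have "f (a \<otimes>\<^bsub>A\<^esub> inv\<^bsub>A\<^esub> a') = \<one>\<^bsub>L\<^esub>" by (rule kill[OF f.group_hom_axioms])
    then show ?thesis using that L.right_cancel[of "inv\<^bsub>L\<^esub> f a'" "f a" "f a'"] by simp
  qed
  have ex: "\<exists>a\<in>carrier A. D #>\<^bsub>B\<^esub> b = D #>\<^bsub>B\<^esub> \<alpha> a" if "b \<in> carrier B" for b
    using H1(2) that D.r_coset_eq_iff unfolding surj_modulo_def D_def[symmetric] by fastforce
  define c where "c b = (SOME a. a \<in> carrier A \<and> D #>\<^bsub>B\<^esub> b = D #>\<^bsub>B\<^esub> \<alpha> a)" for b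
  have c: "c b \<in> carrier A" "D #>\<^bsub>B\<^esub> b = D #>\<^bsub>B\<^esub> \<alpha> (c b)" if "b \<in> carrier B" for b
    using someI_ex[OF ex[OF that, unfolded Bex_def]] unfolding c_def by blast+
  show "factors_uniquely A B \<alpha> L f"
  proof (rule factors_uniquelyI[OF AB(2) \<alpha>, of "f \<circ> c"])
    show "f \<circ> c \<in> hom B L"
    proof (rule homI)
      fix x y assume xy: "x \<in> carrier B" "y \<in> carrier B"
      have "D #>\<^bsub>B\<^esub> \<alpha> (c (x \<otimes>\<^bsub>B\<^esub> y)) = (D #>\<^bsub>B\<^esub> x) <#>\<^bsub>B\<^esub> (D #>\<^bsub>B\<^esub> y)"
        using xy c(2)[of "x \<otimes>\<^bsub>B\<^esub> y"] by (simp add: D.rcos_sum)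
      also have "\<dots> = D #>\<^bsub>B\<^esub> \<alpha> (c x \<otimes>\<^bsub>A\<^esub> c y)"
        using xy c(1) by (simp add: D.rcos_sum[symmetric] c(2)[OF xy(1), symmetric] c(2)[OF xy(2), symmetric])
      finally show "(f \<circ> c) (x \<otimes>\<^bsub>B\<^esub> y) = (f \<circ> c) x \<otimes>\<^bsub>L\<^esub> (f \<circ> c) y"
        using xy c(1) eq[of "c (x \<otimes>\<^bsub>B\<^esub> y)" "c x \<otimes>\<^bsub>A\<^esub> c y"] by simp
    qed (use c in simp)
    show "(f \<circ> c) (\<alpha> a) = f a" if "a \<in> carrier A" for a
      using that c[of "\<alpha> a"] eq[of "c (\<alpha> a)" a] by simp
    show "h b = (f \<circ> c) b"
      if h: "h \<in> hom B L" "\<And>a. a \<in> carrier A \<Longrightarrow> h (\<alpha> a) = f a" and b: "b \<in> carrier B" for h b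
    proof -
      interpret h: group_hom B L h
        by (intro group_hom.intro group_hom_axioms.intro AB L.is_group h)
      have "b \<otimes>\<^bsub>B\<^esub> inv\<^bsub>B\<^esub> \<alpha> (c b) \<in> D"
        using b c[OF b] D.r_coset_eq_iff[of b "\<alpha> (c b)"] by simp
      then have "h (b \<otimes>\<^bsub>B\<^esub> inv\<^bsub>B\<^esub> \<alpha> (c b)) = \<one>\<^bsub>L\<^esub>"
        unfolding D_def by (rule kill[OF h.group_hom_axioms])
      then show ?thesis
        using b c[OF b] h(2) L.right_cancel[of "inv\<^bsub>L\<^esub> f (c b)" "h b" "f (c b)"] by simp
    qed
  qed
qed

text \<open>The elements of \<open>X\<close> solve a system of equations \<open>x\<^sub>i = c\<^sub>i(x) h(l\<^sub>i)\<close> with \<open>c\<^sub>i\<close> in the commutator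
  subgroup of a free group on \<open>x\<^sub>1, \<dots>, x\<^sub>n\<close>. Such a system has a unique solution in a local group,
  because \<open>x\<^sub>i \<mapsto> c\<^sub>i\<inverse> x\<^sub>i\<close> is a 2-connected endomorphism of that free group.\<close>

lemma local_group_solutions:
  assumes L: "local_group L" and M: "local_group M" and h: "h \<in> hom L M"
    and X: "finite X" "X \<subseteq> carrier M"
    and eqn: "\<And>x. x \<in> X \<Longrightarrow>
      \<exists>l\<in>carrier L. x \<otimes>\<^bsub>M\<^esub> inv\<^bsub>M\<^esub> h l \<in> derived M (generate M X)"
  shows "generate M X \<subseteq> h ` carrier L"
proof -
  have gL: "group L" and gM: "group M" using L M by (simp_all add: local_group_def)
  interpret h: group_hom L M h
    by (intro group_hom.intro group_hom_axioms.intro gL gM h)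
  obtain n :: nat and x where x: "X = x ` {i. i < n}"
    using finite_imp_nat_seg_image_inj_on[OF X(1)] by blast
  define S where "S = {i. i < n}"
  obtain F :: "nat monoid" and cl where "free_group F S cl" and fp: "finitely_presented_group F"
    using ex_free_group_nat[of S] by (auto simp: S_def)
  interpret F: free_group F S cl by fact
  have xM: "x s \<in> carrier M" if "s \<in> S" for s using that X(2) x by (auto simp: S_def)
  obtain \<phi> where \<phi>: "\<phi> \<in> hom F M" "\<And>s. s \<in> S \<Longrightarrow> \<phi> (cl [(s, True)]) = x s"
    by (rule F.hom_exists[of M x, OF gM xM]) (simp, erule that, simp)
  interpret \<phi>: group_hom F M \<phi>
    by (intro group_hom.intro group_hom_axioms.intro F.is_group gM \<phi>)
  let ?E = "(\<lambda>s. cl [(s, True)]) ` S"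
  have "\<phi> ` ?E = X" using \<phi>(2) by (auto simp: x S_def image_image)
  moreover have "?E \<subseteq> carrier F" by auto
  ultimately have gen: "generate M X = \<phi> ` carrier F"
    using \<phi>.generate_img[of ?E] by (simp add: F.generate_letters)
  \<comment> \<open>Each commutator correction is lifted to the free group: the subgroup generated
    by \<open>X\<close> is the image of \<open>\<phi>\<close>, so its derived subgroup is the image
    of that of \<open>F\<close>.\<close>
  have "\<exists>l d. l \<in> carrier L \<and> d \<in> derived F (carrier F) \<and> x s \<otimes>\<^bsub>M\<^esub> inv\<^bsub>M\<^esub> h l = \<phi> d" if "s \<in> S" for s
  proof -
    have "x s \<in> X" using that by (auto simp: x S_def)
    from eqn[OF this] obtain l where "l \<in> carrier L"
        "x s \<otimes>\<^bsub>M\<^esub> inv\<^bsub>M\<^esub> h l \<in> \<phi> ` derived F (carrier F)"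
      unfolding gen \<phi>.derived_img[OF order.refl] by blast
    then show ?thesis by blast
  qed
  then obtain l d where ld: "\<And>s. s \<in> S \<Longrightarrow> l s \<in> carrier L" "\<And>s. s \<in> S \<Longrightarrow> d s \<in> derived F (carrier F)"
    "\<And>s. s \<in> S \<Longrightarrow> x s \<otimes>\<^bsub>M\<^esub> inv\<^bsub>M\<^esub> h (l s) = \<phi> (d s)"
    by metis
  have D: "subgroup (derived F (carrier F)) F" by (rule F.derived_is_subgroup) simp
  have dF: "d s \<in> carrier F" if "s \<in> S" for s
    using ld(2)[OF that] subgroup.subset[OF D] by blast
  have "inv\<^bsub>F\<^esub> d s \<otimes>\<^bsub>F\<^esub> cl [(s, True)] \<in> carrier F" if "s \<in> S" for s
    using dF that by simp
  \<comment> \<open>The equations read x_s = \<phi>(d_s) h(l_s), so this choice gives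
    \<open>\<phi> \<circ> \<alpha> = h \<circ> k\<close> on generators, where \<open>k\<close> is
    the map to \<open>L\<close> with values \<open>l s\<close>.\<close>
  then obtain \<alpha> where \<alpha>: "\<alpha> \<in> hom F F"
    "\<And>s. s \<in> S \<Longrightarrow> \<alpha> (cl [(s, True)]) = inv\<^bsub>F\<^esub> d s \<otimes>\<^bsub>F\<^esub> cl [(s, True)]"
    by (rule F.hom_exists[of F "\<lambda>s. inv\<^bsub>F\<^esub> d s \<otimes>\<^bsub>F\<^esub> cl [(s, True)]", OF F.is_group]) (simp, erule that, simp)
  have two: "two_connected F F \<alpha>"
  proof (rule F.endomorphism_two_connected[OF \<alpha>(1)])
    show "\<alpha> (cl [(s, True)]) \<otimes>\<^bsub>F\<^esub> inv\<^bsub>F\<^esub> cl [(s, True)] \<in> derived F (carrier F)" if "s \<in> S" for s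
      using that dF subgroup.m_inv_closed[OF D ld(2)[OF that]] by (simp add: \<alpha>(2) F.m_assoc)
  qed
  obtain k where k: "k \<in> hom F L" "\<And>s. s \<in> S \<Longrightarrow> k (cl [(s, True)]) = l s"
    by (rule F.hom_exists[of L l, OF gL ld(1)]) (simp, erule that, simp)
  have fac: "factors_uniquely F F \<alpha> L f" if "f \<in> hom F L" for f
    using L fp two that unfolding local_group_def by blast
  have facM: "factors_uniquely F F \<alpha> M f" if "f \<in> hom F M" for f
    using M fp two that unfolding local_group_def by blast
  \<comment> \<open>\<open>g\<close> solves the system in \<open>L\<close>. Both
    \<open>h \<circ> g\<close> and \<open>\<phi>\<close> solve it in \<open>M\<close>, so they
    coincide by uniqueness there, and the image of \<open>\<phi>\<close> lies in that of
    \<open>h\<close>.\<close>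
  obtain g where g: "g \<in> hom F L" "\<And>a. a \<in> carrier F \<Longrightarrow> g (\<alpha> a) = k a"
    using factors_uniquelyE[OF fac[OF k(1)] F.is_group \<alpha>(1)] by blast
  have "(h \<circ> k) a = (\<phi> \<circ> \<alpha>) a" if "a \<in> carrier F" for a
  proof (rule F.hom_eqI[OF gM hom_compose[OF k(1) h] hom_compose[OF \<alpha>(1) \<phi>(1)] _ that])
    fix s assume s: "s \<in> S"
    have "inv\<^bsub>M\<^esub> (x s \<otimes>\<^bsub>M\<^esub> inv\<^bsub>M\<^esub> h (l s)) \<otimes>\<^bsub>M\<^esub> x s = h (l s)"
      using xM[OF s] ld(1)[OF s] by (simp add: h.H.inv_mult_group h.H.m_assoc)
    then show "(h \<circ> k) (cl [(s, True)]) = (\<phi> \<circ> \<alpha>) (cl [(s, True)])"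
      using s dF[OF s] by (simp add: k(2) \<alpha>(2) \<phi>(2) ld(3))
  qed
  then have "(h \<circ> g) a = \<phi> a" if "a \<in> carrier F" for a
    using g(2) that
    by (intro factors_uniquely_unique[OF facM[OF hom_compose[OF \<alpha>(1) \<phi>(1)]] F.is_group \<alpha>(1)
          hom_compose[OF g(1) h] \<phi>(1)]) auto
  then show ?thesis
    unfolding gen using hom_in_carrier[OF g(1)] by force
qed

text \<open>Uniqueness is inherited from \<open>M\<close>. For existence, the factorization through
  \<open>M\<close> has to land in the image of \<open>h\<close>: as \<open>\<alpha>\<close> is onto
  modulo commutators, the images of finitely many generators of \<open>B\<close> solve equations
  over that image, and \<open>local_group_solutions\<close> applies.\<close>

lemma local_group_image:
  fixes L :: "('l, 'm) monoid_scheme" and M :: "'c monoid"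
  assumes L: "local_group L" and M: "local_group M" and h: "h \<in> hom L M"
  shows "local_group (M\<lparr>carrier := h ` carrier L\<rparr>)" (is "local_group ?K")
  unfolding local_group_def
proof (intro conjI allI impI)
  have gL: "group L" and gM: "group M" using L M by (simp_all add: local_group_def)
  interpret h: group_hom L M h
    by (intro group_hom.intro group_hom_axioms.intro gL gM h)
  have K: "subgroup (h ` carrier L) M" by (rule h.img_is_subgroup)
  show "group ?K" by (rule h.H.subgroup_imp_group[OF K])
  fix A B :: "nat monoid" and \<alpha> f
  assume *: "finitely_presented_group A \<and> finitely_presented_group B \<and> two_connected A B \<alpha> \<and> f \<in> hom A ?K"
  have fK: "f a \<in> h ` carrier L" if "a \<in> carrier A" for a
    using * hom_in_carrier[OF _ that, of f ?K] by simp
  have f: "f \<in> hom A M"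
    using * fK subgroup.subset[OF K] hom_mult[of f A ?K] by (intro homI) auto
  have AB: "group A" "group B" and \<alpha>: "\<alpha> \<in> hom A B"
    using * by (auto simp: finitely_presented_group_def two_connected_def)
  have H1: "surj_modulo A B (derived B (carrier B)) \<alpha>"
    using * H1_iso_iff[OF AB \<alpha>] by (auto simp: two_connected_def)
  have fac: "factors_uniquely A B \<alpha> M f"
    using M * f unfolding local_group_def by blast
  obtain v where v: "v \<in> hom B M" "\<And>a. a \<in> carrier A \<Longrightarrow> v (\<alpha> a) = f a"
    using factors_uniquelyE[OF fac AB(2) \<alpha>] by blast
  interpret v: group_hom B M v
    by (intro group_hom.intro group_hom_axioms.intro AB gM v)
  obtain T where T: "finite T" "T \<subseteq> carrier B" "generate B T = carrier B"
    using * finitely_presented_imp_generated unfolding finitely_generated_group_def by blast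
  have gen: "generate M (v ` T) = v ` carrier B" using v.generate_img[OF T(2)] T(3) by simp
  have "generate M (v ` T) \<subseteq> h ` carrier L"
  proof (rule local_group_solutions[OF L M h])
    show "finite (v ` T)" using T by simp
    show "v ` T \<subseteq> carrier M" using T(2) by auto
    fix y assume "y \<in> v ` T"
    then obtain b where b: "b \<in> carrier B" "y = v b" using T(2) by blast
    obtain a where a: "a \<in> carrier A" "b \<otimes>\<^bsub>B\<^esub> inv\<^bsub>B\<^esub> \<alpha> a \<in> derived B (carrier B)"
      using H1 b(1) unfolding surj_modulo_def by blast
    obtain l where l: "l \<in> carrier L" "f a = h l" using fK[OF a(1)] by blast
    have "v (b \<otimes>\<^bsub>B\<^esub> inv\<^bsub>B\<^esub> \<alpha> a) \<in> derived M (generate M (v ` T))"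
      unfolding gen using a(2) v.derived_img[of "carrier B"] by simp
    moreover have "v (b \<otimes>\<^bsub>B\<^esub> inv\<^bsub>B\<^esub> \<alpha> a) = y \<otimes>\<^bsub>M\<^esub> inv\<^bsub>M\<^esub> h l"
      using a(1) b v(2)[OF a(1)] l hom_in_carrier[OF \<alpha> a(1)] by simp
    ultimately show "\<exists>l\<in>carrier L. y \<otimes>\<^bsub>M\<^esub> inv\<^bsub>M\<^esub> h l \<in> derived M (generate M (v ` T))"
      using l(1) by auto
  qed
  then have vK: "v \<in> hom B ?K" using v(1) unfolding gen by (simp add: hom_def image_subset_iff_funcset)
  show "factors_uniquely A B \<alpha> ?K f"
  proof (rule factors_uniquelyI[OF AB(2) \<alpha> vK v(2)])
    fix w b assume w: "w \<in> hom B ?K" "\<And>a. a \<in> carrier A \<Longrightarrow> w (\<alpha> a) = f a" "b \<in> carrier B"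
    have "w \<in> hom B M"
      using w(1) hom_in_carrier[OF w(1)] subgroup.subset[OF K] hom_mult[of w B ?K] by (intro homI) auto
    then show "w b = v b"
      using v(1) w(2) v(2) w(3) by (rule factors_uniquely_unique[OF fac AB(2) \<alpha>])
  qed
qed

subsection \<open>Abelianization of a homology localization\<close>

text \<open>Choosing representatives embeds a quotient into the type of the group, so that quotients
  of \<open>G\<close> and \<open>E\<close> become admissible test groups for the
  localization.\<close>

lemma (in normal) inj_on_coset_representative: "inj_on (\<lambda>X. SOME x. x \<in> X) (carrier (G Mod H))"
proof (rule inj_onI)
  fix X Y
  assume "X \<in> carrier (G Mod H)" "Y \<in> carrier (G Mod H)" and eq: "(SOME x. x \<in> X) = (SOME y. y \<in> Y)"
  then obtain x y where xy: "x \<in> carrier G" "X = H #> x" "y \<in> carrier G" "Y = H #> y"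
    by (auto simp: carrier_FactGroup)
  have rep: "(SOME x. x \<in> H #> x') \<in> H #> x'" if "x' \<in> carrier G" for x'
    using rcos_self[OF that is_subgroup] by (rule someI)
  show "X = Y"
    using rep[OF xy(1)] rep[OF xy(3)] eq xy repr_independence[OF _ _ is_subgroup] by metis
qed

lemma (in normal) coset_representative_closed:
  assumes "X \<in> carrier (G Mod H)"
  shows "(SOME x. x \<in> X) \<in> carrier G"
proof -
  obtain x where x: "x \<in> carrier G" "X = H #> x" using assms by (auto simp: carrier_FactGroup)
  have "(SOME x. x \<in> X) \<in> X" unfolding x(2) using rcos_self[OF x(1) is_subgroup] by (rule someI)
  then show ?thesis using x r_coset_subset_G[OF subset x(1)] by blast
qed

text \<open>The projection of \<open>G\<close> to its abelianization factors through
  \<open>\<eta>\<close>, because abelian groups are local; the resulting map on \<open>E\<close>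
  kills commutators.\<close>

lemma localization_inj_abelianization:
  fixes G :: "'a monoid" and E :: "'b monoid"
  assumes "homology_localization G E \<eta>"
  shows "inj_modulo G (derived G (carrier G)) (derived E (carrier E)) \<eta>"
  unfolding inj_modulo_def
proof (intro ballI impI)
  have G: "group G" and E: "group E" and \<eta>: "\<eta> \<in> hom G E"
    using assms by (auto simp: homology_localization_def local_group_def)
  define D where "D = derived G (carrier G)"
  interpret D: normal D G unfolding D_def by (rule group.derived_self_is_normal[OF G])
  have L: "comm_group (G Mod D)" unfolding D_def by (rule group.derived_quot_is_comm_group[OF G])
  then interpret L: comm_group "G Mod D" .
  have inj: "inj_on (\<lambda>X. Inl (SOME x. x \<in> X) :: 'a + 'b + nat) (carrier (G Mod D))"
    using D.inj_on_coset_representative by (auto simp: inj_on_def)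
  obtain h where h: "h \<in> hom E (G Mod D)" "\<And>x. x \<in> carrier G \<Longrightarrow> h (\<eta> x) = D #>\<^bsub>G\<^esub> x"
    using factors_uniquelyE[OF homology_localization_universal[OF assms local_group_comm[OF L] D.r_coset_hom_Mod inj] E \<eta>]
    by blast
  interpret h: group_hom E "G Mod D" h
    by (intro group_hom.intro group_hom_axioms.intro E L.is_group h)
  fix x assume x: "x \<in> carrier G" "\<eta> x \<in> derived E (carrier E)"
  have "h (\<eta> x) \<in> derived (G Mod D) (carrier (G Mod D))" using h.derived_subset x(2) by blast
  then have "D #>\<^bsub>G\<^esub> x = D" using h(2)[OF x(1)] L.derived_eq_singleton[OF order.refl] by simp
  then show "x \<in> derived G (carrier G)"
    using D.r_coset_eq_self_iff[OF x(1)] by (simp add: D_def)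
qed

text \<open>The cokernel of the map on abelianizations is abelian, hence local. The projection of
  \<open>E\<close> onto it and the trivial map agree on \<open>G\<close>, so uniqueness makes the
  projection trivial.\<close>

lemma localization_surj_abelianization:
  fixes G :: "'a monoid" and E :: "'b monoid"
  assumes "homology_localization G E \<eta>"
  shows "surj_modulo G E (derived E (carrier E)) \<eta>"
  unfolding surj_modulo_def
proof
  have G: "group G" and E: "group E" and \<eta>: "\<eta> \<in> hom G E"
    using assms by (auto simp: homology_localization_def local_group_def)
  define D where "D = derived E (carrier E)"
  interpret D: normal D E unfolding D_def by (rule group.derived_self_is_normal[OF E])
  have L: "comm_group (E Mod D)" unfolding D_def by (rule group.derived_quot_is_comm_group[OF E])
  then interpret L: comm_group "E Mod D" .
  interpret q: group_hom G "E Mod D" "r_coset E D \<circ> \<eta>"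
    by (intro group_hom.intro group_hom_axioms.intro G L.is_group hom_compose[OF \<eta> D.r_coset_hom_Mod])
  define I where "I = (r_coset E D \<circ> \<eta>) ` carrier G"
  have subI: "subgroup I (E Mod D)" unfolding I_def by (rule q.img_is_subgroup)
  interpret I: normal I "E Mod D" by (rule L.subgroup_imp_normal[OF subI])
  define L' where "L' = E Mod D Mod I"
  have L': "comm_group L'" unfolding L'_def by (rule L.abelian_FactGroup[OF subI])
  \<comment> \<open>A representative is chosen twice, since the elements of \<open>L'\<close> are
    cosets of cosets.\<close>
  define j :: "'b set set \<Rightarrow> 'a + 'b + nat" where "j X = Inr (Inl (SOME y. y \<in> (SOME x. x \<in> X)))" for X
  have inj: "inj_on j (carrier L')"
    using inj_onD[OF D.inj_on_coset_representative] inj_onD[OF I.inj_on_coset_representative]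
      I.coset_representative_closed
    unfolding L'_def j_def by (intro inj_onI) (metis sum.inject)
  have r: "r_coset (E Mod D) I \<circ> r_coset E D \<in> hom E L'"
    unfolding L'_def by (rule hom_compose[OF D.r_coset_hom_Mod I.r_coset_hom_Mod])
  have one: "(\<lambda>_. \<one>\<^bsub>L'\<^esub>) \<in> hom E L'" "(\<lambda>_. \<one>\<^bsub>L'\<^esub>) \<in> hom G L'"
    using trivial_hom[OF comm_group.axioms(2)[OF L']] by blast+
  have fac: "factors_uniquely G E \<eta> L' (\<lambda>_. \<one>\<^bsub>L'\<^esub>)"
    by (rule homology_localization_universal[OF assms local_group_comm[OF L'] one(2) inj])
  fix y assume y: "y \<in> carrier E"
  have "(r_coset (E Mod D) I \<circ> r_coset E D) y = \<one>\<^bsub>L'\<^esub>"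
  proof (rule factors_uniquely_unique[OF fac E \<eta> r one(1) _ HOL.refl y])
    fix a assume a: "a \<in> carrier G"
    then have "D #>\<^bsub>E\<^esub> \<eta> a \<in> I" unfolding I_def by auto
    then show "(r_coset (E Mod D) I \<circ> r_coset E D) (\<eta> a) = \<one>\<^bsub>L'\<^esub>"
      using I.rcos_const[OF L.is_group] by (simp add: L'_def)
  qed
  moreover have yD: "D #>\<^bsub>E\<^esub> y \<in> carrier (E Mod D)" using y by (auto simp: carrier_FactGroup)
  ultimately have "D #>\<^bsub>E\<^esub> y \<in> I"
    using I.r_coset_eq_self_iff[OF yD] by (simp add: L'_def)
  then show "\<exists>x\<in>carrier G. y \<otimes>\<^bsub>E\<^esub> inv\<^bsub>E\<^esub> \<eta> x \<in> derived E (carrier E)"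
    using y hom_in_carrier[OF \<eta>] D.r_coset_eq_iff[of y] unfolding I_def D_def[symmetric] by auto
qed

lemma (in group_hom) r_coset_derived:
  assumes "x \<in> carrier G" "y \<in> carrier G"
    and "derived G (carrier G) #>\<^bsub>G\<^esub> x = derived G (carrier G) #>\<^bsub>G\<^esub> y"
  shows "derived H (carrier H) #>\<^bsub>H\<^esub> h x = derived H (carrier H) #>\<^bsub>H\<^esub> h y"
proof -
  interpret D: normal "derived G (carrier G)" G by (rule G.derived_self_is_normal)
  interpret E: normal "derived H (carrier H)" H by (rule H.derived_self_is_normal)
  have "h (x \<otimes> inv y) \<in> derived H (carrier H)"
    using derived_subset assms D.r_coset_eq_iff by blast
  then show ?thesis using assms E.r_coset_eq_iff[of "h x" "h y"] by simp
qed

text \<open>Chase in the commutative square of abelianizations. For injectivity of \<open>g\<close>,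
  write an element as \<open>a y\<close> modulo commutators and pull its triviality back through
  \<open>b\<close> and \<open>f\<close> to \<open>y\<close>; for surjectivity, lift through
  \<open>b\<close> and then through \<open>f\<close>.\<close>

lemma abelianization_two_out_of_three:
  assumes "group P" "group G" "group P'" "group G'"
    and f: "f \<in> hom P G" and a: "a \<in> hom P P'" and b: "b \<in> hom G G'" and g: "g \<in> hom P' G'"
    and comm: "\<And>x. x \<in> carrier P \<Longrightarrow> g (a x) = b (f x)"
    and injs: "inj_modulo P (derived P (carrier P)) (derived G (carrier G)) f"
      "inj_modulo G (derived G (carrier G)) (derived G' (carrier G')) b"
    and surjs: "surj_modulo P G (derived G (carrier G)) f"
      "surj_modulo P P' (derived P' (carrier P')) a" "surj_modulo G G' (derived G' (carrier G')) b"
  shows "inj_modulo P' (derived P' (carrier P')) (derived G' (carrier G')) g"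
    and "surj_modulo P' G' (derived G' (carrier G')) g"
proof -
  interpret f: group_hom P G f by (intro group_hom.intro group_hom_axioms.intro assms)
  interpret a: group_hom P P' a by (intro group_hom.intro group_hom_axioms.intro assms)
  interpret b: group_hom G G' b by (intro group_hom.intro group_hom_axioms.intro assms)
  interpret g: group_hom P' G' g by (intro group_hom.intro group_hom_axioms.intro assms)
  interpret DG: normal "derived G (carrier G)" G by (rule f.H.derived_self_is_normal)
  interpret DP': normal "derived P' (carrier P')" P' by (rule a.H.derived_self_is_normal)
  interpret DG': normal "derived G' (carrier G')" G' by (rule b.H.derived_self_is_normal)
  show "inj_modulo P' (derived P' (carrier P')) (derived G' (carrier G')) g"
    unfolding inj_modulo_def
  proof (intro ballI impI)
    fix x assume x: "x \<in> carrier P'" "g x \<in> derived G' (carrier G')"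
    obtain y where y: "y \<in> carrier P" "x \<otimes>\<^bsub>P'\<^esub> inv\<^bsub>P'\<^esub> a y \<in> derived P' (carrier P')"
      using surjs(2) x(1) unfolding surj_modulo_def by blast
    then have xy: "derived P' (carrier P') #>\<^bsub>P'\<^esub> x = derived P' (carrier P') #>\<^bsub>P'\<^esub> a y"
      using x(1) DP'.r_coset_eq_iff[of x "a y"] by simp
    have "b (f y) \<in> derived G' (carrier G')"
      using g.r_coset_derived[OF x(1) _ xy] y(1) x comm[OF y(1)]
        DG'.r_coset_eq_self_iff[of "g x"] DG'.r_coset_eq_self_iff[of "g (a y)"] by simp
    then have "y \<in> derived P (carrier P)"
      using injs y(1) unfolding inj_modulo_def by simp
    then have "a y \<in> derived P' (carrier P')" using a.derived_subset by blast
    then show "x \<in> derived P' (carrier P')"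
      using xy x(1) y(1) DP'.r_coset_eq_self_iff[of x] DP'.r_coset_eq_self_iff[of "a y"] by simp
  qed
  show "surj_modulo P' G' (derived G' (carrier G')) g"
    unfolding surj_modulo_def
  proof
    fix z assume z: "z \<in> carrier G'"
    obtain y where y: "y \<in> carrier G" "z \<otimes>\<^bsub>G'\<^esub> inv\<^bsub>G'\<^esub> b y \<in> derived G' (carrier G')"
      using surjs(3) z unfolding surj_modulo_def by blast
    obtain x where x: "x \<in> carrier P" "y \<otimes>\<^bsub>G\<^esub> inv\<^bsub>G\<^esub> f x \<in> derived G (carrier G)"
      using surjs(1) y unfolding surj_modulo_def by blast
    have "derived G' (carrier G') #>\<^bsub>G'\<^esub> b y = derived G' (carrier G') #>\<^bsub>G'\<^esub> b (f x)"
      using x y(1) DG.r_coset_eq_iff[of y "f x"] by (intro b.r_coset_derived) simp_all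
    moreover have "derived G' (carrier G') #>\<^bsub>G'\<^esub> z = derived G' (carrier G') #>\<^bsub>G'\<^esub> b y"
      using y z DG'.r_coset_eq_iff[of z "b y"] by simp
    ultimately have "z \<otimes>\<^bsub>G'\<^esub> inv\<^bsub>G'\<^esub> g (a x) \<in> derived G' (carrier G')"
      using z x(1) DG'.r_coset_eq_iff[of z "g (a x)"] comm[OF x(1)] by simp
    then show "\<exists>x\<in>carrier P'. z \<otimes>\<^bsub>G'\<^esub> inv\<^bsub>G'\<^esub> g x \<in> derived G' (carrier G')"
      using x(1) by (intro bexI[of _ "a x"]) simp_all
  qed
qed

text \<open>Once the image of \<open>G\<close> lies in the local group \<open>?K\<close>, the map
  \<open>\<eta>_G\<close> extends to \<open>G_hat\<close> with values in \<open>?K\<close>. The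
  extension agrees with the identity on the image of \<open>G\<close>, so by uniqueness it is the
  identity, and \<open>?K\<close> is all of \<open>G_hat\<close>.\<close>

lemma localization_surjective:
  fixes G :: "'b monoid" and G_hat :: "'d monoid" and P_hat :: "'c monoid"
  assumes P_hat: "local_group P_hat" and loc: "homology_localization G G_hat \<eta>_G"
    and "f \<in> hom P G" and \<eta>_P: "\<eta>_P \<in> hom P P_hat" and f_hat: "f_hat \<in> hom P_hat G_hat"
    and comm: "\<And>x. x \<in> carrier P \<Longrightarrow> f_hat (\<eta>_P x) = \<eta>_G (f x)"
    and surj: "surj_modulo P G (derived G (carrier G)) f"
    and fg: "finitely_generated_group G"
  shows "f_hat ` carrier P_hat = carrier G_hat"
proof -
  have G: "group G" and G_hat: "local_group G_hat" "group G_hat" and \<eta>: "\<eta>_G \<in> hom G G_hat"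
    using loc by (auto simp: homology_localization_def local_group_def)
  interpret \<eta>: group_hom G G_hat \<eta>_G
    by (intro group_hom.intro group_hom_axioms.intro G G_hat \<eta>)
  have P_hat_group: "group P_hat" using P_hat by (simp add: local_group_def)
  interpret f_hat: group_hom P_hat G_hat f_hat
    by (intro group_hom.intro group_hom_axioms.intro P_hat_group G_hat f_hat)
  obtain T where T: "finite T" "T \<subseteq> carrier G" "generate G T = carrier G"
    using fg unfolding finitely_generated_group_def by blast
  have gen: "generate G_hat (\<eta>_G ` T) = \<eta>_G ` carrier G" using \<eta>.generate_img[OF T(2)] T(3) by simp
  have "generate G_hat (\<eta>_G ` T) \<subseteq> f_hat ` carrier P_hat"
  proof (rule local_group_solutions[OF P_hat G_hat(1) f_hat])
    show "finite (\<eta>_G ` T)" using T by simp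
    show "\<eta>_G ` T \<subseteq> carrier G_hat" using T(2) by auto
    fix y assume "y \<in> \<eta>_G ` T"
    then obtain b where b: "b \<in> carrier G" "y = \<eta>_G b" using T(2) by blast
    obtain a where a: "a \<in> carrier P" "b \<otimes>\<^bsub>G\<^esub> inv\<^bsub>G\<^esub> f a \<in> derived G (carrier G)"
      using surj b(1) unfolding surj_modulo_def by blast
    have "\<eta>_G (b \<otimes>\<^bsub>G\<^esub> inv\<^bsub>G\<^esub> f a) \<in> derived G_hat (generate G_hat (\<eta>_G ` T))"
      unfolding gen using a(2) \<eta>.derived_img[of "carrier G"] by simp
    moreover have "\<eta>_G (b \<otimes>\<^bsub>G\<^esub> inv\<^bsub>G\<^esub> f a) = y \<otimes>\<^bsub>G_hat\<^esub> inv\<^bsub>G_hat\<^esub> f_hat (\<eta>_P a)"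
      using b a(1) hom_in_carrier[OF assms(3) a(1)] comm by simp
    ultimately show "\<exists>l\<in>carrier P_hat. y \<otimes>\<^bsub>G_hat\<^esub> inv\<^bsub>G_hat\<^esub> f_hat l \<in> derived G_hat (generate G_hat (\<eta>_G ` T))"
      using hom_in_carrier[OF \<eta>_P a(1)] by auto
  qed
  then have \<eta>_K: "\<eta>_G ` carrier G \<subseteq> f_hat ` carrier P_hat" by (simp add: gen)
  let ?K = "G_hat\<lparr>carrier := f_hat ` carrier P_hat\<rparr>"
  have K: "local_group ?K" by (rule local_group_image[OF P_hat G_hat(1) f_hat])
  have "\<eta>_G \<in> hom G ?K" using \<eta> \<eta>_K by (simp add: hom_def image_subset_iff_funcset)
  moreover have inj: "inj_on (\<lambda>x. Inr (Inl x) :: 'b + 'd + nat) X" for X by (simp add: inj_on_def)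
  ultimately obtain g where g: "g \<in> hom G_hat ?K" "\<And>x. x \<in> carrier G \<Longrightarrow> g (\<eta>_G x) = \<eta>_G x"
    using factors_uniquelyE[OF homology_localization_universal[OF loc K _ inj] G_hat(2) \<eta>] by blast
  have "g \<in> hom G_hat G_hat"
    using subsetD[OF subgroup.subset[OF f_hat.img_is_subgroup]] hom_in_carrier[OF g(1)] hom_mult[OF g(1)]
    by (intro homI) simp_all
  moreover have "(\<lambda>y. y) \<in> hom G_hat G_hat" by (rule iso_imp_homomorphism[OF iso_set_refl])
  ultimately have "g y = y" if "y \<in> carrier G_hat" for y
    by (rule factors_uniquely_unique[OF homology_localization_universal[OF loc G_hat(1) \<eta> inj] G_hat(2) \<eta>
          _ _ g(2) HOL.refl that])
  then have "carrier G_hat \<subseteq> f_hat ` carrier P_hat"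
    using hom_in_carrier[OF g(1)] by force
  then show ?thesis by auto
qed

subsection \<open>The induction along the lower central series\<close>

text \<open>Injectivity modulo the \<open>\<mu>\<close>-th terms identifies the kernel of the
  composite from \<open>P\<close> to the quotient of \<open>G\<close> with
  \<open>lower_central P \<mu>\<close>, so the commutator subgroups in \<open>quotient_step\<close>
  are the next terms of both series.\<close>

lemma lower_central_step:
  assumes "group P" "group G" and f: "f \<in> hom P G"
    and inj: "inj_modulo P (lower_central P \<mu>) (lower_central G \<mu>) f"
    and surj: "surj_modulo P G (lower_central G \<mu>) f"
    and ab_inj: "inj_modulo P (derived P (carrier P)) (derived G (carrier G)) f"
    and succ: "is_predecessor \<mu> \<nu>"
  shows "inj_modulo P (lower_central P \<nu>) (lower_central G \<nu>) f \<longleftrightarrow>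
    H2_epi_modulo P G (lower_central_quotient G \<mu>) (r_coset G (lower_central G \<mu>)) f"
proof -
  interpret f: group_hom P G f by (intro group_hom.intro group_hom_axioms.intro assms)
  interpret L: normal "lower_central G \<mu>" G by (rule f.H.lower_central_normal)
  interpret LP: normal "lower_central P \<mu>" P by (rule f.G.lower_central_normal)
  let ?p = "r_coset G (lower_central G \<mu>)"
  have onto: "(?p \<circ> f) ` carrier P = carrier (lower_central_quotient G \<mu>)"
  proof
    show "(?p \<circ> f) ` carrier P \<subseteq> carrier (lower_central_quotient G \<mu>)"
      by (auto simp: carrier_FactGroup)
    have "?p y \<in> (?p \<circ> f) ` carrier P" if y: "y \<in> carrier G" for y
    proof -
      obtain x where "x \<in> carrier P" "y \<otimes>\<^bsub>G\<^esub> inv\<^bsub>G\<^esub> f x \<in> lower_central G \<mu>"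
        using surj y unfolding surj_modulo_def by blast
      then show ?thesis using L.r_coset_eq_iff[OF y, of "f x"] by auto
    qed
    then show "carrier (lower_central_quotient G \<mu>) \<subseteq> (?p \<circ> f) ` carrier P"
      by (auto simp: carrier_FactGroup)
  qed
  interpret quotient_step G "lower_central_quotient G \<mu>" ?p P f
    by (intro quotient_step.intro quotient_step_axioms.intro group_epi.intro group_epi_axioms.intro
        L.r_coset_group_hom assms onto) (simp add: carrier_FactGroup)
  have N: "kernel G (lower_central_quotient G \<mu>) ?p = lower_central G \<mu>"
    by (rule L.kernel_r_coset)
  have "x \<in> kernel P (lower_central_quotient G \<mu>) (?p \<circ> f) \<longleftrightarrow> x \<in> lower_central P \<mu>" for x
  proof -
    have "x \<in> kernel P (lower_central_quotient G \<mu>) (?p \<circ> f) \<longleftrightarrow> x \<in> carrier P \<and> f x \<in> lower_central G \<mu>"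
      using L.r_coset_eq_self_iff[of "f x"] hom_in_carrier[OF assms(3), of x]
      unfolding kernel_def mem_Collect_eq comp_apply one_FactGroup by blast
    also have "\<dots> \<longleftrightarrow> x \<in> lower_central P \<mu>"
      using inj f.hom_lower_central[of \<mu>] LP.subset unfolding inj_modulo_def by blast
    finally show ?thesis .
  qed
  then have NP: "kernel P (lower_central_quotient G \<mu>) (?p \<circ> f) = lower_central P \<mu>" by blast
  show ?thesis
    using step_inj[OF _ ab_inj] step_H2_epi unfolding N NP lower_central_succ[OF succ] by blast
qed

lemma surj_modulo_mono: "surj_modulo P G X f \<Longrightarrow> X \<subseteq> Y \<Longrightarrow> surj_modulo P G Y f"
  unfolding surj_modulo_def by blast

text \<open>An isomorphism at \<open>\<kappa>\<close> descends to each
  \<open>\<mu> < \<kappa>\<close> and to its successor, and \<open>lower_central_step\<close>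
  converts this into the condition for \<open>\<mu>\<close>. In the other direction preimages modulo
  the earlier terms may vary with the ordinal, so at a limit \<open>limit_surj\<close> supplies a
  single one.\<close>

lemma lower_central_induction:
  fixes \<kappa> :: "'o::wellorder"
  assumes "group P" "group G" and f: "f \<in> hom P G"
    and ab_inj: "inj_modulo P (derived P (carrier P)) (derived G (carrier G)) f"
    and ab_surj: "surj_modulo P G (derived G (carrier G)) f"
    and limit_surj: "infinite {..<\<kappa>} \<Longrightarrow> f ` carrier P = carrier G"
  shows "inj_modulo P (lower_central P \<kappa>) (lower_central G \<kappa>) f \<and> surj_modulo P G (lower_central G \<kappa>) f
    \<longleftrightarrow> (\<forall>\<mu><\<kappa>. H2_epi_modulo P G (lower_central_quotient G \<mu>) (r_coset G (lower_central G \<mu>)) f)"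
    (is "?inj \<kappa> \<and> ?surj \<kappa> \<longleftrightarrow> (\<forall>\<mu><\<kappa>. ?E \<mu>)")
proof
  interpret f: group_hom P G f by (intro group_hom.intro group_hom_axioms.intro assms)
  {
    assume iso: "?inj \<kappa> \<and> ?surj \<kappa>"
    show "\<forall>\<mu><\<kappa>. ?E \<mu>"
    proof (intro allI impI)
      fix \<mu> assume \<mu>: "\<mu> < \<kappa>"
      define \<nu> where "\<nu> = (LEAST \<nu>. \<mu> < \<nu>)"
      have \<nu>: "is_predecessor \<mu> \<nu>" "\<nu> \<le> \<kappa>"
        unfolding \<nu>_def using is_predecessor_Least[OF \<mu>] by blast+
      have "?inj \<mu>" "?inj \<nu>"
        using f.inj_modulo_lower_central_antimono[OF conjunct1[OF iso] conjunct2[OF iso]] \<mu> \<nu>(2)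
        by auto
      moreover have "?surj \<mu>"
        using iso surj_modulo_mono f.H.lower_central_antimono[of \<mu> \<kappa>] \<mu> by fastforce
      ultimately show "?E \<mu>"
        using lower_central_step[OF assms(1-3) _ _ ab_inj \<nu>(1)] by blast
    qed
  next
    assume E: "\<forall>\<mu><\<kappa>. ?E \<mu>"
    have "?inj \<nu> \<and> ?surj \<nu>" if "\<nu> \<le> \<kappa>" for \<nu>
      using that
    proof (induction \<nu> rule: less_induct)
      case (less \<nu>)
      show ?case
      proof (cases \<nu> rule: ordinal_cases)
        case one
        then show ?thesis
          by (auto simp: inj_modulo_def surj_modulo_def lower_central_one intro!: bexI[of _ "\<one>\<^bsub>P\<^esub>"])
      next
        case (succ \<mu>)
        have \<mu>: "\<mu> < \<nu>" by (rule is_predecessor_less[OF succ])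
        have IH: "?inj \<mu>" "?surj \<mu>" using less.IH[OF \<mu>] less.prems \<mu> by auto
        have "?surj \<nu>"
          unfolding lower_central_succ[OF succ]
          by (rule surj_modulo_commutator_subgroup[OF assms(1-3) f.H.lower_central_normal IH(2) ab_surj])
        moreover have "?inj \<nu>"
          using lower_central_step[OF assms(1-3) IH ab_inj succ] E \<mu> less.prems by auto
        ultimately show ?thesis by blast
      next
        case limit
        \<comment> \<open>A limit stage \<open>\<nu> \<le> \<kappa>\<close> occurs only when
          \<open>\<kappa>\<close> is infinite.\<close>
        have "infinite {..<\<kappa>}"
          using infinite_lessThan_limit[OF limit] less.prems finite_subset[of "{..<\<nu>}" "{..<\<kappa>}"] by fastforce
        then have surj: "f ` carrier P = carrier G" by (rule limit_surj)
        interpret L: normal "lower_central G \<nu>" G by (rule f.H.lower_central_normal)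
        have "?surj \<nu>"
          unfolding surj_modulo_def
        proof
          fix y assume "y \<in> carrier G"
          then obtain x where x: "x \<in> carrier P" "y = f x" using surj by blast
          then have "y \<otimes>\<^bsub>G\<^esub> inv\<^bsub>G\<^esub> f x = \<one>\<^bsub>G\<^esub>" by simp
          then show "\<exists>x\<in>carrier P. y \<otimes>\<^bsub>G\<^esub> inv\<^bsub>G\<^esub> f x \<in> lower_central G \<nu>"
            using x(1) L.one_closed by (intro bexI[of _ x]) simp_all
        qed
        moreover have "?inj \<nu>"
          using less unfolding inj_modulo_def lower_central_limit[OF limit] by auto
        ultimately show ?thesis by blast
      qed
    qed
    then show "?inj \<kappa> \<and> ?surj \<kappa>" by simp
  }
qed

theorem theorem6p1:
  fixes P :: "'a monoid" and G :: "'b monoid"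
    and P_hat :: "'c monoid" and G_hat :: "'d monoid"
    and \<eta>_P :: "'a \<Rightarrow> 'c" and \<eta>_G :: "'b \<Rightarrow> 'd"
    and f :: "'a \<Rightarrow> 'b" and f_hat :: "'c \<Rightarrow> 'd"
    and \<kappa> :: "'o::wellorder"
  assumes "group P" and "group G"
    and "homology_localization P P_hat \<eta>_P"
    and "homology_localization G G_hat \<eta>_G"
    and "f \<in> hom P G"
    and "f_hat \<in> hom P_hat G_hat"
    and "\<forall>x\<in>carrier P. f_hat (\<eta>_P x) = \<eta>_G (f x)"
    and "ordinal_one < \<kappa>"
    and "group_homology_map 1 G f \<in> iso (group_homology 1 P) (group_homology 1 G)"
    and "infinite {..<\<kappa>} \<longrightarrow> finitely_generated_group G"
  shows "quotient_map G_hat (lower_central G_hat \<kappa>) f_hat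
           \<in> iso (lower_central_quotient P_hat \<kappa>) (lower_central_quotient G_hat \<kappa>)
     \<longleftrightarrow> (\<forall>\<mu><\<kappa>.
           r_coset (group_homology 2 G_hat) (H2_kernel G_hat \<mu>) \<circ> group_homology_map 2 G_hat f_hat
             \<in> epi (group_homology 2 P_hat) (group_homology 2 G_hat Mod H2_kernel G_hat \<mu>))"
proof -
  have P_hat: "local_group P_hat" "group P_hat" and \<eta>_P: "\<eta>_P \<in> hom P P_hat"
    and G_hat: "group G_hat" and \<eta>_G: "\<eta>_G \<in> hom G G_hat"
    using assms(3,4) by (auto simp: homology_localization_def local_group_def)
  interpret f_hat: group_hom P_hat G_hat f_hat
    by (intro group_hom.intro group_hom_axioms.intro P_hat G_hat assms(6))
  have comm: "f_hat (\<eta>_P x) = \<eta>_G (f x)" if "x \<in> carrier P" for x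
    using that assms(7) by blast
  have f: "inj_modulo P (derived P (carrier P)) (derived G (carrier G)) f"
    "surj_modulo P G (derived G (carrier G)) f"
    using assms(9) H1_iso_iff[OF assms(1,2,5)] by blast+
  \<comment> \<open>First homology is controlled for \<open>f\<close> only; the square with the two
    localizations passes this on to \<open>f_hat\<close>.\<close>
  note ab = abelianization_two_out_of_three[OF assms(1,2) P_hat(2) G_hat assms(5) \<eta>_P \<eta>_G assms(6) comm
      f(1) localization_inj_abelianization[OF assms(4)] f(2)
      localization_surj_abelianization[OF assms(3)] localization_surj_abelianization[OF assms(4)]]
  have "f_hat ` carrier P_hat = carrier G_hat" if "infinite {..<\<kappa>}"
    using localization_surjective[OF P_hat(1) assms(4,5) \<eta>_P assms(6) comm f(2)] assms(10) that by blast
  note induction = lower_central_induction[OF P_hat(2) G_hat assms(6) ab this]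
  have "quotient_map G_hat (lower_central G_hat \<kappa>) f_hat
      \<in> iso (lower_central_quotient P_hat \<kappa>) (lower_central_quotient G_hat \<kappa>) \<longleftrightarrow>
    inj_modulo P_hat (lower_central P_hat \<kappa>) (lower_central G_hat \<kappa>) f_hat \<and>
    surj_modulo P_hat G_hat (lower_central G_hat \<kappa>) f_hat"
    by (intro quotient_map_iso_iff P_hat(2) G_hat f_hat.G.lower_central_normal
        f_hat.H.lower_central_normal assms(6) f_hat.hom_lower_central)
  then show ?thesis
    unfolding H2_epi_iff[OF P_hat(2) G_hat assms(6)] using induction by blast
qed

end
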